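(* Let $(C,\overline{\otimes},e)$ be a closed symmetric monoidal category with finite limits and colimits, and let $\lambda$ be a cardinal. Let $V=\text{``}\mathrm{colim}"_{i\in I}V_i\in\mathrm{Ind}(C)$ where $V_i\in C$ and $I$ has cardinality less than $\lambda$. Let $W=\text{``}\mathrm{colim}"_{j\in J}W_j\in\mathrm{Ind}(C)$, with $W_j\in C$, where $J$ is $\lambda$-filtered. Assume that $W$ is nuclear in $\mathrm{Ind}(C)$. Then the natural morphism $$\Big(\lim_{i\in I}(V_i^\vee)\Big)\overline{\otimes}W\to\lim_{i\in I}(V_i^\vee\overline{\otimes}W)$$ is an isomorphism. Also, if $\lambda=\aleph_1$ and $V_1,V_2,V_3,\dots$ is a countable list of objects in $C$, the natural morphism $$\Big(\prod_{i}(V_i^\vee)\Big)\overline{\otimes}W\to\prod_{i}(V_i^\vee\overline{\otimes}W)$$ is an isomorphism.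
   Context: $\underline{\mathrm{Hom}}$ denotes the internal Hom and $V^\vee=\underline{\mathrm{Hom}}(V,e)$; the main example is $C=\mathrm{Ban}_R$, the category of Banach modules over a Banach ring $R$ with bounded $R$-linear maps and the completed projective tensor product. $\mathrm{Ind}(C)$ is the ind-completion of $C$ with the extended closed symmetric monoidal structure $(\text{``}\mathrm{colim}"_iE_i)\overline{\otimes}(\text{``}\mathrm{colim}"_jF_j)=\text{``}\mathrm{colim}"_{(i,j)}E_i\overline{\otimes}F_j$ and $\underline{\mathrm{Hom}}(\text{``}\mathrm{colim}"_iE_i,\text{``}\mathrm{colim}"_jF_j)=\lim_i\text{``}\mathrm{colim}"_j\underline{\mathrm{Hom}}(E_i,F_j)$; the index posets in formal colimits are filtered. Limits and products are taken in $\mathrm{Ind}(C)$. An object $W$ of $\mathrm{Ind}(C)$ is nuclear if for every object $X$ of $C$ the natural morphism $X^\vee\overline{\otimes}W\to\underline{\mathrm{Hom}}(X,W)$ is an isomorphism. A poset $J$ is $\lambda$-filtered if any subset $S\subset J$ with $|S|<\lambda$ has an upper bound. *)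

theory Defs
  imports Main
begin

unbundle cardinal_syntax

record ('o, 'm) cat =
  Ob :: "'o set"
  Ar :: "'m set"
  Dom :: "'m \<Rightarrow> 'o"
  Cod :: "'m \<Rightarrow> 'o"
  Idn :: "'o \<Rightarrow> 'm"
  Cmp :: "'m \<Rightarrow> 'm \<Rightarrow> 'm"  (infixr \<open>\<cdot>\<index>\<close> 68)

definition homs :: "('o, 'm, 'z) cat_scheme \<Rightarrow> 'o \<Rightarrow> 'o \<Rightarrow> 'm set" where
  "homs C A B = {f \<in> Ar C. Dom C f = A \<and> Cod C f = B}"

locale category =
  fixes C :: "('o, 'm, 'z) cat_scheme" (structure)
  assumes dom_ob: "f \<in> Ar C \<Longrightarrow> Dom C f \<in> Ob C"
    and cod_ob: "f \<in> Ar C \<Longrightarrow> Cod C f \<in> Ob C"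
    and idn_homs: "A \<in> Ob C \<Longrightarrow> Idn C A \<in> homs C A A"
    and cmp_homs: "\<lbrakk>f \<in> homs C A B; g \<in> homs C B D\<rbrakk> \<Longrightarrow> g \<cdot> f \<in> homs C A D"
    and cmp_idn: "f \<in> homs C A B \<Longrightarrow> f \<cdot> Idn C A = f"
    and idn_cmp: "f \<in> homs C A B \<Longrightarrow> Idn C B \<cdot> f = f"
    and cmp_assoc: "\<lbrakk>f \<in> homs C A B; g \<in> homs C B D; h \<in> homs C D E\<rbrakk>
                    \<Longrightarrow> (h \<cdot> g) \<cdot> f = h \<cdot> (g \<cdot> f)"

definition inverse_arrows :: "('o, 'm, 'z) cat_scheme \<Rightarrow> 'm \<Rightarrow> 'm \<Rightarrow> bool" where
  "inverse_arrows C f g \<longleftrightarrow> f \<in> Ar C \<and> g \<in> homs C (Cod C f) (Dom C f) \<and>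
     g \<cdot>\<^bsub>C\<^esub> f = Idn C (Dom C f) \<and> f \<cdot>\<^bsub>C\<^esub> g = Idn C (Cod C f)"

definition is_iso :: "('o, 'm, 'z) cat_scheme \<Rightarrow> 'm \<Rightarrow> bool" where
  "is_iso C f \<longleftrightarrow> (\<exists>g. inverse_arrows C f g)"

definition inv_ar :: "('o, 'm, 'z) cat_scheme \<Rightarrow> 'm \<Rightarrow> 'm" where
  "inv_ar C f = (THE g. inverse_arrows C f g)"

definition opposite :: "('o, 'm, 'z) cat_scheme \<Rightarrow> ('o, 'm) cat" where
  "opposite C = \<lparr>Ob = Ob C, Ar = Ar C, Dom = Cod C, Cod = Dom C, Idn = Idn C,
                 Cmp = (\<lambda>g f. f \<cdot>\<^bsub>C\<^esub> g)\<rparr>"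

text \<open>In \<open>poset_cat P r\<close> the pair \<open>(i, j)\<close> is the arrow from \<open>i\<close> to \<open>j\<close>, present iff \<open>i \<le> j\<close>.\<close>

definition poset_cat :: "'x set \<Rightarrow> 'x rel \<Rightarrow> ('x, 'x \<times> 'x) cat" where
  "poset_cat P r = \<lparr>Ob = P, Ar = r \<inter> (P \<times> P), Dom = fst, Cod = snd, Idn = (\<lambda>i. (i, i)),
                    Cmp = (\<lambda>g f. (fst f, snd g))\<rparr>"

record ('i, 'a, 'o, 'm) diagram =
  fob :: "'i \<Rightarrow> 'o"
  far :: "'a \<Rightarrow> 'm"

definition is_functor ::
  "('i, 'a, 'y) cat_scheme \<Rightarrow> ('o, 'm, 'z) cat_scheme \<Rightarrow> ('i, 'a, 'o, 'm, 'w) diagram_scheme \<Rightarrow> bool"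
  where
  "is_functor J C F \<longleftrightarrow>
     (\<forall>i \<in> Ob J. fob F i \<in> Ob C) \<and>
     (\<forall>i \<in> Ob J. \<forall>j \<in> Ob J. \<forall>a \<in> homs J i j. far F a \<in> homs C (fob F i) (fob F j)) \<and>
     (\<forall>i \<in> Ob J. far F (Idn J i) = Idn C (fob F i)) \<and>
     (\<forall>a \<in> Ar J. \<forall>b \<in> Ar J. Dom J b = Cod J a \<longrightarrow> far F (b \<cdot>\<^bsub>J\<^esub> a) = far F b \<cdot>\<^bsub>C\<^esub> far F a)"

definition is_cone ::
  "('i, 'a, 'y) cat_scheme \<Rightarrow> ('o, 'm, 'z) cat_scheme \<Rightarrow> ('i, 'a, 'o, 'm, 'w) diagram_scheme
    \<Rightarrow> 'o \<Rightarrow> ('i \<Rightarrow> 'm) \<Rightarrow> bool" where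
  "is_cone J C F L p \<longleftrightarrow> L \<in> Ob C \<and>
     (\<forall>i \<in> Ob J. p i \<in> homs C L (fob F i)) \<and>
     (\<forall>a \<in> Ar J. far F a \<cdot>\<^bsub>C\<^esub> p (Dom J a) = p (Cod J a))"

definition is_limit ::
  "('i, 'a, 'y) cat_scheme \<Rightarrow> ('o, 'm, 'z) cat_scheme \<Rightarrow> ('i, 'a, 'o, 'm, 'w) diagram_scheme
    \<Rightarrow> 'o \<Rightarrow> ('i \<Rightarrow> 'm) \<Rightarrow> bool" where
  "is_limit J C F L p \<longleftrightarrow> is_cone J C F L p \<and>
     (\<forall>X r. is_cone J C F X r \<longrightarrow> (\<exists>!u. u \<in> homs C X L \<and> (\<forall>i \<in> Ob J. p i \<cdot>\<^bsub>C\<^esub> u = r i)))"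

definition is_colimit ::
  "('i, 'a, 'y) cat_scheme \<Rightarrow> ('o, 'm, 'z) cat_scheme \<Rightarrow> ('i, 'a, 'o, 'm, 'w) diagram_scheme
    \<Rightarrow> 'o \<Rightarrow> ('i \<Rightarrow> 'm) \<Rightarrow> bool" where
  "is_colimit J C F L p \<longleftrightarrow> is_limit (opposite J) (opposite C) F L p"

text \<open>The morphism \<open>X \<rightarrow> L\<close> induced by a cone \<open>r\<close> with apex \<open>X\<close>, where \<open>L\<close> is a limit with
  projections \<open>p i\<close>, \<open>i \<in> I\<close>.\<close>

definition induced ::
  "('o, 'm, 'z) cat_scheme \<Rightarrow> 'i set \<Rightarrow> 'o \<Rightarrow> ('i \<Rightarrow> 'm) \<Rightarrow> 'o \<Rightarrow> ('i \<Rightarrow> 'm) \<Rightarrow> 'm" where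
  "induced C I L p X r = (THE u. u \<in> homs C X L \<and> (\<forall>i \<in> I. p i \<cdot>\<^bsub>C\<^esub> u = r i))"

definition is_product ::
  "('o, 'm, 'z) cat_scheme \<Rightarrow> 'i set \<Rightarrow> ('i \<Rightarrow> 'o) \<Rightarrow> 'o \<Rightarrow> ('i \<Rightarrow> 'm) \<Rightarrow> bool" where
  "is_product C I A P p \<longleftrightarrow>
     is_limit (poset_cat I (Id_on I)) C \<lparr>fob = A, far = (\<lambda>a. Idn C (A (fst a)))\<rparr> P p"

text \<open>Every finite category is isomorphic to one whose objects and arrows are natural numbers,
  so it suffices to let the shapes range over \<open>(nat, nat) cat\<close>.\<close>

definition has_finite_limits :: "('o, 'm, 'z) cat_scheme \<Rightarrow> bool" where
  "has_finite_limits C \<longleftrightarrow>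
     (\<forall>(J :: (nat, nat) cat) (F :: (nat, nat, 'o, 'm) diagram).
        category J \<and> finite (Ob J) \<and> finite (Ar J) \<and> is_functor J C F \<longrightarrow>
        (\<exists>L p. is_limit J C F L p))"

definition has_finite_colimits :: "('o, 'm, 'z) cat_scheme \<Rightarrow> bool" where
  "has_finite_colimits C \<longleftrightarrow>
     (\<forall>(J :: (nat, nat) cat) (F :: (nat, nat, 'o, 'm) diagram).
        category J \<and> finite (Ob J) \<and> finite (Ar J) \<and> is_functor J C F \<longrightarrow>
        (\<exists>L p. is_colimit J C F L p))"


record ('o, 'm) csm_cat = "('o, 'm) cat" +
  tob :: "'o \<Rightarrow> 'o \<Rightarrow> 'o"  (infixr \<open>\<otimes>\<index>\<close> 72)
  tar :: "'m \<Rightarrow> 'm \<Rightarrow> 'm"  (infixr \<open>\<odot>\<index>\<close> 72)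
  unt :: "'o"
  asc :: "'o \<Rightarrow> 'o \<Rightarrow> 'o \<Rightarrow> 'm"
  lun :: "'o \<Rightarrow> 'm"
  run :: "'o \<Rightarrow> 'm"
  braid :: "'o \<Rightarrow> 'o \<Rightarrow> 'm"
  ihom :: "'o \<Rightarrow> 'o \<Rightarrow> 'o"
  evl :: "'o \<Rightarrow> 'o \<Rightarrow> 'm"

locale closed_symmetric_monoidal = category M
  for M :: "('o, 'm, 'z) csm_cat_scheme" (structure) +
  assumes tob_ob: "\<lbrakk>A \<in> Ob M; B \<in> Ob M\<rbrakk> \<Longrightarrow> A \<otimes> B \<in> Ob M"
    and unt_ob: "unt M \<in> Ob M"
    and tar_homs: "\<lbrakk>f \<in> homs M A A'; g \<in> homs M B B'\<rbrakk> \<Longrightarrow> f \<odot> g \<in> homs M (A \<otimes> B) (A' \<otimes> B')"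
    and tar_idn: "\<lbrakk>A \<in> Ob M; B \<in> Ob M\<rbrakk> \<Longrightarrow> Idn M A \<odot> Idn M B = Idn M (A \<otimes> B)"
    and tar_cmp: "\<lbrakk>f \<in> homs M A A'; f' \<in> homs M A' A''; g \<in> homs M B B'; g' \<in> homs M B' B''\<rbrakk>
        \<Longrightarrow> (f' \<cdot> f) \<odot> (g' \<cdot> g) = (f' \<odot> g') \<cdot> (f \<odot> g)"
    and asc_homs: "\<lbrakk>A \<in> Ob M; B \<in> Ob M; D \<in> Ob M\<rbrakk>
        \<Longrightarrow> asc M A B D \<in> homs M ((A \<otimes> B) \<otimes> D) (A \<otimes> (B \<otimes> D))"
    and asc_iso: "\<lbrakk>A \<in> Ob M; B \<in> Ob M; D \<in> Ob M\<rbrakk> \<Longrightarrow> is_iso M (asc M A B D)"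
    and asc_nat: "\<lbrakk>f \<in> homs M A A'; g \<in> homs M B B'; h \<in> homs M D D'\<rbrakk>
        \<Longrightarrow> asc M A' B' D' \<cdot> ((f \<odot> g) \<odot> h) = (f \<odot> (g \<odot> h)) \<cdot> asc M A B D"
    and lun_homs: "A \<in> Ob M \<Longrightarrow> lun M A \<in> homs M (unt M \<otimes> A) A"
    and lun_iso: "A \<in> Ob M \<Longrightarrow> is_iso M (lun M A)"
    and lun_nat: "f \<in> homs M A A' \<Longrightarrow> lun M A' \<cdot> (Idn M (unt M) \<odot> f) = f \<cdot> lun M A"
    and run_homs: "A \<in> Ob M \<Longrightarrow> run M A \<in> homs M (A \<otimes> unt M) A"
    and run_iso: "A \<in> Ob M \<Longrightarrow> is_iso M (run M A)"
    and run_nat: "f \<in> homs M A A' \<Longrightarrow> run M A' \<cdot> (f \<odot> Idn M (unt M)) = f \<cdot> run M A"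
    and braid_homs: "\<lbrakk>A \<in> Ob M; B \<in> Ob M\<rbrakk> \<Longrightarrow> braid M A B \<in> homs M (A \<otimes> B) (B \<otimes> A)"
    and braid_nat: "\<lbrakk>f \<in> homs M A A'; g \<in> homs M B B'\<rbrakk>
        \<Longrightarrow> braid M A' B' \<cdot> (f \<odot> g) = (g \<odot> f) \<cdot> braid M A B"
    and braid_braid: "\<lbrakk>A \<in> Ob M; B \<in> Ob M\<rbrakk> \<Longrightarrow> braid M B A \<cdot> braid M A B = Idn M (A \<otimes> B)"
    and pentagon: "\<lbrakk>A \<in> Ob M; B \<in> Ob M; D \<in> Ob M; E \<in> Ob M\<rbrakk>
        \<Longrightarrow> asc M A B (D \<otimes> E) \<cdot> asc M (A \<otimes> B) D E
            = (Idn M A \<odot> asc M B D E) \<cdot> asc M A (B \<otimes> D) E \<cdot> (asc M A B D \<odot> Idn M E)"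
    and triangle: "\<lbrakk>A \<in> Ob M; B \<in> Ob M\<rbrakk>
        \<Longrightarrow> (Idn M A \<odot> lun M B) \<cdot> asc M A (unt M) B = run M A \<odot> Idn M B"
    and hexagon: "\<lbrakk>A \<in> Ob M; B \<in> Ob M; D \<in> Ob M\<rbrakk>
        \<Longrightarrow> asc M B D A \<cdot> braid M A (B \<otimes> D) \<cdot> asc M A B D
            = (Idn M B \<odot> braid M A D) \<cdot> asc M B A D \<cdot> (braid M A B \<odot> Idn M D)"
    and ihom_ob: "\<lbrakk>A \<in> Ob M; B \<in> Ob M\<rbrakk> \<Longrightarrow> ihom M A B \<in> Ob M"
    and evl_homs: "\<lbrakk>A \<in> Ob M; B \<in> Ob M\<rbrakk> \<Longrightarrow> evl M A B \<in> homs M (ihom M A B \<otimes> A) B"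
    and evl_universal: "\<lbrakk>X \<in> Ob M; A \<in> Ob M; B \<in> Ob M; f \<in> homs M (X \<otimes> A) B\<rbrakk>
        \<Longrightarrow> \<exists>!g. g \<in> homs M X (ihom M A B) \<and> evl M A B \<cdot> (g \<odot> Idn M A) = f"

definition curried ::
  "('o, 'm, 'z) csm_cat_scheme \<Rightarrow> 'o \<Rightarrow> 'o \<Rightarrow> 'o \<Rightarrow> 'm \<Rightarrow> 'm" where
  "curried M X A B f =
     (THE g. g \<in> homs M X (ihom M A B) \<and> evl M A B \<cdot>\<^bsub>M\<^esub> (g \<odot>\<^bsub>M\<^esub> Idn M A) = f)"

definition ihom_post :: "('o, 'm, 'z) csm_cat_scheme \<Rightarrow> 'o \<Rightarrow> 'm \<Rightarrow> 'm" where
  "ihom_post M X f =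
     curried M (ihom M X (Dom M f)) X (Cod M f) (f \<cdot>\<^bsub>M\<^esub> evl M X (Dom M f))"

definition dual :: "('o, 'm, 'z) csm_cat_scheme \<Rightarrow> 'o \<Rightarrow> 'o" where
  "dual M A = ihom M A (unt M)"

definition dual_ar :: "('o, 'm, 'z) csm_cat_scheme \<Rightarrow> 'm \<Rightarrow> 'm" where
  "dual_ar M f = curried M (dual M (Cod M f)) (Dom M f) (unt M)
     (evl M (Cod M f) (unt M) \<cdot>\<^bsub>M\<^esub> (Idn M (dual M (Cod M f)) \<odot>\<^bsub>M\<^esub> f))"

text \<open>The adjoint of
  \<open>(X\<^sup>\<or> \<otimes> B) \<otimes> X \<cong> X\<^sup>\<or> \<otimes> (B \<otimes> X) \<cong> X\<^sup>\<or> \<otimes> (X \<otimes> B) \<cong> (X\<^sup>\<or> \<otimes> X) \<otimes> B \<rightarrow> e \<otimes> B \<cong> B\<close>.\<close>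

definition dual_tensor_to_ihom :: "('o, 'm, 'z) csm_cat_scheme \<Rightarrow> 'o \<Rightarrow> 'o \<Rightarrow> 'm" where
  "dual_tensor_to_ihom M X B = curried M (dual M X \<otimes>\<^bsub>M\<^esub> B) X B
     (lun M B \<cdot>\<^bsub>M\<^esub> (evl M X (unt M) \<odot>\<^bsub>M\<^esub> Idn M B) \<cdot>\<^bsub>M\<^esub> inv_ar M (asc M (dual M X) X B)
      \<cdot>\<^bsub>M\<^esub> (Idn M (dual M X) \<odot>\<^bsub>M\<^esub> braid M B X) \<cdot>\<^bsub>M\<^esub> asc M (dual M X) B X)"


text \<open>The elements of \<open>'u ix\<close> serve as indices of formal colimits; \<open>'u\<close> bounds the size of the
  index posets that are admitted, so \<open>Ind C\<close> below is the ind-completion relative to a universe of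
  index sets, and statements are to be read as polymorphic in \<open>'u\<close>. The constructors \<open>Point\<close> and
  \<open>Duo\<close> provide the index of a constant object and products of index posets.\<close>

datatype 'u ix = Point | Atom 'u | Duo (duo1: "'u ix") (duo2: "'u ix")

text \<open>An object \<open>"colim"_i E_i\<close> is a functor from a filtered poset \<open>(idx E, ile E)\<close>, with values
  \<open>fob E i\<close> and transition morphisms \<open>far E (i, j)\<close>.\<close>

record ('x, 'o, 'm) ind_ob = "('x, 'x \<times> 'x, 'o, 'm) diagram" +
  idx :: "'x set"
  ile :: "'x rel"

definition filtered_poset :: "'x set \<Rightarrow> 'x rel \<Rightarrow> bool" where
  "filtered_poset P r \<longleftrightarrow> partial_order_on P r \<and> P \<noteq> {} \<and>
     (\<forall>i \<in> P. \<forall>j \<in> P. \<exists>k \<in> P. (i, k) \<in> r \<and> (j, k) \<in> r)"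

abbreviation index_cat :: "('x, 'o, 'm) ind_ob \<Rightarrow> ('x, 'x \<times> 'x) cat" where
  "index_cat E \<equiv> poset_cat (idx E) (ile E)"

definition is_ind_ob :: "('o, 'm, 'z) cat_scheme \<Rightarrow> ('x, 'o, 'm) ind_ob \<Rightarrow> bool" where
  "is_ind_ob C E \<longleftrightarrow> filtered_poset (idx E) (ile E) \<and> is_functor (index_cat E) C E"

text \<open>The class of \<open>f : X \<rightarrow> F_j\<close> in \<open>colim_k Hom(X, F_k)\<close>, as a set of pairs \<open>(k, g)\<close>
  with \<open>g : X \<rightarrow> F_k\<close>.\<close>

definition germ ::
  "('o, 'm, 'z) cat_scheme \<Rightarrow> ('x, 'o, 'm) ind_ob \<Rightarrow> 'x \<Rightarrow> 'm \<Rightarrow> ('x \<times> 'm) set" where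
  "germ C F j f = {(k, g). k \<in> idx F \<and> g \<in> homs C (Dom C f) (fob F k) \<and>
     (\<exists>l \<in> idx F. (j, l) \<in> ile F \<and> (k, l) \<in> ile F \<and>
        far F (j, l) \<cdot>\<^bsub>C\<^esub> f = far F (k, l) \<cdot>\<^bsub>C\<^esub> g)}"

text \<open>A morphism \<open>E \<rightarrow> F\<close> is an element of \<open>lim_i colim_j Hom(E_i, F_j)\<close>; its component at
  \<open>i\<close> is \<open>ifam \<phi> i\<close>, which is empty by convention if \<open>i\<close> is not an index of \<open>E\<close>.\<close>

record ('x, 'o, 'm) ind_ar =
  isrc :: "('x, 'o, 'm) ind_ob"
  itgt :: "('x, 'o, 'm) ind_ob"
  ifam :: "'x \<Rightarrow> ('x \<times> 'm) set"

definition is_ind_ar :: "('o, 'm, 'z) cat_scheme \<Rightarrow> ('x, 'o, 'm) ind_ar \<Rightarrow> bool" where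
  "is_ind_ar C \<phi> \<longleftrightarrow> is_ind_ob C (isrc \<phi>) \<and> is_ind_ob C (itgt \<phi>) \<and>
     (\<forall>i \<in> idx (isrc \<phi>). \<exists>j \<in> idx (itgt \<phi>). \<exists>f \<in> homs C (fob (isrc \<phi>) i) (fob (itgt \<phi>) j).
        ifam \<phi> i = germ C (itgt \<phi>) j f) \<and>
     (\<forall>(i, i') \<in> ile (isrc \<phi>). \<forall>(j, f) \<in> ifam \<phi> i'.
        (j, f \<cdot>\<^bsub>C\<^esub> far (isrc \<phi>) (i, i')) \<in> ifam \<phi> i) \<and>
     (\<forall>i. i \<notin> idx (isrc \<phi>) \<longrightarrow> ifam \<phi> i = {})"

text \<open>The morphism given by representatives \<open>f i : E_i \<rightarrow> F_(s i)\<close>.\<close>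

definition ind_rep ::
  "('o, 'm, 'z) cat_scheme \<Rightarrow> ('x, 'o, 'm) ind_ob \<Rightarrow> ('x, 'o, 'm) ind_ob \<Rightarrow> ('x \<Rightarrow> 'x) \<Rightarrow> ('x \<Rightarrow> 'm)
    \<Rightarrow> ('x, 'o, 'm) ind_ar" where
  "ind_rep C E F s f =
     \<lparr>isrc = E, itgt = F, ifam = (\<lambda>i. if i \<in> idx E then germ C F (s i) (f i) else {})\<rparr>"

definition ind_cmp ::
  "('o, 'm, 'z) cat_scheme \<Rightarrow> ('x, 'o, 'm) ind_ar \<Rightarrow> ('x, 'o, 'm) ind_ar \<Rightarrow> ('x, 'o, 'm) ind_ar" where
  "ind_cmp C \<psi> \<phi> = \<lparr>isrc = isrc \<phi>, itgt = itgt \<psi>,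
     ifam = (\<lambda>i. \<Union>(j, f) \<in> ifam \<phi> i. \<Union>(k, g) \<in> ifam \<psi> j. germ C (itgt \<psi>) k (g \<cdot>\<^bsub>C\<^esub> f))\<rparr>"

definition Ind ::
  "('o, 'm, 'z) cat_scheme \<Rightarrow> (('u ix, 'o, 'm) ind_ob, ('u ix, 'o, 'm) ind_ar) cat" where
  "Ind C = \<lparr>Ob = {E. is_ind_ob C E}, Ar = {\<phi>. is_ind_ar C \<phi>}, Dom = isrc, Cod = itgt,
     Idn = (\<lambda>E. ind_rep C E E (\<lambda>i. i) (\<lambda>i. Idn C (fob E i))), Cmp = ind_cmp C\<rparr>"

definition const_ob :: "('o, 'm, 'z) cat_scheme \<Rightarrow> 'o \<Rightarrow> ('u ix, 'o, 'm) ind_ob" where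
  "const_ob C X = \<lparr>fob = (\<lambda>_. X), far = (\<lambda>_. Idn C X), idx = {Point}, ile = {(Point, Point)}\<rparr>"

definition const_ar :: "('o, 'm, 'z) cat_scheme \<Rightarrow> 'm \<Rightarrow> ('u ix, 'o, 'm) ind_ar" where
  "const_ar C f =
     ind_rep C (const_ob C (Dom C f)) (const_ob C (Cod C f)) (\<lambda>_. Point) (\<lambda>_. f)"

definition ind_tensor ::
  "('o, 'm, 'z) csm_cat_scheme \<Rightarrow> ('u ix, 'o, 'm) ind_ob \<Rightarrow> ('u ix, 'o, 'm) ind_ob
    \<Rightarrow> ('u ix, 'o, 'm) ind_ob" where
  "ind_tensor M E F =
     \<lparr>fob = (\<lambda>x. fob E (duo1 x) \<otimes>\<^bsub>M\<^esub> fob F (duo2 x)),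
      far = (\<lambda>(x, y). far E (duo1 x, duo1 y) \<odot>\<^bsub>M\<^esub> far F (duo2 x, duo2 y)),
      idx = {Duo i j |i j. i \<in> idx E \<and> j \<in> idx F},
      ile = {(Duo i j, Duo i' j') |i j i' j'. (i, i') \<in> ile E \<and> (j, j') \<in> ile F}\<rparr>"

definition ind_tensor_ar ::
  "('o, 'm, 'z) csm_cat_scheme \<Rightarrow> ('u ix, 'o, 'm) ind_ar \<Rightarrow> ('u ix, 'o, 'm) ind_ar
    \<Rightarrow> ('u ix, 'o, 'm) ind_ar" where
  "ind_tensor_ar M \<phi> \<psi> =
     \<lparr>isrc = ind_tensor M (isrc \<phi>) (isrc \<psi>), itgt = ind_tensor M (itgt \<phi>) (itgt \<psi>),
      ifam = (\<lambda>x. if x \<in> idx (ind_tensor M (isrc \<phi>) (isrc \<psi>)) then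
                \<Union>(k, f) \<in> ifam \<phi> (duo1 x). \<Union>(l, g) \<in> ifam \<psi> (duo2 x).
                  germ M (ind_tensor M (itgt \<phi>) (itgt \<psi>)) (Duo k l) (f \<odot>\<^bsub>M\<^esub> g)
              else {})\<rparr>"

text \<open>The internal Hom from an object \<open>X\<close> of \<open>C\<close> to \<open>"colim"_j W_j\<close>. The limit in the formula for
  the internal Hom runs over a single index here, which leaves \<open>"colim"_j Hom(X, W_j)\<close>.\<close>

definition ind_ihom ::
  "('o, 'm, 'z) csm_cat_scheme \<Rightarrow> 'o \<Rightarrow> ('u ix, 'o, 'm) ind_ob \<Rightarrow> ('u ix, 'o, 'm) ind_ob" where
  "ind_ihom M X W = W\<lparr>fob := (\<lambda>j. ihom M X (fob W j)), far := (\<lambda>a. ihom_post M X (far W a))\<rparr>"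

definition dual_tensor_to_ind_ihom ::
  "('o, 'm, 'z) csm_cat_scheme \<Rightarrow> 'o \<Rightarrow> ('u ix, 'o, 'm) ind_ob \<Rightarrow> ('u ix, 'o, 'm) ind_ar" where
  "dual_tensor_to_ind_ihom M X W =
     ind_rep M (ind_tensor M (const_ob M (dual M X)) W) (ind_ihom M X W)
       duo2 (\<lambda>x. dual_tensor_to_ihom M X (fob W (duo2 x)))"

definition nuclear :: "('o, 'm, 'z) csm_cat_scheme \<Rightarrow> ('u ix, 'o, 'm) ind_ob \<Rightarrow> bool" where
  "nuclear M W \<longleftrightarrow> (\<forall>X \<in> Ob M. is_iso (Ind M) (dual_tensor_to_ind_ihom M X W))"


definition lambda_filtered :: "'l rel \<Rightarrow> 'x set \<Rightarrow> 'x rel \<Rightarrow> bool" where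
  "lambda_filtered lam P r \<longleftrightarrow> (\<forall>S. S \<subseteq> P \<and> |S| <o lam \<longrightarrow> (\<exists>k \<in> P. \<forall>i \<in> S. (i, k) \<in> r))"

text \<open>The diagram \<open>i \<mapsto> (V_i)\<^sup>\<or>\<close> of shape \<open>opposite (index_cat V)\<close> in \<open>Ind M\<close>; the arrow
  \<open>(i, j)\<close> of the index category runs from \<open>j\<close> to \<open>i\<close> in the opposite category.\<close>

definition dual_diagram ::
  "('o, 'm, 'z) csm_cat_scheme \<Rightarrow> ('u ix, 'o, 'm) ind_ob
    \<Rightarrow> ('u ix, 'u ix \<times> 'u ix, ('u ix, 'o, 'm) ind_ob, ('u ix, 'o, 'm) ind_ar) diagram" where
  "dual_diagram M V = \<lparr>fob = (\<lambda>i. const_ob M (dual M (fob V i))),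
                       far = (\<lambda>a. const_ar M (dual_ar M (far V a)))\<rparr>"

definition tensor_diagram ::
  "('o, 'm, 'z) csm_cat_scheme \<Rightarrow> ('i, 'a, ('u ix, 'o, 'm) ind_ob, ('u ix, 'o, 'm) ind_ar) diagram
    \<Rightarrow> ('u ix, 'o, 'm) ind_ob \<Rightarrow> ('i, 'a, ('u ix, 'o, 'm) ind_ob, ('u ix, 'o, 'm) ind_ar) diagram" where
  "tensor_diagram M D W = \<lparr>fob = (\<lambda>i. ind_tensor M (fob D i) W),
                           far = (\<lambda>a. ind_tensor_ar M (far D a) (Idn (Ind M) W))\<rparr>"

text \<open>If \<open>(L, p)\<close> is a limit of a diagram \<open>D\<close> indexed by \<open>I\<close>, and \<open>(N, q)\<close> a limit of
  \<open>D \<otimes> W\<close>, the natural morphism \<open>L \<otimes> W \<rightarrow> N\<close>.\<close>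

definition tensor_comparison ::
  "('o, 'm, 'z) csm_cat_scheme \<Rightarrow> 'i set \<Rightarrow> ('u ix, 'o, 'm) ind_ob
    \<Rightarrow> ('u ix, 'o, 'm) ind_ob \<Rightarrow> ('i \<Rightarrow> ('u ix, 'o, 'm) ind_ar)
    \<Rightarrow> ('u ix, 'o, 'm) ind_ob \<Rightarrow> ('i \<Rightarrow> ('u ix, 'o, 'm) ind_ar) \<Rightarrow> ('u ix, 'o, 'm) ind_ar" where
  "tensor_comparison M I W L p N q =
     induced (Ind M) I N q (ind_tensor M L W) (\<lambda>i. ind_tensor_ar M (p i) (Idn (Ind M) W))"

end

theory Submission
  imports Defs
begin

text \<open>
  The key point is that nuclearity makes the transition morphisms of \<open>W\<close> trace class. Applying the
  inverse of \<open>W_j\<^sup>\<or> \<otimes> W \<rightarrow> Hom(W_j, W)\<close> to the identity of \<open>W_j\<close> yields an index \<open>j' \<ge> j\<close> and a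
  morphism \<open>t : e \<rightarrow> W_j\<^sup>\<or> \<otimes> W_j'\<close> that induces the transition \<open>\<tau> : W_j \<rightarrow> W_j'\<close>
  (\<open>nuclear_trace_class\<close>). With \<open>D = W_j\<^sup>\<or>\<close>, evaluation contracts a morphism \<open>X \<rightarrow> A \<otimes> W_j\<close> to
  \<open>X \<otimes> D \<rightarrow> A\<close>, and \<open>t\<close> expands a morphism \<open>X \<otimes> D \<rightarrow> A\<close> to \<open>X \<rightarrow> A \<otimes> W_j'\<close>; both are natural in \<open>A\<close>,
  and doing one after the other is composition with \<open>A \<otimes> \<tau>\<close> (\<open>expand_contract\<close>).

  Let \<open>L\<close> be the limit of the duals \<open>V_i\<^sup>\<or>\<close>, and let \<open>X\<close> be an object of the base category. A cone from
  \<open>X\<close> to the objects \<open>V_i\<^sup>\<or> \<otimes> W\<close> consists of fewer than \<open>\<lambda>\<close> morphisms, which satisfy finitely many or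
  fewer than \<open>\<lambda>\<close> compatibilities. As the index poset of \<open>W\<close> is \<open>\<lambda>\<close>-filtered, the cone is represented by
  a strict cone into \<open>V_i\<^sup>\<or> \<otimes> W_j\<close> for a single \<open>j\<close>. Contracting gives a
  cone from \<open>X \<otimes> D\<close> to \<open>V_i\<^sup>\<or>\<close>, that is, a morphism \<open>X \<otimes> D \<rightarrow> L\<close>, and expanding it gives the required
  \<open>X \<rightarrow> L \<otimes> W\<close> (\<open>LW_germ_exists\<close>). The same device shows its uniqueness (\<open>LW_germ_unique\<close>). Morphisms
  from a general ind-object are glued from its components, so \<open>L \<otimes> W\<close> is a limit of \<open>V_i\<^sup>\<or> \<otimes> W\<close>
  (\<open>tensor_limit\<close>), and the natural morphism is an isomorphism by uniqueness of limits. Products are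
  the case of a discrete index poset.
\<close>

section \<open>Composition and limits in a category\<close>

lemma homs_iff: "f \<in> homs C A B \<longleftrightarrow> f \<in> Ar C \<and> Dom C f = A \<and> Cod C f = B"
  by (auto simp: homs_def)

context category
begin

lemma homs_ob: "f \<in> homs C A B \<Longrightarrow> A \<in> Ob C \<and> B \<in> Ob C"
  using dom_ob cod_ob by (auto simp: homs_iff)

lemma idn_ar [simp]:
  assumes "A \<in> Ob C"
  shows "Idn C A \<in> Ar C" "Dom C (Idn C A) = A" "Cod C (Idn C A) = A"
  using idn_homs[OF assms] by (auto simp: homs_iff)

lemma cmp_ar [simp]:
  assumes "f \<in> Ar C" "g \<in> Ar C" "Cod C f = Dom C g"
  shows "g \<cdot> f \<in> Ar C" "Dom C (g \<cdot> f) = Dom C f" "Cod C (g \<cdot> f) = Cod C g"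
  using cmp_homs[of f "Dom C f" "Dom C g" g "Cod C g"] assms by (auto simp: homs_iff)

lemma cmp_unit [simp]:
  assumes "f \<in> Ar C"
  shows "Dom C f = A \<Longrightarrow> f \<cdot> Idn C A = f" "Cod C f = B \<Longrightarrow> Idn C B \<cdot> f = f"
  using cmp_idn[of f "Dom C f" "Cod C f"] idn_cmp[of f "Dom C f" "Cod C f"] assms
  by (auto simp: homs_iff)

lemma assoc [simp]:
  assumes "f \<in> Ar C" "g \<in> Ar C" "h \<in> Ar C" "Cod C f = Dom C g" "Cod C g = Dom C h"
  shows "(h \<cdot> g) \<cdot> f = h \<cdot> (g \<cdot> f)"
  using cmp_assoc[of f "Dom C f" "Dom C g" g "Dom C h" h "Cod C h"] assms by (auto simp: homs_iff)

text \<open>Composites are normalised to right-nested form; these two rules let an equation between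
  composites act on the head of a longer composite.\<close>

lemma reduce:
  assumes "a \<cdot> b = c" "a \<in> Ar C" "b \<in> Ar C" "x \<in> Ar C" "Cod C x = Dom C b" "Cod C b = Dom C a"
  shows "a \<cdot> (b \<cdot> x) = c \<cdot> x"
  using assms assoc[of x b a] by simp

lemma reduce2:
  assumes "a \<cdot> b = c \<cdot> d" "a \<in> Ar C" "b \<in> Ar C" "x \<in> Ar C" "Cod C x = Dom C b" "Cod C b = Dom C a"
    "c \<in> Ar C" "d \<in> Ar C" "Cod C d = Dom C c" 
  shows "a \<cdot> (b \<cdot> x) = c \<cdot> (d \<cdot> x)"
proof -
  have "Dom C (a \<cdot> b) = Dom C (c \<cdot> d)" using assms(1) by (rule arg_cong)
  then have "Dom C d = Dom C b" using assms(2-) by simp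
  moreover have "(a \<cdot> b) \<cdot> x = (c \<cdot> d) \<cdot> x" using assms(1) by (rule arg_cong)
  ultimately show ?thesis
    using assms(2-) by simp
qed

lemma inverse_unique:
  assumes "inverse_arrows C f g" "inverse_arrows C f g'"
  shows "g = g'"
proof -
  have "(g \<cdot> f) \<cdot> g' = g \<cdot> (f \<cdot> g')"
    using assms by (intro assoc) (auto simp: inverse_arrows_def homs_iff)
  then show ?thesis
    using assms by (simp add: inverse_arrows_def homs_iff)
qed

lemma inverse_inv_ar: "is_iso C f \<Longrightarrow> inverse_arrows C f (inv_ar C f)"
  unfolding is_iso_def inv_ar_def by (rule theI') (use inverse_unique in blast)

lemma inv_ar_simps:
  assumes "is_iso C f"
  shows "inv_ar C f \<in> Ar C" "Dom C (inv_ar C f) = Cod C f" "Cod C (inv_ar C f) = Dom C f"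
    "inv_ar C f \<cdot> f = Idn C (Dom C f)" "f \<cdot> inv_ar C f = Idn C (Cod C f)"
  using inverse_inv_ar[OF assms] by (auto simp: inverse_arrows_def homs_iff)

lemma iso_cancel_left:
  assumes "is_iso C f" "f \<cdot> x = f \<cdot> y"
    "x \<in> Ar C" "y \<in> Ar C" "Cod C x = Dom C f" "Cod C y = Dom C f"
  shows "x = y"
proof -
  have f: "f \<in> Ar C" using assms(1) by (auto simp: is_iso_def inverse_arrows_def)
  have "inv_ar C f \<cdot> (f \<cdot> z) = z" if "z \<in> Ar C" "Cod C z = Dom C f" for z
    using that f by (simp add: reduce[OF inv_ar_simps(4)] inv_ar_simps assms(1))
  then show ?thesis using assms(2-) by metis
qed

lemma iso_cancel_right:
  assumes "is_iso C f" "x \<cdot> f = y \<cdot> f"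
    "x \<in> Ar C" "y \<in> Ar C" "Dom C x = Cod C f" "Dom C y = Cod C f"
  shows "x = y"
proof -
  have f: "f \<in> Ar C" using assms(1) by (auto simp: is_iso_def inverse_arrows_def)
  have "(z \<cdot> f) \<cdot> inv_ar C f = z" if "z \<in> Ar C" "Dom C z = Cod C f" for z
    using that f by (simp add: inv_ar_simps assms(1))
  then show ?thesis using assms(2-) by metis
qed

lemma limit_factorization:
  assumes "is_limit J C F L p" "is_cone J C F X r"
  obtains u where "u \<in> homs C X L" "\<And>i. i \<in> Ob J \<Longrightarrow> p i \<cdot> u = r i"
proof -
  have "\<exists>!u. u \<in> homs C X L \<and> (\<forall>i \<in> Ob J. p i \<cdot> u = r i)"
    using assms unfolding is_limit_def by blast
  then show ?thesis using that by blast
qed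

lemma limit_factorization_unique:
  assumes "is_limit J C F L p" "is_cone J C F X r" "u \<in> homs C X L" "v \<in> homs C X L"
    "\<And>i. i \<in> Ob J \<Longrightarrow> p i \<cdot> u = r i" "\<And>i. i \<in> Ob J \<Longrightarrow> p i \<cdot> v = r i"
  shows "u = v"
proof -
  have "\<exists>!u. u \<in> homs C X L \<and> (\<forall>i \<in> Ob J. p i \<cdot> u = r i)"
    using assms(1,2) unfolding is_limit_def by blast
  then show ?thesis using assms(3-) by blast
qed

lemma limit_endo:
  assumes "is_limit J C F L p" "w \<in> homs C L L" "\<And>i. i \<in> Ob J \<Longrightarrow> p i \<cdot> w = p i"
  shows "w = Idn C L"
proof -
  have c: "is_cone J C F L p" using assms(1) by (simp add: is_limit_def)
  show ?thesis
  proof (rule limit_factorization_unique[OF assms(1) c assms(2) _ assms(3)])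
    show "Idn C L \<in> homs C L L"
      using c by (auto simp: is_cone_def intro: idn_homs)
    show "p i \<cdot> Idn C L = p i" if "i \<in> Ob J" for i
      using c that by (auto simp: is_cone_def intro: cmp_idn)
  qed
qed

lemma limit_comparison_iso:
  assumes K: "is_limit J C F K r" and N: "is_limit J C F N q"
  shows "is_iso C (induced C (Ob J) N q K r)"
proof -
  have cK: "is_cone J C F K r" and cN: "is_cone J C F N q"
    using K N by (auto simp: is_limit_def)
  have r: "r i \<in> homs C K (fob F i)" and q: "q i \<in> homs C N (fob F i)" if "i \<in> Ob J" for i
    using cK cN that by (auto simp: is_cone_def)
  obtain u where u: "u \<in> homs C K N" "\<And>i. i \<in> Ob J \<Longrightarrow> q i \<cdot> u = r i"
    by (rule limit_factorization[OF N cK]) (rule that)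
  obtain v where v: "v \<in> homs C N K" "\<And>i. i \<in> Ob J \<Longrightarrow> r i \<cdot> v = q i"
    by (rule limit_factorization[OF K cN]) (rule that)
  have "induced C (Ob J) N q K r = u"
    unfolding induced_def
  proof (rule the_equality)
    show "u' = u" if "u' \<in> homs C K N \<and> (\<forall>i \<in> Ob J. q i \<cdot> u' = r i)" for u'
      by (rule limit_factorization_unique[OF N cK]) (use u that in auto)
  qed (use u in auto)
  moreover have "v \<cdot> u = Idn C K"
  proof (rule limit_endo[OF K cmp_homs[OF u(1) v(1)]])
    show "r i \<cdot> (v \<cdot> u) = r i" if "i \<in> Ob J" for i
      using cmp_assoc[OF u(1) v(1) r[OF that]] u(2)[OF that] v(2)[OF that] by simp
  qed
  moreover have "u \<cdot> v = Idn C N"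
  proof (rule limit_endo[OF N cmp_homs[OF v(1) u(1)]])
    show "q i \<cdot> (u \<cdot> v) = q i" if "i \<in> Ob J" for i
      using cmp_assoc[OF v(1) u(1) q[OF that]] u(2)[OF that] v(2)[OF that] by simp
  qed
  ultimately have "inverse_arrows C (induced C (Ob J) N q K r) v"
    using u(1) v(1) by (auto simp: inverse_arrows_def homs_iff)
  then show ?thesis by (auto simp: is_iso_def)
qed

end

section \<open>Coherence in a symmetric monoidal category\<close>

context closed_symmetric_monoidal
begin

declare tob_ob [simp] unt_ob [simp] ihom_ob [simp]

lemma tar_ar [simp]:
  assumes "f \<in> Ar M" "g \<in> Ar M"
  shows "f \<odot> g \<in> Ar M" "Dom M (f \<odot> g) = Dom M f \<otimes> Dom M g" "Cod M (f \<odot> g) = Cod M f \<otimes> Cod M g"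
  using tar_homs[of f "Dom M f" "Cod M f" g "Dom M g" "Cod M g"] assms by (auto simp: homs_iff)

lemma interchange [simp]:
  assumes "f \<in> Ar M" "f' \<in> Ar M" "g \<in> Ar M" "g' \<in> Ar M" "Cod M f = Dom M f'" "Cod M g = Dom M g'"
  shows "(f' \<odot> g') \<cdot> (f \<odot> g) = (f' \<cdot> f) \<odot> (g' \<cdot> g)"
  using tar_cmp[of f "Dom M f" "Dom M f'" f' "Cod M f'" g "Dom M g" "Dom M g'" g' "Cod M g'"] assms
  by (auto simp: homs_iff)

lemma interchange_reduce [simp]:
  assumes "f \<in> Ar M" "f' \<in> Ar M" "g \<in> Ar M" "g' \<in> Ar M" "Cod M f = Dom M f'" "Cod M g = Dom M g'"
    "x \<in> Ar M" "Cod M x = Dom M f \<otimes> Dom M g"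
  shows "(f' \<odot> g') \<cdot> ((f \<odot> g) \<cdot> x) = ((f' \<cdot> f) \<odot> (g' \<cdot> g)) \<cdot> x"
  using assms by (simp add: reduce[OF interchange])

declare tar_idn [simp]

lemma obs [simp]: "f \<in> Ar M \<Longrightarrow> Dom M f \<in> Ob M" "f \<in> Ar M \<Longrightarrow> Cod M f \<in> Ob M"
  by (auto intro: dom_ob cod_ob)

lemma structure_ar [simp]:
  shows "\<lbrakk>A \<in> Ob M; B \<in> Ob M; D \<in> Ob M\<rbrakk> \<Longrightarrow> asc M A B D \<in> Ar M"
    "\<lbrakk>A \<in> Ob M; B \<in> Ob M; D \<in> Ob M\<rbrakk> \<Longrightarrow> Dom M (asc M A B D) = (A \<otimes> B) \<otimes> D"
    "\<lbrakk>A \<in> Ob M; B \<in> Ob M; D \<in> Ob M\<rbrakk> \<Longrightarrow> Cod M (asc M A B D) = A \<otimes> (B \<otimes> D)"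
    "A \<in> Ob M \<Longrightarrow> lun M A \<in> Ar M" "A \<in> Ob M \<Longrightarrow> Dom M (lun M A) = unt M \<otimes> A"
    "A \<in> Ob M \<Longrightarrow> Cod M (lun M A) = A"
    "A \<in> Ob M \<Longrightarrow> run M A \<in> Ar M" "A \<in> Ob M \<Longrightarrow> Dom M (run M A) = A \<otimes> unt M"
    "A \<in> Ob M \<Longrightarrow> Cod M (run M A) = A"
    "\<lbrakk>A \<in> Ob M; B \<in> Ob M\<rbrakk> \<Longrightarrow> braid M A B \<in> Ar M"
    "\<lbrakk>A \<in> Ob M; B \<in> Ob M\<rbrakk> \<Longrightarrow> Dom M (braid M A B) = A \<otimes> B"
    "\<lbrakk>A \<in> Ob M; B \<in> Ob M\<rbrakk> \<Longrightarrow> Cod M (braid M A B) = B \<otimes> A"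
    "\<lbrakk>A \<in> Ob M; B \<in> Ob M\<rbrakk> \<Longrightarrow> evl M A B \<in> Ar M"
    "\<lbrakk>A \<in> Ob M; B \<in> Ob M\<rbrakk> \<Longrightarrow> Dom M (evl M A B) = ihom M A B \<otimes> A"
    "\<lbrakk>A \<in> Ob M; B \<in> Ob M\<rbrakk> \<Longrightarrow> Cod M (evl M A B) = B"
  using asc_homs lun_homs run_homs braid_homs evl_homs by (auto simp: homs_iff)

lemma inverse_structure_ar [simp]:
  shows "\<lbrakk>A \<in> Ob M; B \<in> Ob M; D \<in> Ob M\<rbrakk> \<Longrightarrow> inv_ar M (asc M A B D) \<in> Ar M"
    "\<lbrakk>A \<in> Ob M; B \<in> Ob M; D \<in> Ob M\<rbrakk> \<Longrightarrow> Dom M (inv_ar M (asc M A B D)) = A \<otimes> (B \<otimes> D)"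
    "\<lbrakk>A \<in> Ob M; B \<in> Ob M; D \<in> Ob M\<rbrakk> \<Longrightarrow> Cod M (inv_ar M (asc M A B D)) = (A \<otimes> B) \<otimes> D"
    "\<lbrakk>A \<in> Ob M; B \<in> Ob M; D \<in> Ob M\<rbrakk> \<Longrightarrow> 
      inv_ar M (asc M A B D) \<cdot> asc M A B D = Idn M ((A \<otimes> B) \<otimes> D)"
    "\<lbrakk>A \<in> Ob M; B \<in> Ob M; D \<in> Ob M\<rbrakk> \<Longrightarrow> 
      asc M A B D \<cdot> inv_ar M (asc M A B D) = Idn M (A \<otimes> (B \<otimes> D))"
    "A \<in> Ob M \<Longrightarrow> inv_ar M (run M A) \<in> Ar M" "A \<in> Ob M \<Longrightarrow> Dom M (inv_ar M (run M A)) = A"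
    "A \<in> Ob M \<Longrightarrow> Cod M (inv_ar M (run M A)) = A \<otimes> unt M"
    "A \<in> Ob M \<Longrightarrow> inv_ar M (run M A) \<cdot> run M A = Idn M (A \<otimes> unt M)"
    "A \<in> Ob M \<Longrightarrow> run M A \<cdot> inv_ar M (run M A) = Idn M A"
  by (simp_all add: inv_ar_simps asc_iso run_iso)

text \<open>Naturality is oriented so that, as a rewrite rule, it moves a morphism past the structure
  isomorphism; side conditions instead of typing judgements keep it applicable by simplification.\<close>

lemma asc_natural:
  assumes "f \<in> Ar M" "g \<in> Ar M" "h \<in> Ar M" "A = Dom M f" "B = Dom M g" "D = Dom M h"
    "A' = Cod M f" "B' = Cod M g" "D' = Cod M h"
  shows "(f \<odot> (g \<odot> h)) \<cdot> asc M A B D = asc M A' B' D' \<cdot> ((f \<odot> g) \<odot> h)"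
  using asc_nat[of f A A' g B B' h D D'] assms by (simp add: homs_iff)

lemma inv_asc_natural:
  assumes "f \<in> Ar M" "g \<in> Ar M" "h \<in> Ar M" "A = Dom M f" "B = Dom M g" "D = Dom M h"
    "A' = Cod M f" "B' = Cod M g" "D' = Cod M h"
  shows "((f \<odot> g) \<odot> h) \<cdot> inv_ar M (asc M A B D) = inv_ar M (asc M A' B' D') \<cdot> (f \<odot> (g \<odot> h))"
proof (rule iso_cancel_left[OF asc_iso[of A' B' D']])
  show "asc M A' B' D' \<cdot> (((f \<odot> g) \<odot> h) \<cdot> inv_ar M (asc M A B D)) =
      asc M A' B' D' \<cdot> (inv_ar M (asc M A' B' D') \<cdot> (f \<odot> (g \<odot> h)))"
    using assms
    by (simp add: reduce[OF inverse_structure_ar(5)] reduce2[OF asc_natural[symmetric]])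
qed (use assms in simp_all)

lemma run_natural:
  assumes "f \<in> Ar M" "Dom M f = A" "Cod M f = A'"
  shows "f \<cdot> run M A = run M A' \<cdot> (f \<odot> Idn M (unt M))"
  using run_nat[of f A A'] assms by (simp add: homs_iff)

lemma lun_natural:
  assumes "f \<in> Ar M" "Dom M f = A" "Cod M f = A'"
  shows "f \<cdot> lun M A = lun M A' \<cdot> (Idn M (unt M) \<odot> f)"
  using lun_nat[of f A A'] assms by (simp add: homs_iff)

lemma inv_run_natural:
  assumes "f \<in> Ar M" "Dom M f = A" "Cod M f = A'"
  shows "inv_ar M (run M A') \<cdot> f = (f \<odot> Idn M (unt M)) \<cdot> inv_ar M (run M A)"
proof (rule iso_cancel_left[OF run_iso[of A']])
  have [simp]: "A \<in> Ob M" "A' \<in> Ob M" using assms by auto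
  show "run M A' \<cdot> inv_ar M (run M A') \<cdot> f
      = run M A' \<cdot> (f \<odot> Idn M (unt M)) \<cdot> inv_ar M (run M A)"
    using assms by (simp add: reduce[OF inverse_structure_ar(10)] reduce2[OF run_natural[OF assms, symmetric]])
qed (use assms in auto)

lemma braid_natural:
  assumes "f \<in> Ar M" "g \<in> Ar M" "A = Dom M f" "B = Dom M g" "A' = Cod M f" "B' = Cod M g"
  shows "(g \<odot> f) \<cdot> braid M A B = braid M A' B' \<cdot> (f \<odot> g)"
  using braid_nat[of f A A' g B B'] assms by (simp add: homs_iff)

lemma braid_iso: "A \<in> Ob M \<Longrightarrow> B \<in> Ob M \<Longrightarrow> is_iso M (braid M A B)"
  unfolding is_iso_def inverse_arrows_def
  by (rule exI[of _ "braid M B A"]) (simp add: homs_iff braid_braid)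

lemma tensor_unit_right_faithful:
  assumes "f \<odot> Idn M (unt M) = g \<odot> Idn M (unt M)" "f \<in> homs M A B" "g \<in> homs M A B"
  shows "f = g"
proof (rule iso_cancel_right[OF run_iso])
  show "f \<cdot> run M A = g \<cdot> run M A"
    using assms by (simp add: run_natural[of _ A B] homs_iff)
qed (use assms homs_ob in \<open>auto simp: homs_iff\<close>)

lemma tensor_unit_left_faithful:
  assumes "Idn M (unt M) \<odot> f = Idn M (unt M) \<odot> g" "f \<in> homs M A B" "g \<in> homs M A B"
  shows "f = g"
proof (rule iso_cancel_right[OF lun_iso])
  show "f \<cdot> lun M A = g \<cdot> lun M A"
    using assms by (simp add: lun_natural[of _ A B] homs_iff)
qed (use assms homs_ob in \<open>auto simp: homs_iff\<close>)

text \<open>The remaining unit coherences follow from pentagon, triangle and hexagon by Kelly's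
  argument: the equation is proved after tensoring with \<open>e\<close>, which is faithful.\<close>

lemma run_tensor:
  assumes [simp]: "A \<in> Ob M" "B \<in> Ob M"
  shows "(Idn M A \<odot> run M B) \<cdot> asc M A B (unt M) = run M (A \<otimes> B)"
proof (rule tensor_unit_right_faithful)
  let ?e = "unt M"
  let ?x = "(Idn M A \<odot> run M B) \<cdot> asc M A B ?e"
  have "asc M A B ?e \<cdot> (?x \<odot> Idn M ?e)
      = asc M A B ?e \<cdot> ((Idn M A \<odot> run M B) \<odot> Idn M ?e) \<cdot> (asc M A B ?e \<odot> Idn M ?e)"
    by simp
  also have "\<dots> = (Idn M A \<odot> (run M B \<odot> Idn M ?e)) \<cdot> asc M A (B \<otimes> ?e) ?e \<cdot> (asc M A B ?e \<odot> Idn M ?e)"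
    by (simp add: reduce2[OF asc_natural] del: interchange_reduce)
  also have "\<dots> = (Idn M A \<odot> (Idn M B \<odot> lun M ?e)) \<cdot> (Idn M A \<odot> asc M B ?e ?e) \<cdot>
      asc M A (B \<otimes> ?e) ?e \<cdot> (asc M A B ?e \<odot> Idn M ?e)"
    by (simp add: triangle)
  also have "\<dots> = (Idn M A \<odot> (Idn M B \<odot> lun M ?e)) \<cdot> asc M A B (?e \<otimes> ?e) \<cdot> asc M (A \<otimes> B) ?e ?e"
    by (simp add: pentagon)
  also have "\<dots> = asc M A B ?e \<cdot> (Idn M (A \<otimes> B) \<odot> lun M ?e) \<cdot> asc M (A \<otimes> B) ?e ?e"
    by (simp add: reduce2[OF asc_natural])
  also have "\<dots> = asc M A B ?e \<cdot> (run M (A \<otimes> B) \<odot> Idn M ?e)"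
    by (simp add: triangle)
  finally show "?x \<odot> Idn M ?e = run M (A \<otimes> B) \<odot> Idn M ?e"
    by (rule iso_cancel_left[OF asc_iso[OF assms unt_ob]]) simp_all
  show "?x \<in> homs M ((A \<otimes> B) \<otimes> ?e) (A \<otimes> B)" "run M (A \<otimes> B) \<in> homs M ((A \<otimes> B) \<otimes> ?e) (A \<otimes> B)"
    by (simp_all add: homs_iff)
qed

lemma lun_tensor:
  assumes [simp]: "A \<in> Ob M" "B \<in> Ob M"
  shows "lun M (A \<otimes> B) \<cdot> asc M (unt M) A B = lun M A \<odot> Idn M B"
proof (rule tensor_unit_left_faithful)
  let ?e = "unt M"
  let ?z = "asc M ?e (?e \<otimes> A) B \<cdot> (asc M ?e ?e A \<odot> Idn M B)"
  have "(Idn M ?e \<odot> (lun M (A \<otimes> B) \<cdot> asc M ?e A B)) \<cdot> ?z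
      = (Idn M ?e \<odot> lun M (A \<otimes> B)) \<cdot> (Idn M ?e \<odot> asc M ?e A B) \<cdot> ?z"
    by simp
  also have "\<dots> = (Idn M ?e \<odot> lun M (A \<otimes> B)) \<cdot> asc M ?e ?e (A \<otimes> B) \<cdot> asc M (?e \<otimes> ?e) A B"
    by (simp add: pentagon)
  also have "\<dots> = (run M ?e \<odot> Idn M (A \<otimes> B)) \<cdot> asc M (?e \<otimes> ?e) A B"
    by (simp add: reduce[OF triangle])
  also have "\<dots> = (run M ?e \<odot> (Idn M A \<odot> Idn M B)) \<cdot> asc M (?e \<otimes> ?e) A B"
    by simp
  also have "\<dots> = asc M ?e A B \<cdot> ((run M ?e \<odot> Idn M A) \<odot> Idn M B)"
    by (simp only: asc_natural structure_ar idn_ar obs tob_ob unt_ob assms)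
  also have "\<dots> = asc M ?e A B \<cdot> ((Idn M ?e \<odot> lun M A) \<odot> Idn M B) \<cdot> (asc M ?e ?e A \<odot> Idn M B)"
    by (simp add: triangle)
  also have "\<dots> = (Idn M ?e \<odot> (lun M A \<odot> Idn M B)) \<cdot> ?z"
    by (simp add: reduce2[OF asc_natural] del: interchange_reduce)
  finally have eq: "(Idn M ?e \<odot> (lun M (A \<otimes> B) \<cdot> asc M ?e A B)) \<cdot> ?z
    = (Idn M ?e \<odot> (lun M A \<odot> Idn M B)) \<cdot> ?z" .
  have iso: "is_iso M ?z"
    unfolding is_iso_def inverse_arrows_def
    by (rule exI[of _ "(inv_ar M (asc M ?e ?e A) \<odot> Idn M B) \<cdot> inv_ar M (asc M ?e (?e \<otimes> A) B)"])
      (simp add: homs_iff reduce[OF inverse_structure_ar(4)] reduce[OF interchange])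
  show "Idn M ?e \<odot> (lun M (A \<otimes> B) \<cdot> asc M ?e A B) = Idn M ?e \<odot> (lun M A \<odot> Idn M B)"
    by (rule iso_cancel_right[OF iso eq]) simp_all
  show "lun M (A \<otimes> B) \<cdot> asc M ?e A B \<in> homs M ((?e \<otimes> A) \<otimes> B) (A \<otimes> B)"
    "lun M A \<odot> Idn M B \<in> homs M ((?e \<otimes> A) \<otimes> B) (A \<otimes> B)"
    by (simp_all add: homs_iff)
qed

lemma lun_braid:
  assumes [simp]: "A \<in> Ob M"
  shows "lun M A \<cdot> braid M A (unt M) = run M A"
proof (rule tensor_unit_right_faithful)
  let ?e = "unt M"
  let ?x = "lun M A \<cdot> braid M A ?e"
  have "braid M A ?e \<cdot> (?x \<odot> Idn M ?e)
      = braid M A ?e \<cdot> (lun M A \<odot> Idn M ?e) \<cdot> (braid M A ?e \<odot> Idn M ?e)"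
    by simp
  also have "\<dots> = braid M A ?e \<cdot> lun M (A \<otimes> ?e) \<cdot> asc M ?e A ?e \<cdot> (braid M A ?e \<odot> Idn M ?e)"
    by (simp add: lun_tensor[symmetric])
  also have "\<dots> = lun M (?e \<otimes> A) \<cdot> (Idn M ?e \<odot> braid M A ?e) \<cdot> asc M ?e A ?e \<cdot> (braid M A ?e \<odot> Idn M ?e)"
    by (simp add: reduce2[OF lun_natural])
  also have "\<dots> = lun M (?e \<otimes> A) \<cdot> asc M ?e ?e A \<cdot> braid M A (?e \<otimes> ?e) \<cdot> asc M A ?e ?e"
    by (simp add: hexagon)
  also have "\<dots> = (lun M ?e \<odot> Idn M A) \<cdot> braid M A (?e \<otimes> ?e) \<cdot> asc M A ?e ?e"
    by (simp add: reduce[OF lun_tensor])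
  also have "\<dots> = braid M A ?e \<cdot> (Idn M A \<odot> lun M ?e) \<cdot> asc M A ?e ?e"
    by (simp add: reduce2[OF braid_natural])
  also have "\<dots> = braid M A ?e \<cdot> (run M A \<odot> Idn M ?e)"
    by (simp add: triangle)
  finally show "?x \<odot> Idn M ?e = run M A \<odot> Idn M ?e"
    by (rule iso_cancel_left[OF braid_iso[OF assms unt_ob]]) simp_all
  show "?x \<in> homs M (A \<otimes> ?e) A" "run M A \<in> homs M (A \<otimes> ?e) A"
    by (simp_all add: homs_iff)
qed

end

section \<open>Pairings, copairings and trace-class morphisms\<close>

context closed_symmetric_monoidal
begin

text \<open>The morphism \<open>(D \<otimes> B') \<otimes> B \<rightarrow> B'\<close> that applies a pairing \<open>ev : D \<otimes> B \<rightarrow> e\<close>.\<close>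

definition pairing_action where
  "pairing_action D B B' ev = lun M B' \<cdot> (ev \<odot> Idn M B') \<cdot> inv_ar M (asc M D B B')
     \<cdot> (Idn M D \<odot> braid M B' B) \<cdot> asc M D B' B"

lemma pairing_action_ar [simp]:
  assumes "D \<in> Ob M" "B \<in> Ob M" "B' \<in> Ob M" "ev \<in> Ar M" "Dom M ev = D \<otimes> B" "Cod M ev = unt M"
  shows "pairing_action D B B' ev \<in> Ar M" "Dom M (pairing_action D B B' ev) = (D \<otimes> B') \<otimes> B"
    "Cod M (pairing_action D B B' ev) = B'"
  unfolding pairing_action_def using assms by simp_all

lemma pairing_action_natural:
  assumes [simp]: "D \<in> Ob M" "B \<in> Ob M" "ev \<in> Ar M" "Dom M ev = D \<otimes> B" "Cod M ev = unt M"
    and g [simp]: "g \<in> Ar M" "Dom M g = B'" "Cod M g = B''"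
  shows "g \<cdot> pairing_action D B B' ev = pairing_action D B B'' ev \<cdot> ((Idn M D \<odot> g) \<odot> Idn M B)"
proof -
  have [simp]: "B' \<in> Ob M" "B'' \<in> Ob M" using obs[OF g(1)] by simp_all
  have "g \<cdot> pairing_action D B B' ev = lun M B'' \<cdot> (ev \<odot> Idn M B'') \<cdot> (Idn M (D \<otimes> B) \<odot> g)
     \<cdot> inv_ar M (asc M D B B') \<cdot> (Idn M D \<odot> braid M B' B) \<cdot> asc M D B' B"
    unfolding pairing_action_def by (simp add: reduce2[OF lun_natural[OF g]])
  also have "(Idn M (D \<otimes> B) \<odot> g) \<cdot> inv_ar M (asc M D B B') \<cdot> (Idn M D \<odot> braid M B' B) \<cdot> asc M D B' B
     = inv_ar M (asc M D B B'') \<cdot> (Idn M D \<odot> (Idn M B \<odot> g)) \<cdot> (Idn M D \<odot> braid M B' B) \<cdot> asc M D B' B"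
    unfolding tar_idn[OF \<open>D \<in> Ob M\<close> \<open>B \<in> Ob M\<close>, symmetric]
    by (simp add: reduce2[OF inv_asc_natural] del: tar_idn)
  also have "\<dots> = inv_ar M (asc M D B B'') \<cdot> (Idn M D \<odot> braid M B'' B) \<cdot>
      (Idn M D \<odot> (g \<odot> Idn M B)) \<cdot> asc M D B' B"
    by (simp add: braid_natural)
  also have "(Idn M D \<odot> (g \<odot> Idn M B)) \<cdot> asc M D B' B = asc M D B'' B \<cdot> ((Idn M D \<odot> g) \<odot> Idn M B)"
    by (simp add: asc_natural)
  finally show ?thesis unfolding pairing_action_def by simp
qed

text \<open>If \<open>t : e \<rightarrow> D \<otimes> B'\<close> followed by the action of \<open>ev\<close> gives \<open>\<tau>\<close>, then so does the composite
  \<open>B \<cong> B \<otimes> e \<rightarrow> B \<otimes> (D \<otimes> B') \<cong> (B \<otimes> D) \<otimes> B' \<rightarrow> e \<otimes> B' \<cong> B'\<close>, in which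
  the pairing is \<open>ev\<close> after the braiding \<open>B \<otimes> D \<rightarrow> D \<otimes> B\<close>. The hexagon identifies the two composites.\<close>

lemma pairing_action_transpose:
  assumes [simp]: "D \<in> Ob M" "B \<in> Ob M" "B' \<in> Ob M" "ev \<in> Ar M" "Dom M ev = D \<otimes> B" "Cod M ev = unt M"
    and t [simp]: "t \<in> Ar M" "Dom M t = unt M" "Cod M t = D \<otimes> B'"
    and [simp]: "\<tau> \<in> Ar M" "Dom M \<tau> = B" "Cod M \<tau> = B'"
    and eq: "pairing_action D B B' ev \<cdot> (t \<odot> Idn M B) = \<tau> \<cdot> lun M B"
  shows "lun M B' \<cdot> ((ev \<cdot> braid M B D) \<odot> Idn M B') \<cdot> inv_ar M (asc M B D B') \<cdot> (Idn M B \<odot> t)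
    \<cdot> inv_ar M (run M B) = \<tau>"
proof -
  have hex: "(braid M B D \<odot> Idn M B') \<cdot> inv_ar M (asc M B D B')
      = inv_ar M (asc M D B B') \<cdot> (Idn M D \<odot> braid M B' B) \<cdot> asc M D B' B \<cdot> braid M B (D \<otimes> B')"
    (is "?l = ?r")
  proof (rule iso_cancel_right)
    show "is_iso M (asc M B D B')" by (simp add: asc_iso)
    have "?r \<cdot> asc M B D B' = inv_ar M (asc M D B B') \<cdot> (Idn M D \<odot> braid M B' B) \<cdot>
      (Idn M D \<odot> braid M B B') \<cdot> asc M D B B' \<cdot> (braid M B D \<odot> Idn M B')"
      by (simp add: hexagon)
    also have "\<dots> = braid M B D \<odot> Idn M B'"
      by (simp add: braid_braid reduce[OF inverse_structure_ar(4)])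
    finally show "?l \<cdot> asc M B D B' = ?r \<cdot> asc M B D B'" by simp
  qed simp_all
  have "lun M B' \<cdot> ((ev \<cdot> braid M B D) \<odot> Idn M B') \<cdot> inv_ar M (asc M B D B') \<cdot> (Idn M B \<odot> t)
      = lun M B' \<cdot> (ev \<odot> Idn M B') \<cdot> ?l \<cdot> (Idn M B \<odot> t)"
    by simp
  also have "\<dots> = pairing_action D B B' ev \<cdot> braid M B (D \<otimes> B') \<cdot> (Idn M B \<odot> t)"
    unfolding hex by (simp add: pairing_action_def)
  also have "\<dots> = pairing_action D B B' ev \<cdot> (t \<odot> Idn M B) \<cdot> braid M B (unt M)"
    by (simp add: braid_natural[of "Idn M B" t])
  also have "\<dots> = \<tau> \<cdot> run M B"
    by (simp add: reduce2[OF eq] lun_braid)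
  finally have "(lun M B' \<cdot> ((ev \<cdot> braid M B D) \<odot> Idn M B') \<cdot> inv_ar M (asc M B D B') \<cdot> (Idn M B \<odot> t))
      \<cdot> inv_ar M (run M B) = (\<tau> \<cdot> run M B) \<cdot> inv_ar M (run M B)" by (rule arg_cong)
  then show ?thesis by simp
qed

text \<open>A pairing \<open>\<epsilon> : B \<otimes> D \<rightarrow> e\<close> turns \<open>f : X \<rightarrow> A \<otimes> B\<close> into \<open>X \<otimes> D \<rightarrow> A\<close>; a copairing
  \<open>t : e \<rightarrow> D \<otimes> B'\<close> turns \<open>g : X \<otimes> D \<rightarrow> A\<close> into \<open>X \<rightarrow> A \<otimes> B'\<close>.\<close>

definition contract where
  "contract A B D \<epsilon> f = run M A \<cdot> (Idn M A \<odot> \<epsilon>) \<cdot> asc M A B D \<cdot> (f \<odot> Idn M D)"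

definition expand where
  "expand X D B' t g = (g \<odot> Idn M B') \<cdot> inv_ar M (asc M X D B') \<cdot> (Idn M X \<odot> t) \<cdot> inv_ar M (run M X)"

lemma contract_ar [simp]:
  assumes "A \<in> Ob M" "B \<in> Ob M" "D \<in> Ob M" "\<epsilon> \<in> Ar M" "Dom M \<epsilon> = B \<otimes> D" "Cod M \<epsilon> = unt M"
    "f \<in> Ar M" "Cod M f = A \<otimes> B"
  shows "contract A B D \<epsilon> f \<in> Ar M" "Dom M (contract A B D \<epsilon> f) = Dom M f \<otimes> D"
    "Cod M (contract A B D \<epsilon> f) = A"
  using assms by (simp_all add: contract_def)

lemma expand_ar [simp]:
  assumes "X \<in> Ob M" "D \<in> Ob M" "B' \<in> Ob M" "t \<in> Ar M" "Dom M t = unt M" "Cod M t = D \<otimes> B'"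
    "g \<in> Ar M" "Dom M g = X \<otimes> D"
  shows "expand X D B' t g \<in> Ar M" "Dom M (expand X D B' t g) = X"
    "Cod M (expand X D B' t g) = Cod M g \<otimes> B'"
  using assms by (simp_all add: expand_def)

lemma contract_natural:
  assumes [simp]: "B \<in> Ob M" "D \<in> Ob M" "\<epsilon> \<in> Ar M" "Dom M \<epsilon> = B \<otimes> D" "Cod M \<epsilon> = unt M"
    "f \<in> Ar M" "Cod M f = A \<otimes> B" and a [simp]: "a \<in> Ar M" "Dom M a = A" "Cod M a = A'"
  shows "contract A' B D \<epsilon> ((a \<odot> Idn M B) \<cdot> f) = a \<cdot> contract A B D \<epsilon> f"
proof -
  have [simp]: "A \<in> Ob M" "A' \<in> Ob M" using obs[OF a(1)] by simp_all
  have "contract A' B D \<epsilon> ((a \<odot> Idn M B) \<cdot> f)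
      = run M A' \<cdot> (Idn M A' \<odot> \<epsilon>) \<cdot> asc M A' B D \<cdot> ((a \<odot> Idn M B) \<odot> Idn M D) \<cdot> (f \<odot> Idn M D)"
    by (simp add: contract_def)
  also have "\<dots> = run M A' \<cdot> (Idn M A' \<odot> \<epsilon>) \<cdot> (a \<odot> (Idn M B \<odot> Idn M D)) \<cdot> asc M A B D \<cdot> (f \<odot> Idn M D)"
    by (simp add: reduce2[OF asc_natural] del: tar_idn interchange interchange_reduce)
  also have "\<dots> = run M A' \<cdot> (a \<odot> Idn M (unt M)) \<cdot> (Idn M A \<odot> \<epsilon>) \<cdot> asc M A B D \<cdot> (f \<odot> Idn M D)"
    by simp
  also have "\<dots> = a \<cdot> contract A B D \<epsilon> f"
    by (simp add: contract_def reduce2[OF run_natural[OF a]] del: interchange_reduce)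
  finally show ?thesis .
qed

lemma expand_natural:
  assumes "X \<in> Ob M" "D \<in> Ob M" "B' \<in> Ob M" "t \<in> Ar M" "Dom M t = unt M" "Cod M t = D \<otimes> B'"
    "g \<in> Ar M" "Dom M g = X \<otimes> D" "a \<in> Ar M" "Dom M a = Cod M g"
  shows "expand X D B' t (a \<cdot> g) = (a \<odot> Idn M B') \<cdot> expand X D B' t g"
  using assms by (simp add: expand_def)

lemma inverse_pentagon:
  assumes [simp]: "A \<in> Ob M" "B \<in> Ob M" "D \<in> Ob M" "E \<in> Ob M"
  shows "(asc M A B D \<odot> Idn M E) \<cdot> inv_ar M (asc M (A \<otimes> B) D E)
    = inv_ar M (asc M A (B \<otimes> D) E) \<cdot> (Idn M A \<odot> inv_ar M (asc M B D E)) \<cdot> asc M A B (D \<otimes> E)"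
    (is "?l = ?r")
proof (rule iso_cancel_right)
  show "is_iso M (asc M (A \<otimes> B) D E)" by (simp add: asc_iso)
  have "?r \<cdot> asc M (A \<otimes> B) D E = inv_ar M (asc M A (B \<otimes> D) E) \<cdot> (Idn M A \<odot> inv_ar M (asc M B D E)) \<cdot>
     (Idn M A \<odot> asc M B D E) \<cdot> asc M A (B \<otimes> D) E \<cdot> (asc M A B D \<odot> Idn M E)"
    by (simp add: pentagon del: interchange_reduce interchange)
  also have "\<dots> = asc M A B D \<odot> Idn M E"
    by (simp add: reduce[OF inverse_structure_ar(4)])
  finally show "?l \<cdot> asc M (A \<otimes> B) D E = ?r \<cdot> asc M (A \<otimes> B) D E" by simp
qed simp_all

lemma inverse_triangle:
  assumes [simp]: "A \<in> Ob M" "B \<in> Ob M"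
  shows "(run M A \<odot> Idn M B) \<cdot> inv_ar M (asc M A (unt M) B) = Idn M A \<odot> lun M B"
  by (simp add: triangle[symmetric])

lemma inverse_run_tensor:
  assumes [simp]: "A \<in> Ob M" "B \<in> Ob M"
  shows "asc M A B (unt M) \<cdot> inv_ar M (run M (A \<otimes> B)) = Idn M A \<odot> inv_ar M (run M B)"
    (is "?l = ?r")
proof (rule iso_cancel_right)
  show "is_iso M (run M (A \<otimes> B))" by (simp add: run_iso)
  have "?r \<cdot> run M (A \<otimes> B) = asc M A B (unt M)"
    by (simp add: run_tensor[symmetric])
  then show "?l \<cdot> run M (A \<otimes> B) = ?r \<cdot> run M (A \<otimes> B)" by simp
qed simp_all

text \<open>If \<open>\<epsilon>\<close> and \<open>t\<close> compose to \<open>\<tau> : B \<rightarrow> B'\<close>, then expanding a contraction amounts to applying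
  \<open>\<tau>\<close> to the second factor.\<close>

lemma expand_contract:
  assumes [simp]: "A \<in> Ob M" "B \<in> Ob M" "D \<in> Ob M" "B' \<in> Ob M"
    "\<epsilon> \<in> Ar M" "Dom M \<epsilon> = B \<otimes> D" "Cod M \<epsilon> = unt M"
    "t \<in> Ar M" "Dom M t = unt M" "Cod M t = D \<otimes> B'"
    and f [simp]: "f \<in> Ar M" "Dom M f = X" "Cod M f = A \<otimes> B"
    and \<tau>: "lun M B' \<cdot> (\<epsilon> \<odot> Idn M B') \<cdot> inv_ar M (asc M B D B') \<cdot> (Idn M B \<odot> t)
      \<cdot> inv_ar M (run M B) = \<tau>"
  shows "expand X D B' t (contract A B D \<epsilon> f) = (Idn M A \<odot> \<tau>) \<cdot> f"
proof -
  have [simp]: "X \<in> Ob M" using obs(1)[OF f(1)] by simp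
  let ?e = "unt M"
  let ?\<epsilon>' = "(run M A \<odot> Idn M B') \<cdot> ((Idn M A \<odot> \<epsilon>) \<odot> Idn M B') \<cdot> (asc M A B D \<odot> Idn M B')"
  have "expand X D B' t (contract A B D \<epsilon> f) = 
    ?\<epsilon>' \<cdot> ((f \<odot> Idn M D) \<odot> Idn M B') \<cdot> inv_ar M (asc M X D B') \<cdot> (Idn M X \<odot> t) \<cdot> inv_ar M (run M X)"
    by (simp add: expand_def contract_def)
  also have "\<dots> = ?\<epsilon>' \<cdot> inv_ar M (asc M (A \<otimes> B) D B') \<cdot> (f \<odot> (Idn M D \<odot> Idn M B')) \<cdot> 
      (Idn M X \<odot> t) \<cdot> inv_ar M (run M X)"
    by (simp add: reduce2[OF inv_asc_natural] del: tar_idn interchange interchange_reduce)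
  also have "\<dots> = ?\<epsilon>' \<cdot> inv_ar M (asc M (A \<otimes> B) D B') \<cdot> (Idn M (A \<otimes> B) \<odot> t) \<cdot> 
      (f \<odot> Idn M ?e) \<cdot> inv_ar M (run M X)"
    by simp
  also have "\<dots> = ?\<epsilon>' \<cdot> inv_ar M (asc M (A \<otimes> B) D B') \<cdot> (Idn M (A \<otimes> B) \<odot> t) \<cdot> 
      inv_ar M (run M (A \<otimes> B)) \<cdot> f"
    by (simp add: inv_run_natural[OF f] del: interchange interchange_reduce)
  also have "\<dots> = (run M A \<odot> Idn M B') \<cdot> ((Idn M A \<odot> \<epsilon>) \<odot> Idn M B') \<cdot> 
      inv_ar M (asc M A (B \<otimes> D) B') \<cdot> (Idn M A \<odot> inv_ar M (asc M B D B')) \<cdot> asc M A B (D \<otimes> B') \<cdot>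
      ((Idn M A \<odot> Idn M B) \<odot> t) \<cdot> inv_ar M (run M (A \<otimes> B)) \<cdot> f"
    by (simp add: reduce2[OF inverse_pentagon] del: interchange interchange_reduce)
  also have "\<dots> = (run M A \<odot> Idn M B') \<cdot> inv_ar M (asc M A ?e B') \<cdot> (Idn M A \<odot> (\<epsilon> \<odot> Idn M B')) \<cdot> 
      (Idn M A \<odot> inv_ar M (asc M B D B')) \<cdot> (Idn M A \<odot> (Idn M B \<odot> t)) \<cdot> 
      asc M A B ?e \<cdot> inv_ar M (run M (A \<otimes> B)) \<cdot> f"
    by (simp add: reduce2[OF inv_asc_natural] reduce2[OF asc_natural] 
        del: tar_idn interchange interchange_reduce)
  also have "\<dots> = (Idn M A \<odot> lun M B') \<cdot> (Idn M A \<odot> (\<epsilon> \<odot> Idn M B')) \<cdot> 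
      (Idn M A \<odot> inv_ar M (asc M B D B')) \<cdot> (Idn M A \<odot> (Idn M B \<odot> t)) \<cdot> 
      (Idn M A \<odot> inv_ar M (run M B)) \<cdot> f"
    by (simp add: reduce[OF inverse_triangle] reduce[OF inverse_run_tensor]
        del: interchange interchange_reduce)
  also have "\<dots> = (Idn M A \<odot> \<tau>) \<cdot> f"
    unfolding \<tau>[symmetric] by simp
  finally show ?thesis .
qed

end

section \<open>The ind-completion is a category\<close>

text \<open>Composition and tensor product of morphisms of ind-objects are unions of germs over all pairs of
  representatives. Once the germ is known not to depend on the pair, the union is any one of them.\<close>

lemma UN_pair_const:
  assumes "\<And>a b c d. (a, b) \<in> S \<Longrightarrow> (c, d) \<in> T a \<Longrightarrow> G a b c d = U" "(a, b) \<in> S" "(c, d) \<in> T a"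
  shows "(\<Union>(a, b) \<in> S. \<Union>(c, d) \<in> T a. G a b c d) = U"
proof
  show "(\<Union>(a, b) \<in> S. \<Union>(c, d) \<in> T a. G a b c d) \<subseteq> U" using assms(1) by auto
  show "U \<subseteq> (\<Union>(a, b) \<in> S. \<Union>(c, d) \<in> T a. G a b c d)" using assms by blast
qed

context category
begin

lemma ind_ob_order:
  assumes "is_ind_ob C F"
  shows ile_idx: "(i, j) \<in> ile F \<Longrightarrow> i \<in> idx F \<and> j \<in> idx F"
    and ile_refl: "i \<in> idx F \<Longrightarrow> (i, i) \<in> ile F"
    and ile_trans: "(i, j) \<in> ile F \<Longrightarrow> (j, k) \<in> ile F \<Longrightarrow> (i, k) \<in> ile F"
    and ile_upper: "i \<in> idx F \<Longrightarrow> j \<in> idx F \<Longrightarrow> \<exists>k. (i, k) \<in> ile F \<and> (j, k) \<in> ile F"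
    and idx_nonempty: "idx F \<noteq> {}"
  using assms unfolding is_ind_ob_def filtered_poset_def partial_order_on_def preorder_on_def
    refl_on_def trans_def by blast+

lemma ind_ob_functor:
  assumes F: "is_ind_ob C F"
  shows ind_fob: "i \<in> idx F \<Longrightarrow> fob F i \<in> Ob C"
    and ind_far: "(i, j) \<in> ile F \<Longrightarrow> far F (i, j) \<in> homs C (fob F i) (fob F j)"
    and ind_far_refl: "i \<in> idx F \<Longrightarrow> far F (i, i) = Idn C (fob F i)"
    and ind_far_cmp: "(i, j) \<in> ile F \<Longrightarrow> (j, k) \<in> ile F \<Longrightarrow> far F (j, k) \<cdot> far F (i, j) = far F (i, k)"
proof -
  have f: "is_functor (index_cat F) C F" using F by (simp add: is_ind_ob_def)
  show "i \<in> idx F \<Longrightarrow> fob F i \<in> Ob C"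
    using f by (auto simp: is_functor_def poset_cat_def)
  show "far F (i, j) \<in> homs C (fob F i) (fob F j)" if "(i, j) \<in> ile F"
  proof -
    have "(i, j) \<in> homs (index_cat F) i j"
      using that ile_idx[OF F that] by (simp add: poset_cat_def homs_iff)
    then show ?thesis
      using f ile_idx[OF F that] by (auto simp: is_functor_def poset_cat_def)
  qed
  show "i \<in> idx F \<Longrightarrow> far F (i, i) = Idn C (fob F i)"
    using f by (auto simp: is_functor_def poset_cat_def)
  show "far F (j, k) \<cdot> far F (i, j) = far F (i, k)" if "(i, j) \<in> ile F" "(j, k) \<in> ile F"
  proof -
    have "\<forall>a \<in> Ar (index_cat F). \<forall>b \<in> Ar (index_cat F). Dom (index_cat F) b = Cod (index_cat F) a
        \<longrightarrow> far F (b \<cdot>\<^bsub>index_cat F\<^esub> a) = far F b \<cdot> far F a"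
      using f unfolding is_functor_def by blast
    from this[rule_format, of "(i, j)" "(j, k)"] show ?thesis
      using that ile_idx[OF F that(1)] ile_idx[OF F that(2)] by (simp add: poset_cat_def)
  qed
qed

lemma is_ind_obI:
  assumes "\<And>i j. (i, j) \<in> ile F \<Longrightarrow> i \<in> idx F \<and> j \<in> idx F" "\<And>i. i \<in> idx F \<Longrightarrow> (i, i) \<in> ile F"
    "\<And>i j k. (i, j) \<in> ile F \<Longrightarrow> (j, k) \<in> ile F \<Longrightarrow> (i, k) \<in> ile F"
    "\<And>i j. (i, j) \<in> ile F \<Longrightarrow> (j, i) \<in> ile F \<Longrightarrow> i = j"
    "\<And>i j. i \<in> idx F \<Longrightarrow> j \<in> idx F \<Longrightarrow> \<exists>k. (i, k) \<in> ile F \<and> (j, k) \<in> ile F"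
    "idx F \<noteq> {}"
    "\<And>i. i \<in> idx F \<Longrightarrow> fob F i \<in> Ob C"
    "\<And>i j. (i, j) \<in> ile F \<Longrightarrow> far F (i, j) \<in> homs C (fob F i) (fob F j)"
    "\<And>i. i \<in> idx F \<Longrightarrow> far F (i, i) = Idn C (fob F i)"
    "\<And>i j k. (i, j) \<in> ile F \<Longrightarrow> (j, k) \<in> ile F \<Longrightarrow> far F (j, k) \<cdot> far F (i, j) = far F (i, k)"
  shows "is_ind_ob C F"
proof -
  have "refl_on (idx F) (ile F)" using assms(2) by (simp add: refl_on_def)
  moreover have "ile F \<subseteq> idx F \<times> idx F" using assms(1) by auto
  moreover have "trans (ile F)" using assms(3) by (rule transI)
  moreover have "antisym (ile F)" using assms(4) by (rule antisymI)
  moreover have "\<forall>i\<in>idx F. \<forall>j\<in>idx F. \<exists>k\<in>idx F. (i, k) \<in> ile F \<and> (j, k) \<in> ile F"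
    using assms(1,5) by meson
  ultimately have "filtered_poset (idx F) (ile F)"
    using assms(6) by (simp add: filtered_poset_def partial_order_on_def preorder_on_def)
  moreover have "is_functor (index_cat F) C F"
    unfolding is_functor_def using assms(7-10) by (auto simp: poset_cat_def homs_iff)
  ultimately show ?thesis by (simp add: is_ind_ob_def)
qed

lemma mem_germ:
  assumes "is_ind_ob C F" "f \<in> homs C X (fob F j)"
  shows "(k, g) \<in> germ C F j f \<longleftrightarrow> k \<in> idx F \<and> g \<in> homs C X (fob F k) \<and>
     (\<exists>l. (j, l) \<in> ile F \<and> (k, l) \<in> ile F \<and> far F (j, l) \<cdot> f = far F (k, l) \<cdot> g)"
  using assms(2) ile_idx[OF assms(1)] by (auto simp: germ_def homs_iff)

lemma germ_self:
  assumes "is_ind_ob C F" "j \<in> idx F" "f \<in> homs C X (fob F j)"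
  shows "(j, f) \<in> germ C F j f"
  unfolding mem_germ[OF assms(1,3)] using assms ile_refl[OF assms(1,2)] by blast

lemma far_assoc:
  assumes F: "is_ind_ob C F" and "(j, k) \<in> ile F" "(k, l) \<in> ile F" "f \<in> homs C X (fob F j)"
  shows "far F (k, l) \<cdot> (far F (j, k) \<cdot> f) = far F (j, l) \<cdot> f"
  using cmp_assoc[OF assms(4) ind_far[OF F assms(2)] ind_far[OF F assms(3)]]
    ind_far_cmp[OF F assms(2,3)] by simp

lemma germ_mono:
  assumes F: "is_ind_ob C F" and f: "f \<in> homs C X (fob F j)" and g: "g \<in> homs C X (fob F k)"
    and l: "(j, l) \<in> ile F" "(k, l) \<in> ile F" "far F (j, l) \<cdot> f = far F (k, l) \<cdot> g"
  shows "germ C F k g \<subseteq> germ C F j f"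
proof clarify
  fix m h assume "(m, h) \<in> germ C F k g"
  then obtain n where h: "m \<in> idx F" "h \<in> homs C X (fob F m)" and n: "(k, n) \<in> ile F" "(m, n) \<in> ile F"
      "far F (k, n) \<cdot> g = far F (m, n) \<cdot> h"
    using mem_germ[OF F g] by blast
  obtain p where p: "(l, p) \<in> ile F" "(n, p) \<in> ile F"
    using ile_upper[OF F] ile_idx[OF F] l n by meson
  have "far F (j, p) \<cdot> f = far F (l, p) \<cdot> (far F (j, l) \<cdot> f)"
    using far_assoc[OF F l(1) p(1) f] by simp
  also have "\<dots> = far F (k, p) \<cdot> g"
    using far_assoc[OF F l(2) p(1) g] l(3) by simp
  also have "\<dots> = far F (n, p) \<cdot> (far F (k, n) \<cdot> g)"
    using far_assoc[OF F n(1) p(2) g] by simp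
  also have "\<dots> = far F (m, p) \<cdot> h"
    using far_assoc[OF F n(2) p(2) h(2)] n(3) by simp
  finally show "(m, h) \<in> germ C F j f"
    using mem_germ[OF F f] h ile_trans[OF F] l n p by blast
qed

text \<open>Two morphisms into members of \<open>F\<close> have the same germ iff they agree further up in \<open>F\<close>.\<close>

lemma germ_eq_iff:
  assumes F: "is_ind_ob C F" and "j \<in> idx F" "f \<in> homs C X (fob F j)" "k \<in> idx F" "g \<in> homs C X (fob F k)"
  shows "germ C F j f = germ C F k g \<longleftrightarrow>
     (\<exists>l. (j, l) \<in> ile F \<and> (k, l) \<in> ile F \<and> far F (j, l) \<cdot> f = far F (k, l) \<cdot> g)" (is "?l \<longleftrightarrow> ?r")
proof
  assume ?l
  then have "(k, g) \<in> germ C F j f" using germ_self[OF F assms(4,5)] by simp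
  then show ?r using mem_germ[OF F assms(3)] by blast
next
  assume ?r
  then obtain l where l: "(j, l) \<in> ile F" "(k, l) \<in> ile F" "far F (j, l) \<cdot> f = far F (k, l) \<cdot> g"
    by blast
  show ?l
    using germ_mono[OF F assms(3,5) l] germ_mono[OF F assms(5,3) l(2,1) l(3)[symmetric]] by blast
qed

lemma germ_eq_mem:
  assumes F: "is_ind_ob C F" and "j \<in> idx F" "f \<in> homs C X (fob F j)" "(k, g) \<in> germ C F j f"
  shows "k \<in> idx F" "g \<in> homs C X (fob F k)" "germ C F k g = germ C F j f"
proof -
  show k: "k \<in> idx F" "g \<in> homs C X (fob F k)"
    using mem_germ[OF F assms(3)] assms(4) by auto
  show "germ C F k g = germ C F j f"
    using germ_eq_iff[OF F assms(2,3) k] mem_germ[OF F assms(3)] assms(4) by blast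
qed

lemma germ_far:
  assumes F: "is_ind_ob C F" and "(j, l) \<in> ile F" "f \<in> homs C X (fob F j)"
  shows "germ C F l (far F (j, l) \<cdot> f) = germ C F j f"
proof -
  have l: "l \<in> idx F" "j \<in> idx F" using ile_idx[OF F assms(2)] by auto
  have h: "far F (j, l) \<cdot> f \<in> homs C X (fob F l)"
    by (rule cmp_homs[OF assms(3) ind_far[OF F assms(2)]])
  show ?thesis
    unfolding germ_eq_iff[OF F l(1) h l(2) assms(3)]
    using ile_refl[OF F l(1)] assms(2) far_assoc[OF F assms(2) _ assms(3)] by blast
qed

lemma germ_precompose:
  assumes F: "is_ind_ob C F" and "j \<in> idx F" "f \<in> homs C X (fob F j)" "k \<in> idx F" "g \<in> homs C X (fob F k)"
    and h: "h \<in> homs C Y X" and "germ C F j f = germ C F k g"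
  shows "germ C F j (f \<cdot> h) = germ C F k (g \<cdot> h)"
proof -
  obtain l where l: "(j, l) \<in> ile F" "(k, l) \<in> ile F" "far F (j, l) \<cdot> f = far F (k, l) \<cdot> g"
    using germ_eq_iff[OF assms(1-5)] assms(7) by blast
  have "far F (j, l) \<cdot> (f \<cdot> h) = far F (k, l) \<cdot> (g \<cdot> h)"
    using cmp_assoc[OF h assms(3) ind_far[OF F l(1)]] cmp_assoc[OF h assms(5) ind_far[OF F l(2)]] l(3)
    by simp
  then show ?thesis
    using germ_eq_iff[OF F assms(2) cmp_homs[OF h assms(3)] assms(4) cmp_homs[OF h assms(5)]] l by blast
qed

lemma germ_eq_common:
  assumes F: "is_ind_ob C F" and "germ C F j f = germ C F k g"
    and "j \<in> idx F" "f \<in> homs C X (fob F j)" "k \<in> idx F" "g \<in> homs C X (fob F k)"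
  obtains l where "(j, l) \<in> ile F" "(k, l) \<in> ile F" "far F (j, l) \<cdot> f = far F (k, l) \<cdot> g"
  using germ_eq_iff[OF F assms(3-6)] assms(2) by blast

lemma Ind_simps:
  "Ob (Ind C) = {E. is_ind_ob C E}" "Ar (Ind C) = {\<phi>. is_ind_ar C \<phi>}" "Dom (Ind C) = isrc"
  "Cod (Ind C) = itgt" "Idn (Ind C) = (\<lambda>E. ind_rep C E E (\<lambda>i. i) (\<lambda>i. Idn C (fob E i)))"
  "Cmp (Ind C) = ind_cmp C"
  by (simp_all add: Ind_def)

text \<open>\<open>ind_hom E F \<phi>\<close> says that \<open>\<phi>\<close> is a morphism \<open>E \<rightarrow> F\<close>, in terms of representatives: every component is
  the germ of some \<open>f : E_i \<rightarrow> F_j\<close>, and restricting any representative along a transition morphism of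
  \<open>E\<close> represents the earlier component.\<close>

definition ind_hom where
  "ind_hom E F \<phi> \<longleftrightarrow> is_ind_ob C E \<and> is_ind_ob C F \<and> isrc \<phi> = E \<and> itgt \<phi> = F \<and>
     (\<forall>i \<in> idx E. \<exists>j f. j \<in> idx F \<and> f \<in> homs C (fob E i) (fob F j) \<and> ifam \<phi> i = germ C F j f) \<and>
     (\<forall>i i' j f. (i, i') \<in> ile E \<longrightarrow> j \<in> idx F \<longrightarrow> f \<in> homs C (fob E i') (fob F j) \<longrightarrow>
        ifam \<phi> i' = germ C F j f \<longrightarrow> ifam \<phi> i = germ C F j (f \<cdot> far E (i, i'))) \<and>
     (\<forall>i. i \<notin> idx E \<longrightarrow> ifam \<phi> i = {})"

lemma homs_Ind: "\<phi> \<in> homs (Ind C) E F \<longleftrightarrow> ind_hom E F \<phi>"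
proof (cases "is_ind_ob C E \<and> is_ind_ob C F \<and> isrc \<phi> = E \<and> itgt \<phi> = F \<and>
     (\<forall>i \<in> idx E. \<exists>j f. j \<in> idx F \<and> f \<in> homs C (fob E i) (fob F j) \<and> ifam \<phi> i = germ C F j f)")
  case False
  then have "\<not> ind_hom E F \<phi>" unfolding ind_hom_def by blast
  moreover have "\<not> (is_ind_ar C \<phi> \<and> isrc \<phi> = E \<and> itgt \<phi> = F)"
    using False unfolding is_ind_ar_def by blast
  ultimately show ?thesis by (simp add: homs_iff[of \<phi>] Ind_simps)
next
  case True
  then have EF: "is_ind_ob C E" "is_ind_ob C F" by auto
  have "(\<forall>(i, i') \<in> ile E. \<forall>(j, f) \<in> ifam \<phi> i'. (j, f \<cdot> far E (i, i')) \<in> ifam \<phi> i) \<longleftrightarrow>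
    (\<forall>i i' j f. (i, i') \<in> ile E \<longrightarrow> j \<in> idx F \<longrightarrow> f \<in> homs C (fob E i') (fob F j) \<longrightarrow>
        ifam \<phi> i' = germ C F j f \<longrightarrow> ifam \<phi> i = germ C F j (f \<cdot> far E (i, i')))" (is "?l \<longleftrightarrow> ?r")
  proof
    assume l: ?l
    show ?r
    proof (intro allI impI)
      fix i i' j f
      assume i: "(i, i') \<in> ile E" and j: "j \<in> idx F" and f: "f \<in> homs C (fob E i') (fob F j)"
        and e: "ifam \<phi> i' = germ C F j f"
      have "(j, f \<cdot> far E (i, i')) \<in> ifam \<phi> i"
        using l i e germ_self[OF EF(2) j f] by fastforce
      moreover obtain k g where "k \<in> idx F" "g \<in> homs C (fob E i) (fob F k)" "ifam \<phi> i = germ C F k g"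
        using True ile_idx[OF EF(1) i] by meson
      ultimately show "ifam \<phi> i = germ C F j (f \<cdot> far E (i, i'))"
        using germ_eq_mem(3)[OF EF(2)] by metis
    qed
  next
    assume r: ?r
    show ?l
    proof clarify
      fix i i' j f
      assume i: "(i, i') \<in> ile E" and f: "(j, f) \<in> ifam \<phi> i'"
      obtain k g where k: "k \<in> idx F" "g \<in> homs C (fob E i') (fob F k)" "ifam \<phi> i' = germ C F k g"
        using True ile_idx[OF EF(1) i] by meson
      have j: "j \<in> idx F" "f \<in> homs C (fob E i') (fob F j)" "germ C F j f = germ C F k g"
        using germ_eq_mem[OF EF(2) k(1,2)] f k(3) by auto
      have "ifam \<phi> i = germ C F j (f \<cdot> far E (i, i'))"
        using r i j k(3) by metis
      then show "(j, f \<cdot> far E (i, i')) \<in> ifam \<phi> i"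
        using germ_self[OF EF(2) j(1) cmp_homs[OF ind_far[OF EF(1) i] j(2)]] by simp
    qed
  qed
  moreover have "(\<forall>i \<in> idx E. \<exists>j \<in> idx F. \<exists>f \<in> homs C (fob E i) (fob F j). ifam \<phi> i = germ C F j f)"
    using True by blast
  ultimately show ?thesis
    using True by (simp add: homs_iff[of \<phi>] Ind_simps is_ind_ar_def ind_hom_def)
qed

text \<open>The last rule is the compatibility of the components with the transition morphisms.\<close>

lemma ind_homD:
  assumes "\<phi> \<in> homs (Ind C) E F"
  shows "is_ind_ob C E" "is_ind_ob C F" "isrc \<phi> = E" "itgt \<phi> = F"
    "\<And>i. i \<notin> idx E \<Longrightarrow> ifam \<phi> i = {}"
    "\<And>i i' j f. (i, i') \<in> ile E \<Longrightarrow> j \<in> idx F \<Longrightarrow> f \<in> homs C (fob E i') (fob F j) \<Longrightarrow>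
        ifam \<phi> i' = germ C F j f \<Longrightarrow> ifam \<phi> i = germ C F j (f \<cdot> far E (i, i'))"
  using assms unfolding homs_Ind ind_hom_def by blast+

lemma ind_hom_component:
  assumes "\<phi> \<in> homs (Ind C) E F" "i \<in> idx E"
  obtains j f where "j \<in> idx F" "f \<in> homs C (fob E i) (fob F j)" "ifam \<phi> i = germ C F j f"
  using assms unfolding homs_Ind ind_hom_def by meson

lemma ind_hom_eqI:
  assumes "\<phi> \<in> homs (Ind C) E F" "\<psi> \<in> homs (Ind C) E F" "\<And>i. i \<in> idx E \<Longrightarrow> ifam \<phi> i = ifam \<psi> i"
  shows "\<phi> = \<psi>"
proof -
  have "ifam \<phi> i = ifam \<psi> i" for i
    using ind_homD[OF assms(1)] ind_homD[OF assms(2)] assms(3) by (cases "i \<in> idx E") auto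
  then have "ifam \<phi> = ifam \<psi>" by blast
  then show ?thesis
    using ind_homD(3,4)[OF assms(1)] ind_homD(3,4)[OF assms(2)] by simp
qed

lemma homs_IndI:
  assumes "is_ind_ob C E" "is_ind_ob C F" "isrc \<phi> = E" "itgt \<phi> = F" "\<And>i. i \<notin> idx E \<Longrightarrow> ifam \<phi> i = {}"
    "\<And>i. i \<in> idx E \<Longrightarrow> s i \<in> idx F" "\<And>i. i \<in> idx E \<Longrightarrow> f i \<in> homs C (fob E i) (fob F (s i))"
    "\<And>i. i \<in> idx E \<Longrightarrow> ifam \<phi> i = germ C F (s i) (f i)"
    "\<And>i i'. (i, i') \<in> ile E \<Longrightarrow> germ C F (s i) (f i) = germ C F (s i') (f i' \<cdot> far E (i, i'))"
  shows "\<phi> \<in> homs (Ind C) E F"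
proof -
  have "ifam \<phi> i = germ C F j (g \<cdot> far E (i, i'))"
    if "(i, i') \<in> ile E" "j \<in> idx F" "g \<in> homs C (fob E i') (fob F j)" "ifam \<phi> i' = germ C F j g"
    for i i' j g
  proof -
    have i: "i \<in> idx E" "i' \<in> idx E" using ile_idx[OF assms(1) that(1)] by auto
    have "germ C F (s i') (f i') = germ C F j g" using assms(8)[OF i(2)] that(4) by simp
    then have "germ C F (s i') (f i' \<cdot> far E (i, i')) = germ C F j (g \<cdot> far E (i, i'))"
      by (intro germ_precompose[OF assms(2) assms(6)[OF i(2)] assms(7)[OF i(2)] that(2,3)
            ind_far[OF assms(1) that(1)]])
    then show ?thesis using assms(8)[OF i(1)] assms(9)[OF that(1)] by simp
  qed
  then show ?thesis
    unfolding homs_Ind ind_hom_def using assms(1-8) by blast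
qed

lemma ind_rep_homs:
  assumes "is_ind_ob C E" "is_ind_ob C F"
    "\<And>i. i \<in> idx E \<Longrightarrow> s i \<in> idx F" "\<And>i. i \<in> idx E \<Longrightarrow> f i \<in> homs C (fob E i) (fob F (s i))"
    "\<And>i i'. (i, i') \<in> ile E \<Longrightarrow> germ C F (s i) (f i) = germ C F (s i') (f i' \<cdot> far E (i, i'))"
  shows "ind_rep C E F s f \<in> homs (Ind C) E F"
  by (rule homs_IndI[where s = s and f = f]) (use assms in \<open>auto simp: ind_rep_def\<close>)

text \<open>Components of a composite may be computed with any representatives.\<close>

lemma ifam_cmp:
  assumes \<phi>: "\<phi> \<in> homs (Ind C) E F" and \<psi>: "\<psi> \<in> homs (Ind C) F G"
    and j: "j \<in> idx F" "f \<in> homs C (fob E i) (fob F j)" "ifam \<phi> i = germ C F j f"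
    and k: "k \<in> idx G" "g \<in> homs C (fob F j) (fob G k)" "ifam \<psi> j = germ C G k g"
  shows "ifam (ind_cmp C \<psi> \<phi>) i = germ C G k (g \<cdot> f)"
proof -
  have F: "is_ind_ob C F" and G: "is_ind_ob C G" using ind_homD[OF \<psi>] by auto
  have "germ C G k' (g' \<cdot> f') = germ C G k (g \<cdot> f)"
    if j': "(j', f') \<in> germ C F j f" and k': "(k', g') \<in> ifam \<psi> j'" for j' f' k' g'
  proof -
    have jf': "j' \<in> idx F" "f' \<in> homs C (fob E i) (fob F j')" "germ C F j' f' = germ C F j f"
      using germ_eq_mem[OF F j(1,2) j'] by auto
    \<comment> \<open>Both representatives are compared with a component of \<open>\<psi>\<close> at an index where \<open>f\<close> and \<open>f'\<close> agree.\<close>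
    obtain l where l: "(j', l) \<in> ile F" "(j, l) \<in> ile F" "far F (j', l) \<cdot> f' = far F (j, l) \<cdot> f"
      by (rule germ_eq_common[OF F jf'(3) jf'(1,2) j(1,2)])
    obtain m h where m: "m \<in> idx G" "h \<in> homs C (fob F l) (fob G m)" "ifam \<psi> l = germ C G m h"
      using ind_hom_component[OF \<psi>] ile_idx[OF F l(1)] by blast
    have "ifam \<psi> j' = germ C G m (h \<cdot> far F (j', l))"
      using ind_homD(6)[OF \<psi> l(1) m] .
    then have kg': "k' \<in> idx G" "g' \<in> homs C (fob F j') (fob G k')"
        "germ C G k' g' = germ C G m (h \<cdot> far F (j', l))"
      using germ_eq_mem[OF G m(1) cmp_homs[OF ind_far[OF F l(1)] m(2)]] k' by auto
    have e: "germ C G k g = germ C G m (h \<cdot> far F (j, l))"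
      using ind_homD(6)[OF \<psi> l(2) m] k(3) by simp
    have "germ C G k' (g' \<cdot> f') = germ C G m ((h \<cdot> far F (j', l)) \<cdot> f')"
      by (rule germ_precompose[OF G kg'(1,2) m(1) cmp_homs[OF ind_far[OF F l(1)] m(2)] jf'(2) kg'(3)])
    also have "(h \<cdot> far F (j', l)) \<cdot> f' = (h \<cdot> far F (j, l)) \<cdot> f"
      using cmp_assoc[OF jf'(2) ind_far[OF F l(1)] m(2)] cmp_assoc[OF j(2) ind_far[OF F l(2)] m(2)] l(3)
      by simp
    also have "germ C G m \<dots> = germ C G k (g \<cdot> f)"
      by (rule germ_precompose[OF G k(1,2) m(1) cmp_homs[OF ind_far[OF F l(2)] m(2)] j(2) e, symmetric])
    finally show ?thesis .
  qed
  moreover have "(j, f) \<in> germ C F j f" "(k, g) \<in> ifam \<psi> j"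
    using germ_self[OF F j(1,2)] germ_self[OF G k(1,2)] k(3) by auto
  ultimately show ?thesis
    unfolding ind_cmp_def j(3) ind_homD(4)[OF \<psi>] ind_ar.simps by (intro UN_pair_const)
qed

lemma ind_cmp_homs:
  assumes \<phi>: "\<phi> \<in> homs (Ind C) E F" and \<psi>: "\<psi> \<in> homs (Ind C) F G"
  shows "ind_cmp C \<psi> \<phi> \<in> homs (Ind C) E G"
proof -
  have E: "is_ind_ob C E" and F: "is_ind_ob C F" and G: "is_ind_ob C G"
    using ind_homD[OF \<psi>] ind_homD[OF \<phi>] by auto
  have "\<exists>j f k g. j \<in> idx F \<and> f \<in> homs C (fob E i) (fob F j) \<and> ifam \<phi> i = germ C F j f \<and>
      k \<in> idx G \<and> g \<in> homs C (fob F j) (fob G k) \<and> ifam \<psi> j = germ C G k g" if "i \<in> idx E" for i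
    using ind_hom_component[OF \<phi> that] ind_hom_component[OF \<psi>] by metis
  then obtain j f k g where *: "\<And>i. i \<in> idx E \<Longrightarrow> j i \<in> idx F \<and> f i \<in> homs C (fob E i) (fob F (j i)) \<and>
      ifam \<phi> i = germ C F (j i) (f i) \<and>
      k i \<in> idx G \<and> g i \<in> homs C (fob F (j i)) (fob G (k i)) \<and> ifam \<psi> (j i) = germ C G (k i) (g i)"
    by metis
  show ?thesis
  proof (rule homs_IndI[OF E G, where s = k and f = "\<lambda>i. g i \<cdot> f i"])
    show "ifam (ind_cmp C \<psi> \<phi>) i = {}" if "i \<notin> idx E" for i
      using ind_homD(5)[OF \<phi> that] by (simp add: ind_cmp_def)
    show "ifam (ind_cmp C \<psi> \<phi>) i = germ C G (k i) (g i \<cdot> f i)" if "i \<in> idx E" for i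
      using *[OF that] ifam_cmp[OF \<phi> \<psi>] by blast
    show "germ C G (k i) (g i \<cdot> f i) = germ C G (k i') ((g i' \<cdot> f i') \<cdot> far E (i, i'))"
      if i: "(i, i') \<in> ile E" for i i'
    proof -
      have ii: "i \<in> idx E" "i' \<in> idx E" using ile_idx[OF E i] by auto
      note i' = *[OF ii(2)]
      have e: "ifam \<phi> i = germ C F (j i') (f i' \<cdot> far E (i, i'))"
        using ind_homD(6)[OF \<phi> i] i' by blast
      have "ifam (ind_cmp C \<psi> \<phi>) i = germ C G (k i') (g i' \<cdot> (f i' \<cdot> far E (i, i')))"
        using ifam_cmp[OF \<phi> \<psi> _ cmp_homs[OF ind_far[OF E i]] e] i' by blast
      moreover have "ifam (ind_cmp C \<psi> \<phi>) i = germ C G (k i) (g i \<cdot> f i)"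
        using *[OF ii(1)] ifam_cmp[OF \<phi> \<psi>] by blast
      moreover have "(g i' \<cdot> f i') \<cdot> far E (i, i') = g i' \<cdot> (f i' \<cdot> far E (i, i'))"
        using cmp_assoc[OF ind_far[OF E i]] i' by blast
      ultimately show ?thesis by simp
    qed
  qed (use * ind_homD[OF \<phi>] ind_homD[OF \<psi>] in \<open>auto simp: ind_cmp_def intro: cmp_homs\<close>)
qed

lemma ifam_idn: "i \<in> idx E \<Longrightarrow> ifam (Idn (Ind C) E) i = germ C E i (Idn C (fob E i))"
  by (simp add: Ind_simps ind_rep_def)

lemma idn_Ind_homs:
  assumes E: "is_ind_ob C E"
  shows "Idn (Ind C) E \<in> homs (Ind C) E E"
  unfolding Ind_simps
proof (rule ind_rep_homs[OF E E])
  show "germ C E i (Idn C (fob E i)) = germ C E i' (Idn C (fob E i') \<cdot> far E (i, i'))"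
    if i: "(i, i') \<in> ile E" for i i'
  proof -
    have "Idn C (fob E i') \<cdot> far E (i, i') = far E (i, i') \<cdot> Idn C (fob E i)"
      using ind_far[OF E i] by (simp add: homs_iff)
    then show ?thesis
      using germ_far[OF E i idn_homs] ind_fob[OF E] ile_idx[OF E i] by simp
  qed
qed (use ind_fob[OF E] idn_homs in auto)

lemma category_Ind: "category (Ind C :: (('u ix, 'o, 'm) ind_ob, ('u ix, 'o, 'm) ind_ar) cat)"
    (is "category ?I")
proof
  fix \<phi> :: "('u ix, 'o, 'm) ind_ar" assume "\<phi> \<in> Ar ?I"
  then show "Dom ?I \<phi> \<in> Ob ?I" "Cod ?I \<phi> \<in> Ob ?I" by (auto simp: Ind_simps is_ind_ar_def)
next
  fix E :: "('u ix, 'o, 'm) ind_ob" assume "E \<in> Ob ?I"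
  then show "Idn ?I E \<in> homs ?I E E" using idn_Ind_homs by (simp add: Ind_simps(1))
next
  fix E F G :: "('u ix, 'o, 'm) ind_ob" and \<phi> \<psi>
  assume "\<phi> \<in> homs ?I E F" "\<psi> \<in> homs ?I F G"
  then show "\<psi> \<cdot>\<^bsub>?I\<^esub> \<phi> \<in> homs ?I E G" using ind_cmp_homs by (simp add: Ind_simps(6))
next
  fix E F :: "('u ix, 'o, 'm) ind_ob" and \<phi>
  assume \<phi>: "\<phi> \<in> homs ?I E F"
  then have E: "is_ind_ob C E" and F: "is_ind_ob C F" using ind_homD by auto
  show "\<phi> \<cdot>\<^bsub>?I\<^esub> Idn ?I E = \<phi>"
    unfolding Ind_simps(6)
  proof (rule ind_hom_eqI[OF ind_cmp_homs[OF idn_Ind_homs[OF E] \<phi>] \<phi>])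
    fix i assume i: "i \<in> idx E"
    obtain j f where j: "j \<in> idx F" "f \<in> homs C (fob E i) (fob F j)" "ifam \<phi> i = germ C F j f"
      by (rule ind_hom_component[OF \<phi> i])
    show "ifam (ind_cmp C \<phi> (Idn ?I E)) i = ifam \<phi> i"
      using ifam_cmp[OF idn_Ind_homs[OF E] \<phi> i idn_homs[OF ind_fob[OF E i]] ifam_idn[OF i] j]
        cmp_idn[OF j(2)] j(3) by simp
  qed
  show "Idn ?I F \<cdot>\<^bsub>?I\<^esub> \<phi> = \<phi>"
    unfolding Ind_simps(6)
  proof (rule ind_hom_eqI[OF ind_cmp_homs[OF \<phi> idn_Ind_homs[OF F]] \<phi>])
    fix i assume i: "i \<in> idx E"
    obtain j f where j: "j \<in> idx F" "f \<in> homs C (fob E i) (fob F j)" "ifam \<phi> i = germ C F j f"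
      by (rule ind_hom_component[OF \<phi> i])
    show "ifam (ind_cmp C (Idn ?I F) \<phi>) i = ifam \<phi> i"
      using ifam_cmp[OF \<phi> idn_Ind_homs[OF F] j j(1) idn_homs[OF ind_fob[OF F j(1)]] ifam_idn[OF j(1)]]
        idn_cmp[OF j(2)] j(3) by simp
  qed
next
  fix E F G H :: "('u ix, 'o, 'm) ind_ob" and \<phi> \<psi> \<chi>
  assume \<phi>: "\<phi> \<in> homs ?I E F" and \<psi>: "\<psi> \<in> homs ?I F G" and \<chi>: "\<chi> \<in> homs ?I G H"
  show "(\<chi> \<cdot>\<^bsub>?I\<^esub> \<psi>) \<cdot>\<^bsub>?I\<^esub> \<phi> = \<chi> \<cdot>\<^bsub>?I\<^esub> (\<psi> \<cdot>\<^bsub>?I\<^esub> \<phi>)"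
    unfolding Ind_simps(6)
  proof (rule ind_hom_eqI)
    show "ind_cmp C (ind_cmp C \<chi> \<psi>) \<phi> \<in> homs ?I E H" "ind_cmp C \<chi> (ind_cmp C \<psi> \<phi>) \<in> homs ?I E H"
      using \<phi> \<psi> \<chi> ind_cmp_homs by blast+
    fix i assume i: "i \<in> idx E"
    obtain j f where j: "j \<in> idx F" "f \<in> homs C (fob E i) (fob F j)" "ifam \<phi> i = germ C F j f"
      by (rule ind_hom_component[OF \<phi> i])
    obtain k g where k: "k \<in> idx G" "g \<in> homs C (fob F j) (fob G k)" "ifam \<psi> j = germ C G k g"
      by (rule ind_hom_component[OF \<psi> j(1)])
    obtain l h where l: "l \<in> idx H" "h \<in> homs C (fob G k) (fob H l)" "ifam \<chi> k = germ C H l h"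
      by (rule ind_hom_component[OF \<chi> k(1)])
    show "ifam (ind_cmp C (ind_cmp C \<chi> \<psi>) \<phi>) i = ifam (ind_cmp C \<chi> (ind_cmp C \<psi> \<phi>)) i"
      using ifam_cmp[OF \<phi> ind_cmp_homs[OF \<psi> \<chi>] j l(1) cmp_homs[OF k(2) l(2)] ifam_cmp[OF \<psi> \<chi> k l]]
        ifam_cmp[OF ind_cmp_homs[OF \<phi> \<psi>] \<chi> k(1) cmp_homs[OF j(2) k(2)] ifam_cmp[OF \<phi> \<psi> j k] l]
        cmp_assoc[OF j(2) k(2) l(2)] by simp
  qed
qed

lemma const_ob_simps [simp]:
  "fob (const_ob C X) i = X" "far (const_ob C X) a = Idn C X"
  "idx (const_ob C X) = {Point}" "ile (const_ob C X) = {(Point, Point)}"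
  by (simp_all add: const_ob_def)

lemma const_ob_ind_ob: "X \<in> Ob C \<Longrightarrow> is_ind_ob C (const_ob C X)"
  by (rule is_ind_obI) (auto simp: idn_homs)

text \<open>Germs into a constant object are morphisms.\<close>

lemma germ_const:
  assumes "f \<in> homs C Y X" "g \<in> homs C Y X"
  shows "germ C (const_ob C X) Point f = germ C (const_ob C X) Point g \<longleftrightarrow> f = g"
  using germ_eq_iff[OF const_ob_ind_ob[OF conjunct2[OF homs_ob[OF assms(1)]]], of Point f Y Point g]
    assms idn_cmp[OF assms(1)] idn_cmp[OF assms(2)] by simp

lemma const_ar_homs:
  assumes f: "f \<in> homs C X Y"
  shows "const_ar C f \<in> homs (Ind C) (const_ob C X) (const_ob C Y)"
    "ifam (const_ar C f) Point = germ C (const_ob C Y) Point f"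
proof -
  have e: "const_ar C f = ind_rep C (const_ob C X) (const_ob C Y) (\<lambda>_. Point) (\<lambda>_. f)"
    using f by (simp add: const_ar_def homs_iff)
  show "const_ar C f \<in> homs (Ind C) (const_ob C X) (const_ob C Y)"
    unfolding e using f homs_ob[OF f] cmp_idn[OF f]
    by (intro ind_rep_homs const_ob_ind_ob) auto
  show "ifam (const_ar C f) Point = germ C (const_ob C Y) Point f"
    unfolding e by (simp add: ind_rep_def)
qed

lemma const_component:
  assumes "\<phi> \<in> homs (Ind C) E (const_ob C X)" "i \<in> idx E"
  obtains f where "f \<in> homs C (fob E i) X" "ifam \<phi> i = germ C (const_ob C X) Point f"
  using ind_hom_component[OF assms] by auto

end

section \<open>The tensor product of ind-objects\<close>

context closed_symmetric_monoidal
begin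

lemma ind_tensor_simps [simp]:
  "fob (ind_tensor M E F) (Duo i j) = fob E i \<otimes> fob F j"
  "far (ind_tensor M E F) (Duo i j, Duo i' j') = far E (i, i') \<odot> far F (j, j')"
  "Duo i j \<in> idx (ind_tensor M E F) \<longleftrightarrow> i \<in> idx E \<and> j \<in> idx F"
  "(Duo i j, Duo i' j') \<in> ile (ind_tensor M E F) \<longleftrightarrow> (i, i') \<in> ile E \<and> (j, j') \<in> ile F"
  by (auto simp: ind_tensor_def)

lemma idx_ind_tensorE:
  assumes "x \<in> idx (ind_tensor M E F)"
  obtains i j where "x = Duo i j" "i \<in> idx E" "j \<in> idx F"
  using assms by (auto simp: ind_tensor_def)

lemma ile_ind_tensorE:
  assumes "(x, y) \<in> ile (ind_tensor M E F)"
  obtains i j i' j' where "x = Duo i j" "y = Duo i' j'" "(i, i') \<in> ile E" "(j, j') \<in> ile F"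
  using assms by (auto simp: ind_tensor_def)

lemma ind_tensor_ind_ob:
  assumes E: "is_ind_ob M E" and F: "is_ind_ob M F"
  shows "is_ind_ob M (ind_tensor M E F)"
proof (rule is_ind_obI)
  have antisym: "antisym (ile E)" "antisym (ile F)"
    using E F by (auto simp: is_ind_ob_def filtered_poset_def partial_order_on_def)
  note h = ile_idx[OF E] ile_idx[OF F]
  show "x \<in> idx (ind_tensor M E F) \<and> y \<in> idx (ind_tensor M E F)"
    if "(x, y) \<in> ile (ind_tensor M E F)" for x y
    using that h by (auto elim!: ile_ind_tensorE)
  show "(x, x) \<in> ile (ind_tensor M E F)" if "x \<in> idx (ind_tensor M E F)" for x
    using that ile_refl[OF E] ile_refl[OF F] by (auto elim!: idx_ind_tensorE)
  show "(x, z) \<in> ile (ind_tensor M E F)"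
    if "(x, y) \<in> ile (ind_tensor M E F)" "(y, z) \<in> ile (ind_tensor M E F)" for x y z
    using that ile_trans[OF E] ile_trans[OF F] by (auto elim!: ile_ind_tensorE)
  show "x = y"
    if "(x, y) \<in> ile (ind_tensor M E F)" "(y, x) \<in> ile (ind_tensor M E F)" for x y
    using that antisymD[OF antisym(1)] antisymD[OF antisym(2)] by (auto elim!: ile_ind_tensorE)
  show "\<exists>z. (x, z) \<in> ile (ind_tensor M E F) \<and> (y, z) \<in> ile (ind_tensor M E F)"
    if xy: "x \<in> idx (ind_tensor M E F)" "y \<in> idx (ind_tensor M E F)" for x y
  proof -
    obtain i j i' j' where x: "x = Duo i j" "i \<in> idx E" "j \<in> idx F" 
      and y: "y = Duo i' j'" "i' \<in> idx E" "j' \<in> idx F"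
      using xy by (auto elim!: idx_ind_tensorE)
    obtain k l where "(i, k) \<in> ile E" "(i', k) \<in> ile E" "(j, l) \<in> ile F" "(j', l) \<in> ile F"
      using ile_upper[OF E x(2) y(2)] ile_upper[OF F x(3) y(3)] by blast
    then show ?thesis unfolding x(1) y(1) by (intro exI[of _ "Duo k l"]) simp
  qed
  show "idx (ind_tensor M E F) \<noteq> {}"
    using idx_nonempty[OF E] idx_nonempty[OF F] by (auto simp: ind_tensor_def)
  show "fob (ind_tensor M E F) x \<in> Ob M" if "x \<in> idx (ind_tensor M E F)" for x
    using that ind_fob[OF E] ind_fob[OF F] by (auto elim!: idx_ind_tensorE)
  show "far (ind_tensor M E F) (x, y) \<in> homs M (fob (ind_tensor M E F) x) (fob (ind_tensor M E F) y)"
    if "(x, y) \<in> ile (ind_tensor M E F)" for x y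
    using that ind_far[OF E] ind_far[OF F] by (auto elim!: ile_ind_tensorE intro!: tar_homs)
  show "far (ind_tensor M E F) (x, x) = Idn M (fob (ind_tensor M E F) x)"
    if "x \<in> idx (ind_tensor M E F)" for x
    using that ind_far_refl[OF E] ind_far_refl[OF F] ind_fob[OF E] ind_fob[OF F]
    by (auto elim!: idx_ind_tensorE)
  show "far (ind_tensor M E F) (y, z) \<cdot> far (ind_tensor M E F) (x, y) = far (ind_tensor M E F) (x, z)"
    if xy: "(x, y) \<in> ile (ind_tensor M E F)" "(y, z) \<in> ile (ind_tensor M E F)" for x y z
  proof -
    obtain i j i' j' where x: "x = Duo i j" "y = Duo i' j'" "(i, i') \<in> ile E" "(j, j') \<in> ile F"
      by (rule ile_ind_tensorE[OF xy(1)])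
    obtain i'' j'' where z: "z = Duo i'' j''" "(i', i'') \<in> ile E" "(j', j'') \<in> ile F"
      using xy(2) x(2) by (auto elim!: ile_ind_tensorE)
    show ?thesis
      unfolding x(1,2) z(1)
      using ind_far[OF E x(3)] ind_far[OF E z(2)] ind_far[OF F x(4)] ind_far[OF F z(3)]
        ind_far_cmp[OF E x(3) z(2)] ind_far_cmp[OF F x(4) z(3)]
      by (simp add: homs_iff)
  qed
qed

lemma germ_tensor:
  assumes E: "is_ind_ob M E" and F: "is_ind_ob M F"
    and f: "i \<in> idx E" "f \<in> homs M X (fob E i)" "i' \<in> idx E" "f' \<in> homs M X (fob E i')"
      "germ M E i f = germ M E i' f'"
    and g: "j \<in> idx F" "g \<in> homs M Y (fob F j)" "j' \<in> idx F" "g' \<in> homs M Y (fob F j')"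
      "germ M F j g = germ M F j' g'"
  shows "germ M (ind_tensor M E F) (Duo i j) (f \<odot> g) = germ M (ind_tensor M E F) (Duo i' j') (f' \<odot> g')"
proof -
  obtain k where k: "(i, k) \<in> ile E" "(i', k) \<in> ile E" "far E (i, k) \<cdot> f = far E (i', k) \<cdot> f'"
    by (rule germ_eq_common[OF E f(5) f(1-4)])
  obtain l where l: "(j, l) \<in> ile F" "(j', l) \<in> ile F" "far F (j, l) \<cdot> g = far F (j', l) \<cdot> g'"
    by (rule germ_eq_common[OF F g(5) g(1-4)])
  have "far (ind_tensor M E F) (Duo i j, Duo k l) \<cdot> (f \<odot> g) =
      far (ind_tensor M E F) (Duo i' j', Duo k l) \<cdot> (f' \<odot> g')"
    using f g k(3) l(3) ind_far[OF E k(1)] ind_far[OF E k(2)] ind_far[OF F l(1)] ind_far[OF F l(2)]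
    by (simp add: homs_iff)
  moreover have "Duo i j \<in> idx (ind_tensor M E F)" "Duo i' j' \<in> idx (ind_tensor M E F)"
    "f \<odot> g \<in> homs M (X \<otimes> Y) (fob (ind_tensor M E F) (Duo i j))" 
    "f' \<odot> g' \<in> homs M (X \<otimes> Y) (fob (ind_tensor M E F) (Duo i' j'))" 
    "(Duo i j, Duo k l) \<in> ile (ind_tensor M E F)" "(Duo i' j', Duo k l) \<in> ile (ind_tensor M E F)"
    using f g k l by (auto intro!: tar_homs)
  ultimately show ?thesis
    using germ_eq_iff[OF ind_tensor_ind_ob[OF E F]] by blast
qed

lemma ifam_tensor:
  assumes \<phi>: "\<phi> \<in> homs (Ind M) E E'" and \<psi>: "\<psi> \<in> homs (Ind M) F F'"
    and i: "i \<in> idx E" "k \<in> idx E'" "f \<in> homs M (fob E i) (fob E' k)" "ifam \<phi> i = germ M E' k f"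
    and j: "j \<in> idx F" "l \<in> idx F'" "g \<in> homs M (fob F j) (fob F' l)" "ifam \<psi> j = germ M F' l g"
  shows "ifam (ind_tensor_ar M \<phi> \<psi>) (Duo i j) = germ M (ind_tensor M E' F') (Duo k l) (f \<odot> g)"
proof -
  have E': "is_ind_ob M E'" and F': "is_ind_ob M F'" using ind_homD[OF \<phi>] ind_homD[OF \<psi>] by auto
  have "germ M (ind_tensor M E' F') (Duo k' l') (f' \<odot> g') = germ M (ind_tensor M E' F') (Duo k l) (f \<odot> g)"
    if "(k', f') \<in> germ M E' k f" "(l', g') \<in> germ M F' l g" for k' f' l' g'
    using germ_eq_mem[OF E' i(2,3) that(1)] germ_eq_mem[OF F' j(2,3) that(2)] i(2,3) j(2,3)
    by (intro germ_tensor[OF E' F'])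
  moreover have "(k, f) \<in> germ M E' k f" "(l, g) \<in> germ M F' l g"
    using germ_self[OF E' i(2,3)] germ_self[OF F' j(2,3)] by auto
  ultimately have "(\<Union>(k', f') \<in> germ M E' k f. \<Union>(l', g') \<in> germ M F' l g.
      germ M (ind_tensor M E' F') (Duo k' l') (f' \<odot> g')) = germ M (ind_tensor M E' F') (Duo k l) (f \<odot> g)"
    by (intro UN_pair_const)
  then show ?thesis
    using i(1,4) j(1,4) ind_homD(3,4)[OF \<phi>] ind_homD(3,4)[OF \<psi>] by (simp add: ind_tensor_ar_def)
qed

lemma ind_tensor_ar_homs:
  assumes \<phi>: "\<phi> \<in> homs (Ind M) E E'" and \<psi>: "\<psi> \<in> homs (Ind M) F F'"
  shows "ind_tensor_ar M \<phi> \<psi> \<in> homs (Ind M) (ind_tensor M E F) (ind_tensor M E' F')"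
proof -
  have E: "is_ind_ob M E" and E': "is_ind_ob M E'" and F: "is_ind_ob M F" and F': "is_ind_ob M F'"
    using ind_homD[OF \<phi>] ind_homD[OF \<psi>] by auto
  have "\<exists>k f. k \<in> idx E' \<and> f \<in> homs M (fob E i) (fob E' k) \<and> ifam \<phi> i = germ M E' k f" if "i \<in> idx E" for i
    using ind_hom_component[OF \<phi> that] by metis
  then obtain k f where f: "\<And>i. i \<in> idx E \<Longrightarrow> k i \<in> idx E'"
      "\<And>i. i \<in> idx E \<Longrightarrow> f i \<in> homs M (fob E i) (fob E' (k i))"
      "\<And>i. i \<in> idx E \<Longrightarrow> ifam \<phi> i = germ M E' (k i) (f i)"
    by metis
  have "\<exists>l g. l \<in> idx F' \<and> g \<in> homs M (fob F j) (fob F' l) \<and> ifam \<psi> j = germ M F' l g" if "j \<in> idx F" for j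
    using ind_hom_component[OF \<psi> that] by metis
  then obtain l g where g: "\<And>j. j \<in> idx F \<Longrightarrow> l j \<in> idx F'"
      "\<And>j. j \<in> idx F \<Longrightarrow> g j \<in> homs M (fob F j) (fob F' (l j))"
      "\<And>j. j \<in> idx F \<Longrightarrow> ifam \<psi> j = germ M F' (l j) (g j)"
    by metis
  show ?thesis
  proof (rule homs_IndI[OF ind_tensor_ind_ob[OF E F] ind_tensor_ind_ob[OF E' F'],
        where s = "\<lambda>x. Duo (k (duo1 x)) (l (duo2 x))" and f = "\<lambda>x. f (duo1 x) \<odot> g (duo2 x)"])
    show "isrc (ind_tensor_ar M \<phi> \<psi>) = ind_tensor M E F" "itgt (ind_tensor_ar M \<phi> \<psi>) = ind_tensor M E' F'"
      using ind_homD[OF \<phi>] ind_homD[OF \<psi>] by (auto simp: ind_tensor_ar_def)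
    show "ifam (ind_tensor_ar M \<phi> \<psi>) x = {}" if "x \<notin> idx (ind_tensor M E F)" for x
      using ind_homD[OF \<phi>] ind_homD[OF \<psi>] that by (auto simp: ind_tensor_ar_def)
    fix x assume "x \<in> idx (ind_tensor M E F)"
    then obtain i j where x: "x = Duo i j" "i \<in> idx E" "j \<in> idx F" by (rule idx_ind_tensorE)
    show "Duo (k (duo1 x)) (l (duo2 x)) \<in> idx (ind_tensor M E' F')"
      "f (duo1 x) \<odot> g (duo2 x) \<in> homs M (fob (ind_tensor M E F) x)
         (fob (ind_tensor M E' F') (Duo (k (duo1 x)) (l (duo2 x))))"
      using f g x by (auto intro!: tar_homs)
    show "ifam (ind_tensor_ar M \<phi> \<psi>) x = germ M (ind_tensor M E' F') (Duo (k (duo1 x)) (l (duo2 x)))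
        (f (duo1 x) \<odot> g (duo2 x))"
      using ifam_tensor[OF \<phi> \<psi>] f g x by simp
  next
    fix x x' assume "(x, x') \<in> ile (ind_tensor M E F)"
    then obtain i j i' j' where x: "x = Duo i j" "x' = Duo i' j'" and i: "(i, i') \<in> ile E" and j: "(j, j') \<in> ile F"
      by (rule ile_ind_tensorE)
    have ii: "i \<in> idx E" "i' \<in> idx E" and jj: "j \<in> idx F" "j' \<in> idx F"
      using ile_idx[OF E i] ile_idx[OF F j] by auto
    have "germ M E' (k i) (f i) = germ M E' (k i') (f i' \<cdot> far E (i, i'))"
      using ind_homD(6)[OF \<phi> i] f ii by metis
    moreover have "germ M F' (l j) (g j) = germ M F' (l j') (g j' \<cdot> far F (j, j'))"
      using ind_homD(6)[OF \<psi> j] g jj by metis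
    ultimately have "germ M (ind_tensor M E' F') (Duo (k i) (l j)) (f i \<odot> g j) =
        germ M (ind_tensor M E' F') (Duo (k i') (l j')) ((f i' \<cdot> far E (i, i')) \<odot> (g j' \<cdot> far F (j, j')))"
      by (intro germ_tensor[OF E' F' f(1)[OF ii(1)] f(2)[OF ii(1)] f(1)[OF ii(2)]
            cmp_homs[OF ind_far[OF E i] f(2)[OF ii(2)]] _ g(1)[OF jj(1)] g(2)[OF jj(1)] g(1)[OF jj(2)]
            cmp_homs[OF ind_far[OF F j] g(2)[OF jj(2)]]])
    also have "(f i' \<cdot> far E (i, i')) \<odot> (g j' \<cdot> far F (j, j')) = (f i' \<odot> g j') \<cdot> (far E (i, i') \<odot> far F (j, j'))"
      using f(2)[OF ii(2)] g(2)[OF jj(2)] ind_far[OF E i] ind_far[OF F j] by (simp add: homs_iff)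
    finally show "germ M (ind_tensor M E' F') (Duo (k (duo1 x)) (l (duo2 x))) (f (duo1 x) \<odot> g (duo2 x)) =
        germ M (ind_tensor M E' F') (Duo (k (duo1 x')) (l (duo2 x')))
          ((f (duo1 x') \<odot> g (duo2 x')) \<cdot> far (ind_tensor M E F) (x, x'))"
      unfolding x by simp
  qed
qed

lemma ind_tensor_ar_cmp:
  assumes \<phi>: "\<phi> \<in> homs (Ind M) E E'" and \<phi>': "\<phi>' \<in> homs (Ind M) E' E''"
    and \<psi>: "\<psi> \<in> homs (Ind M) F F'" and \<psi>': "\<psi>' \<in> homs (Ind M) F' F''"
  shows "ind_cmp M (ind_tensor_ar M \<phi>' \<psi>') (ind_tensor_ar M \<phi> \<psi>) =
    ind_tensor_ar M (ind_cmp M \<phi>' \<phi>) (ind_cmp M \<psi>' \<psi>)"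
proof (rule ind_hom_eqI)
  show "ind_cmp M (ind_tensor_ar M \<phi>' \<psi>') (ind_tensor_ar M \<phi> \<psi>) \<in>
      homs (Ind M) (ind_tensor M E F) (ind_tensor M E'' F'')"
    by (rule ind_cmp_homs[OF ind_tensor_ar_homs[OF \<phi> \<psi>] ind_tensor_ar_homs[OF \<phi>' \<psi>']])
  show "ind_tensor_ar M (ind_cmp M \<phi>' \<phi>) (ind_cmp M \<psi>' \<psi>) \<in>
      homs (Ind M) (ind_tensor M E F) (ind_tensor M E'' F'')"
    by (rule ind_tensor_ar_homs[OF ind_cmp_homs[OF \<phi> \<phi>'] ind_cmp_homs[OF \<psi> \<psi>']])
  fix x assume "x \<in> idx (ind_tensor M E F)"
  then obtain i j where x: "x = Duo i j" and i: "i \<in> idx E" and j: "j \<in> idx F" by (rule idx_ind_tensorE)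
  obtain k f where f: "k \<in> idx E'" "f \<in> homs M (fob E i) (fob E' k)" "ifam \<phi> i = germ M E' k f"
    by (rule ind_hom_component[OF \<phi> i])
  obtain k' f' where f': "k' \<in> idx E''" "f' \<in> homs M (fob E' k) (fob E'' k')" "ifam \<phi>' k = germ M E'' k' f'"
    by (rule ind_hom_component[OF \<phi>' f(1)])
  obtain l g where g: "l \<in> idx F'" "g \<in> homs M (fob F j) (fob F' l)" "ifam \<psi> j = germ M F' l g"
    by (rule ind_hom_component[OF \<psi> j])
  obtain l' g' where g': "l' \<in> idx F''" "g' \<in> homs M (fob F' l) (fob F'' l')" "ifam \<psi>' l = germ M F'' l' g'"
    by (rule ind_hom_component[OF \<psi>' g(1)])
  have "ifam (ind_cmp M (ind_tensor_ar M \<phi>' \<psi>') (ind_tensor_ar M \<phi> \<psi>)) (Duo i j) =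
      germ M (ind_tensor M E'' F'') (Duo k' l') ((f' \<odot> g') \<cdot> (f \<odot> g))"
    using f g f' g' by (intro ifam_cmp[OF ind_tensor_ar_homs[OF \<phi> \<psi>] ind_tensor_ar_homs[OF \<phi>' \<psi>'],
          of "Duo k l"] ifam_tensor[OF \<phi> \<psi> i _ _ _ j] ifam_tensor[OF \<phi>' \<psi>']) (auto intro: tar_homs)
  moreover have "ifam (ind_tensor_ar M (ind_cmp M \<phi>' \<phi>) (ind_cmp M \<psi>' \<psi>)) (Duo i j) =
      germ M (ind_tensor M E'' F'') (Duo k' l') ((f' \<cdot> f) \<odot> (g' \<cdot> g))"
    by (rule ifam_tensor[OF ind_cmp_homs[OF \<phi> \<phi>'] ind_cmp_homs[OF \<psi> \<psi>']
          i f'(1) cmp_homs[OF f(2) f'(2)] ifam_cmp[OF \<phi> \<phi>' f f']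
          j g'(1) cmp_homs[OF g(2) g'(2)] ifam_cmp[OF \<psi> \<psi>' g g']])
  ultimately show "ifam (ind_cmp M (ind_tensor_ar M \<phi>' \<psi>') (ind_tensor_ar M \<phi> \<psi>)) x =
      ifam (ind_tensor_ar M (ind_cmp M \<phi>' \<phi>) (ind_cmp M \<psi>' \<psi>)) x"
    using tar_cmp[OF f(2) f'(2) g(2) g'(2)] x by simp
qed

lemma ind_tensor_ar_idn:
  assumes E: "is_ind_ob M E" and F: "is_ind_ob M F"
  shows "ind_tensor_ar M (Idn (Ind M) E) (Idn (Ind M) F) = Idn (Ind M) (ind_tensor M E F)"
proof (rule ind_hom_eqI[OF ind_tensor_ar_homs[OF idn_Ind_homs[OF E] idn_Ind_homs[OF F]]
      idn_Ind_homs[OF ind_tensor_ind_ob[OF E F]]])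
  fix x assume x: "x \<in> idx (ind_tensor M E F)"
  then obtain i j where ij: "x = Duo i j" "i \<in> idx E" "j \<in> idx F" by (rule idx_ind_tensorE)
  show "ifam (ind_tensor_ar M (Idn (Ind M) E) (Idn (Ind M) F)) x = ifam (Idn (Ind M) (ind_tensor M E F)) x"
    unfolding ifam_idn[OF x]
    using ifam_tensor[OF idn_Ind_homs[OF E] idn_Ind_homs[OF F] ij(2,2) idn_homs[OF ind_fob[OF E ij(2)]] 
        ifam_idn[OF ij(2)] ij(3,3) idn_homs[OF ind_fob[OF F ij(3)]] ifam_idn[OF ij(3)]]
      ind_fob[OF E ij(2)] ind_fob[OF F ij(3)]
    by (simp add: ij(1))
qed

section \<open>Nuclear objects have trace-class transition morphisms\<close>

lemma curried_property:
  assumes "X \<in> Ob M" "A \<in> Ob M" "B \<in> Ob M" "f \<in> homs M (X \<otimes> A) B"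
  shows "curried M X A B f \<in> homs M X (ihom M A B)" "evl M A B \<cdot> (curried M X A B f \<odot> Idn M A) = f"
  using theI'[OF evl_universal[OF assms]] unfolding curried_def by auto

text \<open>Postcomposition in the internal Hom, after uncurrying, is postcomposition.\<close>

lemma ihom_post_uncurry:
  assumes "X \<in> Ob M" and g: "g \<in> homs M B B'" and h: "h \<in> homs M Y (ihom M X B)"
  shows "evl M X B' \<cdot> ((ihom_post M X g \<cdot> h) \<odot> Idn M X) = g \<cdot> evl M X B \<cdot> (h \<odot> Idn M X)"
proof -
  have B [simp]: "B \<in> Ob M" "B' \<in> Ob M" "X \<in> Ob M" using homs_ob[OF g] assms by auto
  have gs [simp]: "g \<in> Ar M" "Dom M g = B" "Cod M g = B'" and hs [simp]: "h \<in> Ar M" "Cod M h = ihom M X B"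
    using g h by (auto simp: homs_iff)
  let ?p = "ihom_post M X g"
  have p: "?p \<in> homs M (ihom M X B) (ihom M X B')" "evl M X B' \<cdot> (?p \<odot> Idn M X) = g \<cdot> evl M X B"
    using curried_property[of "ihom M X B" X B' "g \<cdot> evl M X B"] by (auto simp: ihom_post_def homs_iff)
  have [simp]: "?p \<in> Ar M" "Dom M ?p = ihom M X B" "Cod M ?p = ihom M X B'" using p(1) by (auto simp: homs_iff)
  have "evl M X B' \<cdot> ((?p \<cdot> h) \<odot> Idn M X) = evl M X B' \<cdot> (?p \<odot> Idn M X) \<cdot> (h \<odot> Idn M X)"
    by simp
  also have "\<dots> = g \<cdot> evl M X B \<cdot> (h \<odot> Idn M X)"
    by (simp add: reduce2[OF p(2)] del: interchange interchange_reduce)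
  finally show ?thesis .
qed

lemma dual_ob [simp]: "X \<in> Ob M \<Longrightarrow> dual M X \<in> Ob M"
  by (simp add: dual_def)

lemma dual_tensor_to_ihom_uncurry:
  assumes [simp]: "X \<in> Ob M" "B \<in> Ob M"
  shows "dual_tensor_to_ihom M X B \<in> homs M (dual M X \<otimes> B) (ihom M X B)"
    "evl M X B \<cdot> (dual_tensor_to_ihom M X B \<odot> Idn M X) = pairing_action (dual M X) X B (evl M X (unt M))"
proof -
  have "dual_tensor_to_ihom M X B = 
      curried M (dual M X \<otimes> B) X B (pairing_action (dual M X) X B (evl M X (unt M)))"
    by (simp add: dual_tensor_to_ihom_def pairing_action_def)
  moreover have "pairing_action (dual M X) X B (evl M X (unt M)) \<in> homs M ((dual M X \<otimes> B) \<otimes> X) B"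
    unfolding homs_iff by (simp add: dual_def)
  ultimately show "dual_tensor_to_ihom M X B \<in> homs M (dual M X \<otimes> B) (ihom M X B)"
    "evl M X B \<cdot> (dual_tensor_to_ihom M X B \<odot> Idn M X) = pairing_action (dual M X) X B (evl M X (unt M))"
    using curried_property[of "dual M X \<otimes> B" X B] by simp_all
qed

text \<open>From every \<open>W_j\<close> there is a transition morphism \<open>W_j \<rightarrow> W_j'\<close> that is the composite of a copairing
  \<open>e \<rightarrow> D \<otimes> W_j'\<close> and a pairing \<open>W_j \<otimes> D \<rightarrow> e\<close>. Here \<open>D\<close> is any object, not necessarily the dual of \<open>W_j\<close>.\<close>

definition trace_class_transitions where
  "trace_class_transitions W \<longleftrightarrow> (\<forall>j \<in> idx W. \<exists>j' D \<epsilon> t. (j, j') \<in> ile W \<and> D \<in> Ob M \<and>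
     \<epsilon> \<in> homs M (fob W j \<otimes> D) (unt M) \<and> t \<in> homs M (unt M) (D \<otimes> fob W j') \<and>
     lun M (fob W j') \<cdot> (\<epsilon> \<odot> Idn M (fob W j')) \<cdot> inv_ar M (asc M (fob W j) D (fob W j'))
       \<cdot> (Idn M (fob W j) \<odot> t) \<cdot> inv_ar M (run M (fob W j)) = far W (j, j'))"

text \<open>For \<open>X = W_j\<close>, the inverse of \<open>X\<^sup>\<or> \<otimes> W \<rightarrow> Hom(X, W)\<close> sends the name \<open>e \<rightarrow> Hom(X, X)\<close> of the identity,
  viewed in \<open>"colim"_k Hom(X, W_k)\<close> at the index \<open>j\<close>, to some \<open>e \<rightarrow> X\<^sup>\<or> \<otimes> W_{j1}\<close>. Its image in
  \<open>"colim"_k Hom(X, W_k)\<close> is again the name of the identity, so the two agree at a later index \<open>j2\<close>, which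
  is to say that the copairing induces the transition morphism \<open>X \<rightarrow> W_{j2}\<close>.\<close>

lemma nuclear_trace_class:
  assumes W: "is_ind_ob M (W :: ('u ix, 'o, 'm) ind_ob)" and "nuclear M W"
  shows "trace_class_transitions W"
  unfolding trace_class_transitions_def
proof
  fix j assume j: "j \<in> idx W"
  define X where "X = fob W j"
  have X [simp]: "X \<in> Ob M" using ind_fob[OF W j] by (simp add: X_def)
  let ?S = "ind_tensor M (const_ob M (dual M X)) W" and ?T = "ind_ihom M X W"
  let ?\<delta> = "dual_tensor_to_ind_ihom M X W"
  obtain \<gamma> where \<gamma>: "inverse_arrows (Ind M) ?\<delta> \<gamma>"
    using assms(2) X unfolding nuclear_def is_iso_def by blast
  have st: "isrc ?\<delta> = ?S" "itgt ?\<delta> = ?T"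
    by (simp_all add: dual_tensor_to_ind_ihom_def ind_rep_def)
  have \<delta>: "?\<delta> \<in> homs (Ind M) ?S ?T" 
    using \<gamma> st unfolding inverse_arrows_def homs_iff by (simp add: Ind_simps)
  have \<gamma>h: "\<gamma> \<in> homs (Ind M) ?T ?S"
    using \<gamma> st unfolding inverse_arrows_def by (simp add: Ind_simps)
  have inv: "ind_cmp M ?\<delta> \<gamma> = Idn (Ind M) ?T"
    using \<gamma> st unfolding inverse_arrows_def by (simp add: Ind_simps)
  have T: "is_ind_ob M ?T" using ind_homD[OF \<delta>] by auto
  have T_simps: "idx ?T = idx W" "ile ?T = ile W" "fob ?T k = ihom M X (fob W k)"
    "far ?T a = ihom_post M X (far W a)" for k a
    by (simp_all add: ind_ihom_def)
  have jT: "j \<in> idx ?T" "fob ?T j = ihom M X X" using j by (simp_all add: T_simps X_def[symmetric])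
  obtain x f where "x \<in> idx ?S" "f \<in> homs M (fob ?T j) (fob ?S x)" "ifam \<gamma> j = germ M ?S x f"
    by (rule ind_hom_component[OF \<gamma>h jT(1)])
  then have x: "x \<in> idx ?S" "f \<in> homs M (ihom M X X) (fob ?S x)" "ifam \<gamma> j = germ M ?S x f"
    using jT(2) by simp_all
  obtain j1 where j1: "x = Duo Point j1" "j1 \<in> idx W"
    using x(1) by (auto elim!: idx_ind_tensorE)
  have f: "f \<in> homs M (ihom M X X) (dual M X \<otimes> fob W j1)" using x(2) j1 by simp
  have W1 [simp]: "fob W j1 \<in> Ob M" using ind_fob[OF W j1(2)] .
  let ?d = "dual_tensor_to_ihom M X (fob W j1)"
  have d: "?d \<in> homs M (dual M X \<otimes> fob W j1) (ihom M X (fob W j1))"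
    by (rule dual_tensor_to_ihom_uncurry) simp_all
  have df: "?d \<cdot> f \<in> homs M (ihom M X X) (ihom M X (fob W j1))" by (rule cmp_homs[OF f d])
  have "ifam ?\<delta> (Duo Point j1) = germ M ?T j1 ?d"
    using j1 by (simp add: dual_tensor_to_ind_ihom_def ind_rep_def)
  then have "ifam (ind_cmp M ?\<delta> \<gamma>) j = germ M ?T j1 (?d \<cdot> f)"
    using ifam_cmp[OF \<gamma>h \<delta>, of x f j j1 ?d] x j1 d by (simp add: T_simps X_def[symmetric])
  moreover have "ifam (Idn (Ind M) ?T) j = germ M ?T j (Idn M (ihom M X X))"
    using ifam_idn[of j ?T] j by (simp add: T_simps X_def[symmetric])
  ultimately have "germ M ?T j1 (?d \<cdot> f) = germ M ?T j (Idn M (ihom M X X))"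
    using inv by simp
  then obtain j2 where j2: "(j1, j2) \<in> ile W" "(j, j2) \<in> ile W"
    "ihom_post M X (far W (j1, j2)) \<cdot> (?d \<cdot> f) = ihom_post M X (far W (j, j2)) \<cdot> Idn M (ihom M X X)"
    using germ_eq_common[OF T, of j1 "?d \<cdot> f" j "Idn M (ihom M X X)" "ihom M X X"] df j j1 
      idn_homs[of "ihom M X X"] unfolding T_simps X_def[symmetric]
    by (metis X ihom_ob)
  note W2 = ind_fob[OF W conjunct2[OF ile_idx[OF W j2(1)]], simp]
  have \<tau>1: "far W (j1, j2) \<in> homs M (fob W j1) (fob W j2)" and \<tau>: "far W (j, j2) \<in> homs M X (fob W j2)"
    using ind_far[OF W j2(1)] ind_far[OF W j2(2)] by (auto simp: X_def)
  have ts [simp]: "far W (j1, j2) \<in> Ar M" "Dom M (far W (j1, j2)) = fob W j1" "Cod M (far W (j1, j2)) = fob W j2"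
    "far W (j, j2) \<in> Ar M" "Dom M (far W (j, j2)) = X" "Cod M (far W (j, j2)) = fob W j2"
    using \<tau> \<tau>1 by (auto simp: homs_iff)
  have fs [simp]: "f \<in> Ar M" "Dom M f = ihom M X X" "Cod M f = dual M X \<otimes> fob W j1"
    "?d \<in> Ar M" "Dom M ?d = dual M X \<otimes> fob W j1" "Cod M ?d = ihom M X (fob W j1)"
    using f d by (auto simp: homs_iff)
  \<comment> \<open>The name of the identity of \<open>X\<close>.\<close>
  define n where "n = curried M (unt M) X X (lun M X)"
  have n: "n \<in> homs M (unt M) (ihom M X X)" "evl M X X \<cdot> (n \<odot> Idn M X) = lun M X"
    using curried_property[of "unt M" X X "lun M X"] by (auto simp: n_def lun_homs)
  have ns [simp]: "n \<in> Ar M" "Dom M n = unt M" "Cod M n = ihom M X X" using n by (auto simp: homs_iff)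
  have ps: "ihom_post M X (far W (j1, j2)) \<in> homs M (ihom M X (fob W j1)) (ihom M X (fob W j2))"
    "ihom_post M X (far W (j, j2)) \<in> homs M (ihom M X X) (ihom M X (fob W j2))"
    using ind_far[OF T, of j1 j2] ind_far[OF T, of j j2] j2(1,2) by (simp_all add: T_simps X_def[symmetric])
  define t where "t = (Idn M (dual M X) \<odot> far W (j1, j2)) \<cdot> f \<cdot> n"
  have t [simp]: "t \<in> Ar M" "Dom M t = unt M" "Cod M t = dual M X \<otimes> fob W j2"
    by (simp_all add: t_def)
  let ?ev = "evl M X (unt M)"
  have ev: "?ev \<in> Ar M" "Dom M ?ev = dual M X \<otimes> X" "Cod M ?ev = unt M" by (simp_all add: dual_def)
  have "far W (j, j2) \<cdot> lun M X = evl M X (fob W j2) \<cdot> ((ihom_post M X (far W (j, j2)) \<cdot> n) \<odot> Idn M X)"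
    using ihom_post_uncurry[OF X \<tau> n(1)] n(2) by simp
  also have "ihom_post M X (far W (j, j2)) = ihom_post M X (far W (j1, j2)) \<cdot> (?d \<cdot> f)"
    using j2(3) ps(2) by (simp add: homs_iff)
  also have "(\<dots> \<cdot> n) = ihom_post M X (far W (j1, j2)) \<cdot> (?d \<cdot> f \<cdot> n)"
    using ps(1) by (simp add: homs_iff)
  also have "evl M X (fob W j2) \<cdot> (\<dots> \<odot> Idn M X) = 
      far W (j1, j2) \<cdot> evl M X (fob W j1) \<cdot> ((?d \<cdot> f \<cdot> n) \<odot> Idn M X)"
    by (rule ihom_post_uncurry[OF X \<tau>1]) (simp add: homs_iff)
  also have "\<dots> = far W (j1, j2) \<cdot> evl M X (fob W j1) \<cdot> (?d \<odot> Idn M X) \<cdot> ((f \<cdot> n) \<odot> Idn M X)"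
    by simp
  also have "\<dots> = far W (j1, j2) \<cdot> pairing_action (dual M X) X (fob W j1) ?ev \<cdot> ((f \<cdot> n) \<odot> Idn M X)"
    by (simp add: reduce[OF dual_tensor_to_ihom_uncurry(2)] del: interchange interchange_reduce)
  also have "\<dots> = pairing_action (dual M X) X (fob W j2) ?ev \<cdot> ((Idn M (dual M X) \<odot> far W (j1, j2)) \<odot> Idn M X)
      \<cdot> ((f \<cdot> n) \<odot> Idn M X)"
    using ev by (simp add: reduce2[OF pairing_action_natural] del: interchange interchange_reduce)
  also have "\<dots> = pairing_action (dual M X) X (fob W j2) ?ev \<cdot> (t \<odot> Idn M X)"
    using ev by (simp add: t_def)
  finally have "lun M (fob W j2) \<cdot> ((?ev \<cdot> braid M X (dual M X)) \<odot> Idn M (fob W j2))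
      \<cdot> inv_ar M (asc M X (dual M X) (fob W j2)) \<cdot> (Idn M X \<odot> t) \<cdot> inv_ar M (run M X) = far W (j, j2)"
    using ev by (intro pairing_action_transpose) simp_all
  moreover have "?ev \<cdot> braid M X (dual M X) \<in> homs M (X \<otimes> dual M X) (unt M)"
    "t \<in> homs M (unt M) (dual M X \<otimes> fob W j2)"
    using ev by (simp_all add: homs_iff)
  ultimately show "\<exists>j' D \<epsilon> t. (j, j') \<in> ile W \<and> D \<in> Ob M \<and>
     \<epsilon> \<in> homs M (fob W j \<otimes> D) (unt M) \<and> t \<in> homs M (unt M) (D \<otimes> fob W j') \<and>
     lun M (fob W j') \<cdot> (\<epsilon> \<odot> Idn M (fob W j')) \<cdot> inv_ar M (asc M (fob W j) D (fob W j'))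
       \<cdot> (Idn M (fob W j) \<odot> t) \<cdot> inv_ar M (run M (fob W j)) = far W (j, j')"
    using j2(2) dual_ob[OF X] unfolding X_def[symmetric] by blast
qed

end

section \<open>Tensoring preserves small limits of constant objects\<close>

context category
begin

lemma const_ar_cmp:
  assumes f: "f \<in> homs C X Y" and g: "g \<in> homs C Y Z"
  shows "ind_cmp C (const_ar C g) (const_ar C f) = (const_ar C (g \<cdot> f) :: ('u ix, 'o, 'm) ind_ar)"
    (is "?l = ?r")
proof -
  define cf cg :: "('u ix, 'o, 'm) ind_ar" where "cf = const_ar C f" and "cg = const_ar C g"
  have cf: "cf \<in> homs (Ind C) (const_ob C X) (const_ob C Y)" "ifam cf Point = germ C (const_ob C Y) Point f"
    unfolding cf_def by (rule const_ar_homs[OF f])+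
  have cg: "cg \<in> homs (Ind C) (const_ob C Y) (const_ob C Z)" "ifam cg Point = germ C (const_ob C Z) Point g"
    unfolding cg_def by (rule const_ar_homs[OF g])+
  note h = const_ar_homs[OF cmp_homs[OF f g]]
  have "ind_cmp C cg cf = const_ar C (g \<cdot> f)"
  proof (rule ind_hom_eqI[OF ind_cmp_homs[OF cf(1) cg(1)] h(1)])
    fix i :: "'u ix" assume "i \<in> idx (const_ob C X)"
    then have i: "i = Point" by simp
    show "ifam (ind_cmp C cg cf) i = ifam (const_ar C (g \<cdot> f)) i"
      unfolding i h(2) by (rule ifam_cmp[OF cf(1) cg(1) _ _ cf(2) _ _ cg(2)]) (use f g in simp_all)
  qed
  then show ?thesis by (simp add: cf_def cg_def)
qed

lemma hom_from_const:
  assumes F: "is_ind_ob C F" and k: "k \<in> idx F" and w: "w \<in> homs C Y (fob F k)"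
  shows "ind_rep C (const_ob C Y) F (\<lambda>_. k) (\<lambda>_. w) \<in> homs (Ind C) (const_ob C Y) F"
    "ifam (ind_rep C (const_ob C Y) F (\<lambda>_. k) (\<lambda>_. w)) Point = germ C F k w"
proof -
  show "ind_rep C (const_ob C Y) F (\<lambda>_. k) (\<lambda>_. w) \<in> homs (Ind C) (const_ob C Y) F"
    using k w homs_ob[OF w] cmp_idn[OF w] F by (intro ind_rep_homs const_ob_ind_ob) auto
  show "ifam (ind_rep C (const_ob C Y) F (\<lambda>_. k) (\<lambda>_. w)) Point = germ C F k w"
    by (simp add: ind_rep_def)
qed

end

text \<open>A diagram of objects \<open>A i\<close> of the base category with a limit \<open>(L, p)\<close> in the ind-completion, and an
  ind-object \<open>W\<close> with trace-class transition morphisms in which families of indices parametrised by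
  the objects, or by the arrows, of the shape \<open>J\<close> are bounded. The
  \<open>A i\<close> need not be duals.\<close>

locale constant_diagram = closed_symmetric_monoidal M
  for M :: "('o, 'm, 'z) csm_cat_scheme" (structure) +
  fixes W L :: "('u ix, 'o, 'm) ind_ob"
    and J :: "('i, 'a, 'y) cat_scheme" and A :: "'i \<Rightarrow> 'o" and d :: "'a \<Rightarrow> 'm"
    and p :: "'i \<Rightarrow> ('u ix, 'o, 'm) ind_ar"
  assumes W: "is_ind_ob M W" and trace_class: "trace_class_transitions W"
    and shape: "\<And>a. a \<in> Ar J \<Longrightarrow> Dom J a \<in> Ob J \<and> Cod J a \<in> Ob J"
    and A_ob: "\<And>i. i \<in> Ob J \<Longrightarrow> A i \<in> Ob M"
    and d_homs: "\<And>a. a \<in> Ar J \<Longrightarrow> d a \<in> homs M (A (Dom J a)) (A (Cod J a))"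
    and bounded_Ob: "\<And>s. (\<And>i. i \<in> Ob J \<Longrightarrow> s i \<in> idx W) \<Longrightarrow> \<exists>m \<in> idx W. \<forall>i \<in> Ob J. (s i, m) \<in> ile W"
    and bounded_Ar: "\<And>s. (\<And>a. a \<in> Ar J \<Longrightarrow> s a \<in> idx W) \<Longrightarrow> \<exists>m \<in> idx W. \<forall>a \<in> Ar J. (s a, m) \<in> ile W"
    and limit: "is_limit J (Ind M) \<lparr>fob = \<lambda>i. const_ob M (A i), far = \<lambda>a. const_ar M (d a)\<rparr> L p"
begin

text \<open>The constant objects and morphisms, with the universe of index sets that \<open>W\<close> and \<open>L\<close> have.\<close>

abbreviation cst :: "'o \<Rightarrow> ('u ix, 'o, 'm) ind_ob" where "cst \<equiv> const_ob M"

abbreviation cst_ar :: "'m \<Rightarrow> ('u ix, 'o, 'm) ind_ar" where "cst_ar \<equiv> const_ar M"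

lemma cst_ar_homs:
  assumes "f \<in> homs M X Y"
  shows "cst_ar f \<in> homs (Ind M) (cst X) (cst Y)" "ifam (cst_ar f) Point = germ M (cst Y) Point f"
  by (rule const_ar_homs[OF assms])+

lemma cst_ind_ob: "X \<in> Ob M \<Longrightarrow> is_ind_ob M (cst X)"
  by (rule const_ob_ind_ob)

lemma cst_ar_cmp:
  "f \<in> homs M X Y \<Longrightarrow> g \<in> homs M Y Z \<Longrightarrow> ind_cmp M (cst_ar g) (cst_ar f) = cst_ar (g \<cdot> f)"
  by (rule const_ar_cmp)

lemma germ_cst:
  "f \<in> homs M Y X \<Longrightarrow> g \<in> homs M Y X \<Longrightarrow> germ M (cst X) Point f = germ M (cst X) Point g \<longleftrightarrow> f = g"
  by (rule germ_const)

text \<open>The diagram of the \<open>A i\<close>, the objects \<open>A i \<otimes> W\<close>, and \<open>L \<otimes> W\<close>.\<close>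

abbreviation diag where
  "diag \<equiv> \<lparr>fob = \<lambda>i. cst (A i), far = \<lambda>a. cst_ar (d a)\<rparr>"

abbreviation AW where "AW i \<equiv> ind_tensor M (cst (A i)) W"

abbreviation LW where "LW \<equiv> ind_tensor M L W"

lemma cone: "is_cone J (Ind M) diag L p"
  using limit by (simp add: is_limit_def)

lemma L: "is_ind_ob M L"
  using cone by (simp add: is_cone_def Ind_simps)

lemma p_homs: "i \<in> Ob J \<Longrightarrow> p i \<in> homs (Ind M) L (cst (A i))"
  using cone by (simp add: is_cone_def)

lemma LW: "is_ind_ob M LW"
  by (rule ind_tensor_ind_ob[OF L W])

lemma AW: "i \<in> Ob J \<Longrightarrow> is_ind_ob M (AW i)"
  by (intro ind_tensor_ind_ob cst_ind_ob W A_ob)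

text \<open>The component \<open>L_k \<rightarrow> A i\<close> of the projection \<open>p i\<close>; it is unique by \<open>germ_cst\<close>.\<close>

definition proj where
  "proj i k = (SOME f. f \<in> homs M (fob L k) (A i) \<and> ifam (p i) k = germ M (cst (A i)) Point f)"

lemma proj_homs: "i \<in> Ob J \<Longrightarrow> k \<in> idx L \<Longrightarrow> proj i k \<in> homs M (fob L k) (A i)"
  and ifam_p: "i \<in> Ob J \<Longrightarrow> k \<in> idx L \<Longrightarrow> ifam (p i) k = germ M (cst (A i)) Point (proj i k)"
proof -
  have *: "proj i k \<in> homs M (fob L k) (A i) \<and> ifam (p i) k = germ M (cst (A i)) Point (proj i k)"
    if "i \<in> Ob J" "k \<in> idx L"
  proof -
    have "\<exists>f. f \<in> homs M (fob L k) (A i) \<and> ifam (p i) k = germ M (cst (A i)) Point f"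
      using const_component[OF p_homs[OF that(1)] that(2)] by metis
    then show ?thesis unfolding proj_def by (rule someI_ex)
  qed
  show "i \<in> Ob J \<Longrightarrow> k \<in> idx L \<Longrightarrow> proj i k \<in> homs M (fob L k) (A i)" using * by blast
  show "i \<in> Ob J \<Longrightarrow> k \<in> idx L \<Longrightarrow> ifam (p i) k = germ M (cst (A i)) Point (proj i k)" using * by blast
qed

lemma proj_far:
  assumes i: "i \<in> Ob J" and k: "(k, k') \<in> ile L"
  shows "proj i k' \<cdot> far L (k, k') = proj i k"
proof -
  have kk: "k \<in> idx L" "k' \<in> idx L" using ile_idx[OF L k] by auto
  have h: "proj i k' \<cdot> far L (k, k') \<in> homs M (fob L k) (A i)"
    by (rule cmp_homs[OF ind_far[OF L k] proj_homs[OF i kk(2)]])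
  show ?thesis
    using ind_homD(6)[OF p_homs[OF i] k, of Point "proj i k'"] proj_homs[OF i kk(2)] ifam_p[OF i]
      kk germ_cst[OF h proj_homs[OF i kk(1)]] by simp
qed

lemma proj_d:
  assumes a: "a \<in> Ar J" and k: "k \<in> idx L"
  shows "d a \<cdot> proj (Dom J a) k = proj (Cod J a) k"
proof -
  have ob: "Dom J a \<in> Ob J" "Cod J a \<in> Ob J" using shape[OF a] by auto
  have h: "d a \<cdot> proj (Dom J a) k \<in> homs M (fob L k) (A (Cod J a))"
    by (rule cmp_homs[OF proj_homs[OF ob(1) k] d_homs[OF a]])
  have "ind_cmp M (cst_ar (d a)) (p (Dom J a)) = p (Cod J a)"
    using cone a by (simp add: is_cone_def Ind_simps)
  moreover have "ifam (ind_cmp M (cst_ar (d a)) (p (Dom J a))) k =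
      germ M (cst (A (Cod J a))) Point (d a \<cdot> proj (Dom J a) k)"
    using ifam_cmp[OF p_homs[OF ob(1)] cst_ar_homs(1)[OF d_homs[OF a]] _ _ ifam_p[OF ob(1) k] _ _
        cst_ar_homs(2)[OF d_homs[OF a]]] proj_homs[OF ob(1) k] d_homs[OF a] by simp
  ultimately show ?thesis
    using ifam_p[OF ob(2) k] germ_cst[OF h proj_homs[OF ob(2) k]] by simp
qed

text \<open>A morphism from a constant object to \<open>L\<close> is given by some \<open>w : Y \<rightarrow> L_k\<close>. The next lemmas restate
  the universal property of \<open>L\<close> for such morphisms inside the base category.\<close>

lemma cmp_hom_from_const:
  assumes "i \<in> Ob J" "k \<in> idx L" "w \<in> homs M Y (fob L k)"
  shows "ind_cmp M (p i) (ind_rep M (cst Y) L (\<lambda>_. k) (\<lambda>_. w)) = cst_ar (proj i k \<cdot> w)"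
proof (rule ind_hom_eqI[OF ind_cmp_homs[OF hom_from_const(1)[OF L assms(2,3)] p_homs[OF assms(1)]]])
  have h: "proj i k \<cdot> w \<in> homs M Y (A i)" by (rule cmp_homs[OF assms(3) proj_homs[OF assms(1,2)]])
  show "cst_ar (proj i k \<cdot> w) \<in> homs (Ind M) (cst Y) (cst (A i))"
    by (rule cst_ar_homs(1)[OF h])
  show "ifam (ind_cmp M (p i) (ind_rep M (cst Y) L (\<lambda>_. k) (\<lambda>_. w))) x =
      ifam (cst_ar (proj i k \<cdot> w)) x" if "x \<in> idx (cst Y)" for x
    using that ifam_cmp[OF hom_from_const(1)[OF L assms(2,3)] p_homs[OF assms(1)] assms(2) _
        hom_from_const(2)[OF L assms(2,3)] _ _ ifam_p[OF assms(1,2)]] assms(3) proj_homs[OF assms(1,2)]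
      cst_ar_homs(2)[OF h] by simp
qed

lemma const_cone:
  assumes "Y \<in> Ob M" "\<And>i. i \<in> Ob J \<Longrightarrow> w i \<in> homs M Y (A i)"
    "\<And>a. a \<in> Ar J \<Longrightarrow> d a \<cdot> w (Dom J a) = w (Cod J a)"
  shows "is_cone J (Ind M) diag (cst Y) (\<lambda>i. cst_ar (w i))"
  unfolding is_cone_def
proof (intro conjI ballI)
  show "cst Y \<in> Ob (Ind M)" using cst_ind_ob[OF assms(1)] by (simp add: Ind_simps)
  show "cst_ar (w i) \<in> homs (Ind M) (cst Y) (fob diag i)" if "i \<in> Ob J" for i
    using cst_ar_homs(1)[OF assms(2)[OF that]] by simp
  show "far diag a \<cdot>\<^bsub>Ind M\<^esub> cst_ar (w (Dom J a)) = cst_ar (w (Cod J a))" if "a \<in> Ar J" for a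
    using cst_ar_cmp[OF assms(2) d_homs[OF that]] shape[OF that] assms(3)[OF that]
    by (simp add: Ind_simps)
qed

lemma lift_to_limit:
  assumes Y: "Y \<in> Ob M" and w: "\<And>i. i \<in> Ob J \<Longrightarrow> w i \<in> homs M Y (A i)"
    "\<And>a. a \<in> Ar J \<Longrightarrow> d a \<cdot> w (Dom J a) = w (Cod J a)"
  shows "\<exists>k g. k \<in> idx L \<and> g \<in> homs M Y (fob L k) \<and> (\<forall>i \<in> Ob J. proj i k \<cdot> g = w i)"
proof -
  have c: "is_cone J (Ind M) diag (cst Y) (\<lambda>i. cst_ar (w i))"
    by (rule const_cone[OF Y]) (rule w, assumption)+
  obtain \<phi> where \<phi>: "\<phi> \<in> homs (Ind M) (cst Y) L"
      "\<And>i. i \<in> Ob J \<Longrightarrow> p i \<cdot>\<^bsub>Ind M\<^esub> \<phi> = cst_ar (w i)"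
    by (rule category.limit_factorization[OF category_Ind limit c]) (rule that)
  have "Point \<in> idx (cst Y)" by simp
  then obtain k g where g: "k \<in> idx L" "g \<in> homs M (fob (cst Y) Point) (fob L k)"
      "ifam \<phi> Point = germ M L k g"
    by (rule ind_hom_component[OF \<phi>(1)])
  have g': "g \<in> homs M Y (fob L k)" using g(2) by simp
  have "proj i k \<cdot> g = w i" if i: "i \<in> Ob J" for i
  proof -
    have "ifam (ind_cmp M (p i) \<phi>) Point = germ M (cst (A i)) Point (proj i k \<cdot> g)"
      using ifam_cmp[OF \<phi>(1) p_homs[OF i] g _ _ ifam_p[OF i g(1)]] proj_homs[OF i g(1)] by simp
    moreover have "ind_cmp M (p i) \<phi> = cst_ar (w i)" using \<phi>(2)[OF i] by (simp add: Ind_simps)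
    ultimately show ?thesis
      using cst_ar_homs(2)[OF w(1)[OF i]] 
        germ_cst[OF cmp_homs[OF g' proj_homs[OF i g(1)]] w(1)[OF i]] by simp
  qed
  then show ?thesis using g(1) g' by blast
qed

lemma projections_jointly_monic:
  assumes k: "k \<in> idx L" and g: "g \<in> homs M Y (fob L k)" and h: "h \<in> homs M Y (fob L k)"
    and eq: "\<And>i. i \<in> Ob J \<Longrightarrow> proj i k \<cdot> g = proj i k \<cdot> h"
  obtains k' where "(k, k') \<in> ile L" "far L (k, k') \<cdot> g = far L (k, k') \<cdot> h"
proof -
  let ?r = "\<lambda>w. ind_rep M (cst Y) L (\<lambda>_. k) (\<lambda>_. w)"
  have Y: "Y \<in> Ob M" using homs_ob[OF g] by simp
  have c: "is_cone J (Ind M) diag (cst Y) (\<lambda>i. cst_ar (proj i k \<cdot> g))"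
  proof (rule const_cone[OF Y])
    show "proj i k \<cdot> g \<in> homs M Y (A i)" if "i \<in> Ob J" for i
      by (rule cmp_homs[OF g proj_homs[OF that k]])
    show "d a \<cdot> (proj (Dom J a) k \<cdot> g) = proj (Cod J a) k \<cdot> g" if a: "a \<in> Ar J" for a
      using cmp_assoc[OF g proj_homs[OF _ k] d_homs[OF a]] shape[OF a] proj_d[OF a k] by simp
  qed
  have "?r g = ?r h"
    by (rule category.limit_factorization_unique[OF category_Ind limit c hom_from_const(1)[OF L k g]
          hom_from_const(1)[OF L k h]])
      (use cmp_hom_from_const[OF _ k g] cmp_hom_from_const[OF _ k h] eq in \<open>simp_all add: Ind_simps\<close>)
  then have "germ M L k g = germ M L k h"
    using hom_from_const(2)[OF L k g] hom_from_const(2)[OF L k h] by simp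
  then show ?thesis
    using germ_eq_common[OF L _ k g k h] that by metis
qed

text \<open>The trace-class property in the form in which it is used.\<close>

lemma contract_expand:
  assumes "j \<in> idx W"
  obtains j' D \<epsilon> t where "(j, j') \<in> ile W" "D \<in> Ob M" "\<epsilon> \<in> homs M (fob W j \<otimes> D) (unt M)"
    "t \<in> homs M (unt M) (D \<otimes> fob W j')"
    "\<And>B X f. B \<in> Ob M \<Longrightarrow> f \<in> homs M X (B \<otimes> fob W j) \<Longrightarrow> 
      expand X D (fob W j') t (contract B (fob W j) D \<epsilon> f) = (Idn M B \<odot> far W (j, j')) \<cdot> f"
proof -
  obtain j' D \<epsilon> t where *: "(j, j') \<in> ile W" "D \<in> Ob M" "\<epsilon> \<in> homs M (fob W j \<otimes> D) (unt M)"
    "t \<in> homs M (unt M) (D \<otimes> fob W j')"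
    "lun M (fob W j') \<cdot> (\<epsilon> \<odot> Idn M (fob W j')) \<cdot> inv_ar M (asc M (fob W j) D (fob W j'))
       \<cdot> (Idn M (fob W j) \<odot> t) \<cdot> inv_ar M (run M (fob W j)) = far W (j, j')"
    using trace_class assms unfolding trace_class_transitions_def by meson
  have "expand X D (fob W j') t (contract B (fob W j) D \<epsilon> f) = (Idn M B \<odot> far W (j, j')) \<cdot> f"
    if "B \<in> Ob M" "f \<in> homs M X (B \<otimes> fob W j)" for B X f
    using that * ind_fob[OF W] ile_idx[OF W *(1)]
    by (intro expand_contract) (auto simp: homs_iff)
  then show ?thesis using that * by blast
qed

lemma contract_homs:
  assumes "B \<in> Ob M" "X' \<in> Ob M" "D \<in> Ob M" "\<epsilon> \<in> homs M (X' \<otimes> D) (unt M)" "f \<in> homs M X (B \<otimes> X')"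
  shows "contract B X' D \<epsilon> f \<in> homs M (X \<otimes> D) B"
  using assms by (simp add: homs_iff)

lemma expand_homs:
  assumes "X \<in> Ob M" "D \<in> Ob M" "B' \<in> Ob M" "t \<in> homs M (unt M) (D \<otimes> B')" "g \<in> homs M (X \<otimes> D) B"
  shows "expand X D B' t g \<in> homs M X (B \<otimes> B')"
  using assms by (simp add: homs_iff)

text \<open>After contraction \<open>u\<close> and \<open>v\<close> become morphisms \<open>X \<otimes> D \<rightarrow> L_k\<close> with the same projections, so they
  agree in some \<open>L_k'\<close>; expanding shows that \<open>u\<close> and \<open>v\<close> agree in \<open>L_k' \<otimes> W_j'\<close>.\<close>

lemma LW_germ_unique_strict:
  assumes k: "k \<in> idx L" and j: "j \<in> idx W" and u: "u \<in> homs M X (fob L k \<otimes> fob W j)"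
    and v: "v \<in> homs M X (fob L k \<otimes> fob W j)"
    and eq: "\<And>i. i \<in> Ob J \<Longrightarrow> (proj i k \<odot> Idn M (fob W j)) \<cdot> u = (proj i k \<odot> Idn M (fob W j)) \<cdot> v"
  shows "germ M LW (Duo k j) u = germ M LW (Duo k j) v"
proof -
  obtain j' D \<epsilon> t where t: "(j, j') \<in> ile W" "D \<in> Ob M" "\<epsilon> \<in> homs M (fob W j \<otimes> D) (unt M)"
    "t \<in> homs M (unt M) (D \<otimes> fob W j')"
    and zigzag: "\<And>B X f. B \<in> Ob M \<Longrightarrow> f \<in> homs M X (B \<otimes> fob W j) \<Longrightarrow> 
      expand X D (fob W j') t (contract B (fob W j) D \<epsilon> f) = (Idn M B \<odot> far W (j, j')) \<cdot> f"
    using contract_expand[OF j] by metis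
  let ?c = "\<lambda>B. contract B (fob W j) D \<epsilon>"
  note Wj = ind_fob[OF W j] and Lk = ind_fob[OF L k]
  have c: "?c (fob L k) f \<in> homs M (X \<otimes> D) (fob L k)" if "f \<in> homs M X (fob L k \<otimes> fob W j)" for f
    by (rule contract_homs[OF Lk Wj t(2,3) that])
  have nat: "?c B ((a \<odot> Idn M (fob W j)) \<cdot> f) = a \<cdot> ?c (fob L k) f"
    if "f \<in> homs M X (fob L k \<otimes> fob W j)" "a \<in> homs M (fob L k) B" for a B f
    using that t Wj by (intro contract_natural) (auto simp: homs_iff)
  have "proj i k \<cdot> ?c (fob L k) u = proj i k \<cdot> ?c (fob L k) v" if i: "i \<in> Ob J" for i
    using nat[OF u proj_homs[OF i k]] nat[OF v proj_homs[OF i k]] eq[OF i] by simp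
  then obtain k' where k': "(k, k') \<in> ile L" 
      "far L (k, k') \<cdot> ?c (fob L k) u = far L (k, k') \<cdot> ?c (fob L k) v"
    using projections_jointly_monic[OF k c[OF u] c[OF v]] by metis
  note l = ind_far[OF L k'(1)] and w = ind_far[OF W t(1)]
  have Lk': "fob L k' \<in> Ob M" using homs_ob[OF l] by simp
  have "(Idn M (fob L k') \<odot> far W (j, j')) \<cdot> (far L (k, k') \<odot> Idn M (fob W j)) \<cdot> f
      = expand X D (fob W j') t (far L (k, k') \<cdot> ?c (fob L k) f)"
    if f: "f \<in> homs M X (fob L k \<otimes> fob W j)" for f
    using zigzag[OF Lk' cmp_homs[OF f tar_homs[OF l idn_homs[OF Wj]]]] nat[OF f l] by simp
  then have "(Idn M (fob L k') \<odot> far W (j, j')) \<cdot> (far L (k, k') \<odot> Idn M (fob W j)) \<cdot> u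
      = (Idn M (fob L k') \<odot> far W (j, j')) \<cdot> (far L (k, k') \<odot> Idn M (fob W j)) \<cdot> v"
    using u v k'(2) by metis
  then have "far LW (Duo k j, Duo k' j') \<cdot> u = far LW (Duo k j, Duo k' j') \<cdot> v"
    using u v l w Wj Lk' by (simp add: homs_iff)
  moreover have "Duo k j \<in> idx LW" "u \<in> homs M X (fob LW (Duo k j))" "v \<in> homs M X (fob LW (Duo k j))"
    "(Duo k j, Duo k' j') \<in> ile LW"
    using k j u v k'(1) t(1) by simp_all
  ultimately show ?thesis
    using germ_eq_iff[OF LW] by blast
qed

lemma bounded_Ob':
  assumes "\<And>i. i \<in> Ob J \<Longrightarrow> s i \<in> idx W" "j \<in> idx W"
  obtains m where "(j, m) \<in> ile W" "\<And>i. i \<in> Ob J \<Longrightarrow> (s i, m) \<in> ile W"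
proof -
  obtain m where m: "m \<in> idx W" "\<And>i. i \<in> Ob J \<Longrightarrow> (s i, m) \<in> ile W"
    using bounded_Ob[of s] assms(1) by blast
  obtain n where "(j, n) \<in> ile W" "(m, n) \<in> ile W" using ile_upper[OF W assms(2) m(1)] by blast
  then show ?thesis using that ile_trans[OF W] m(2) by blast
qed

lemma bounded_Ar':
  assumes "\<And>a. a \<in> Ar J \<Longrightarrow> s a \<in> idx W" "j \<in> idx W"
  obtains m where "(j, m) \<in> ile W" "\<And>a. a \<in> Ar J \<Longrightarrow> (s a, m) \<in> ile W"
proof -
  obtain m where m: "m \<in> idx W" "\<And>a. a \<in> Ar J \<Longrightarrow> (s a, m) \<in> ile W"
    using bounded_Ar[of s] assms(1) by blast
  obtain n where "(j, n) \<in> ile W" "(m, n) \<in> ile W" using ile_upper[OF W assms(2) m(1)] by blast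
  then show ?thesis using that ile_trans[OF W] m(2) by blast
qed

lemma AW_germ_eq:
  assumes i: "i \<in> Ob J" and j: "j \<in> idx W" "j' \<in> idx W"
    and f: "f \<in> homs M X (A i \<otimes> fob W j)" and g: "g \<in> homs M X (A i \<otimes> fob W j')"
  shows "germ M (AW i) (Duo Point j) f = germ M (AW i) (Duo Point j') g \<longleftrightarrow>
    (\<exists>m. (j, m) \<in> ile W \<and> (j', m) \<in> ile W \<and>
       (Idn M (A i) \<odot> far W (j, m)) \<cdot> f = (Idn M (A i) \<odot> far W (j', m)) \<cdot> g)" (is "_ \<longleftrightarrow> ?r")
proof -
  have "germ M (AW i) (Duo Point j) f = germ M (AW i) (Duo Point j') g \<longleftrightarrow>
    (\<exists>l. (Duo Point j, l) \<in> ile (AW i) \<and> (Duo Point j', l) \<in> ile (AW i) \<and>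
       far (AW i) (Duo Point j, l) \<cdot> f = far (AW i) (Duo Point j', l) \<cdot> g)" (is "_ \<longleftrightarrow> ?s")
    by (rule germ_eq_iff[OF AW[OF i]]) (use j f g in auto)
  moreover have "?s \<longleftrightarrow> ?r"
  proof
    assume ?s
    then obtain l where l: "(Duo Point j, l) \<in> ile (AW i)" "(Duo Point j', l) \<in> ile (AW i)"
       "far (AW i) (Duo Point j, l) \<cdot> f = far (AW i) (Duo Point j', l) \<cdot> g" by blast
    obtain m where m: "l = Duo Point m" using l(1) by (auto elim!: ile_ind_tensorE)
    show ?r using l unfolding m by auto
  next
    assume ?r
    then obtain m where "(j, m) \<in> ile W" "(j', m) \<in> ile W"
       "(Idn M (A i) \<odot> far W (j, m)) \<cdot> f = (Idn M (A i) \<odot> far W (j', m)) \<cdot> g" by blast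
    then show ?s by (intro exI[of _ "Duo Point m"]) simp
  qed
  ultimately show ?thesis by blast
qed

lemma AW_germ_push:
  assumes i: "i \<in> Ob J" and j: "(j, m) \<in> ile W" and f: "f \<in> homs M X (A i \<otimes> fob W j)"
  shows "(Idn M (A i) \<odot> far W (j, m)) \<cdot> f \<in> homs M X (A i \<otimes> fob W m)"
    "germ M (AW i) (Duo Point m) ((Idn M (A i) \<odot> far W (j, m)) \<cdot> f) = germ M (AW i) (Duo Point j) f"
proof -
  show "(Idn M (A i) \<odot> far W (j, m)) \<cdot> f \<in> homs M X (A i \<otimes> fob W m)"
    by (rule cmp_homs[OF f tar_homs[OF idn_homs[OF A_ob[OF i]] ind_far[OF W j]]])
  show "germ M (AW i) (Duo Point m) ((Idn M (A i) \<odot> far W (j, m)) \<cdot> f) = germ M (AW i) (Duo Point j) f"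
    using germ_far[OF AW[OF i], of "Duo Point j" "Duo Point m" f X] j f by simp
qed

lemma AW_push_push:
  assumes i: "i \<in> Ob J" and j: "(j, m) \<in> ile W" "(m, n) \<in> ile W" and f: "f \<in> homs M X (A i \<otimes> fob W j)"
  shows "(Idn M (A i) \<odot> far W (m, n)) \<cdot> ((Idn M (A i) \<odot> far W (j, m)) \<cdot> f) = (Idn M (A i) \<odot> far W (j, n)) \<cdot> f"
  using far_assoc[OF AW[OF i], of "Duo Point j" "Duo Point m" "Duo Point n" f X] j f by simp

text \<open>A morphism from \<open>X\<close> to \<open>L \<otimes> W\<close> is determined by its projections. Equality of the \<open>i\<close>-th projections
  holds at an index \<open>s i\<close> of \<open>W\<close> that depends on \<open>i\<close>; a common bound reduces the claim to the strict
  case.\<close>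

lemma LW_germ_unique:
  assumes k: "k \<in> idx L" "k' \<in> idx L" and j: "j \<in> idx W" "j' \<in> idx W" 
    and u: "u \<in> homs M X (fob L k \<otimes> fob W j)" and v: "v \<in> homs M X (fob L k' \<otimes> fob W j')"
    and eq: "\<And>i. i \<in> Ob J \<Longrightarrow> germ M (AW i) (Duo Point j) ((proj i k \<odot> Idn M (fob W j)) \<cdot> u) =
        germ M (AW i) (Duo Point j') ((proj i k' \<odot> Idn M (fob W j')) \<cdot> v)"
  shows "germ M LW (Duo k j) u = germ M LW (Duo k' j') v"
proof -
  note Wj = ind_fob[OF W j(1)] ind_fob[OF W j(2)]
  have pu: "(proj i k \<odot> Idn M (fob W j)) \<cdot> u \<in> homs M X (A i \<otimes> fob W j)"
    and pv: "(proj i k' \<odot> Idn M (fob W j')) \<cdot> v \<in> homs M X (A i \<otimes> fob W j')" if "i \<in> Ob J" for i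
    using cmp_homs[OF u tar_homs[OF proj_homs[OF that k(1)] idn_homs[OF Wj(1)]]]
      cmp_homs[OF v tar_homs[OF proj_homs[OF that k(2)] idn_homs[OF Wj(2)]]] by auto
  have "\<exists>m. (j, m) \<in> ile W \<and> (j', m) \<in> ile W \<and>
       (Idn M (A i) \<odot> far W (j, m)) \<cdot> ((proj i k \<odot> Idn M (fob W j)) \<cdot> u) =
       (Idn M (A i) \<odot> far W (j', m)) \<cdot> ((proj i k' \<odot> Idn M (fob W j')) \<cdot> v)" if "i \<in> Ob J" for i
    using AW_germ_eq[OF that j pu[OF that] pv[OF that]] eq[OF that] by blast
  then obtain s where s: "\<And>i. i \<in> Ob J \<Longrightarrow> (j, s i) \<in> ile W" "\<And>i. i \<in> Ob J \<Longrightarrow> (j', s i) \<in> ile W"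
       "\<And>i. i \<in> Ob J \<Longrightarrow> (Idn M (A i) \<odot> far W (j, s i)) \<cdot> ((proj i k \<odot> Idn M (fob W j)) \<cdot> u) =
       (Idn M (A i) \<odot> far W (j', s i)) \<cdot> ((proj i k' \<odot> Idn M (fob W j')) \<cdot> v)"
    by metis
  obtain j0 where j0: "(j, j0) \<in> ile W" "(j', j0) \<in> ile W" using ile_upper[OF W j] by blast
  obtain k0 where k0: "(k, k0) \<in> ile L" "(k', k0) \<in> ile L" using ile_upper[OF L k] by blast
  obtain m where m: "(j0, m) \<in> ile W" "\<And>i. i \<in> Ob J \<Longrightarrow> (s i, m) \<in> ile W"
    using bounded_Ob'[of s j0] s(1) j0 ile_idx[OF W] by blast
  have jm: "(j, m) \<in> ile W" "(j', m) \<in> ile W" using ile_trans[OF W] j0 m(1) by blast+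
  let ?u = "far LW (Duo k j, Duo k0 m) \<cdot> u" and ?v = "far LW (Duo k' j', Duo k0 m) \<cdot> v"
  have le: "(Duo k j, Duo k0 m) \<in> ile LW" "(Duo k' j', Duo k0 m) \<in> ile LW" using k0 jm by auto
  have uv: "u \<in> homs M X (fob LW (Duo k j))" "v \<in> homs M X (fob LW (Duo k' j'))" using u v by auto
  have km: "k0 \<in> idx L" "m \<in> idx W" using ile_idx[OF L k0(1)] ile_idx[OF W jm(1)] by auto
  have h: "?u \<in> homs M X (fob L k0 \<otimes> fob W m)" "?v \<in> homs M X (fob L k0 \<otimes> fob W m)"
    using cmp_homs[OF uv(1) ind_far[OF LW le(1)]] cmp_homs[OF uv(2) ind_far[OF LW le(2)]] by auto
  have push: "(proj i k0 \<odot> Idn M (fob W m)) \<cdot> (far LW (Duo l n, Duo k0 m) \<cdot> w) =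
      (Idn M (A i) \<odot> far W (s i, m)) \<cdot> ((Idn M (A i) \<odot> far W (n, s i)) \<cdot> ((proj i l \<odot> Idn M (fob W n)) \<cdot> w))"
    if i: "i \<in> Ob J" and ln: "(l, k0) \<in> ile L" "(n, s i) \<in> ile W" and w: "w \<in> homs M X (fob L l \<otimes> fob W n)"
    for i l n w
  proof -
    have "l \<in> idx L" "n \<in> idx W" using ile_idx[OF L ln(1)] ile_idx[OF W ln(2)] by auto
    then show ?thesis
      using w proj_homs[OF i km(1)] proj_homs[OF i, of l] ind_far[OF L ln(1)] ind_far[OF W ln(2)] 
        ind_far[OF W m(2)[OF i]] ind_far_cmp[OF W ln(2) m(2)[OF i]] ind_fob[OF W] km A_ob[OF i]
        proj_far[OF i ln(1)] ind_far[OF W ile_trans[OF W ln(2) m(2)[OF i]]]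
      by (simp add: homs_iff)
  qed
  have "(proj i k0 \<odot> Idn M (fob W m)) \<cdot> ?u = (proj i k0 \<odot> Idn M (fob W m)) \<cdot> ?v" if i: "i \<in> Ob J" for i
    using push[OF i k0(1) s(1)[OF i] u] push[OF i k0(2) s(2)[OF i] v] s(3)[OF i] by simp
  then have "germ M LW (Duo k0 m) ?u = germ M LW (Duo k0 m) ?v"
    by (rule LW_germ_unique_strict[OF km h])
  then show ?thesis
    using germ_far[OF LW le(1) uv(1)] germ_far[OF LW le(2) uv(2)] by simp
qed

text \<open>Compatible morphisms from an object \<open>X\<close> of the base category into the objects \<open>A i \<otimes> W\<close>
  come from a morphism \<open>X \<rightarrow> L \<otimes> W\<close>. Bounding first the indices at which the morphisms live and then
  those at which the compatibilities hold makes them strictly compatible morphisms \<open>r1 i : X \<rightarrow> A i \<otimes> W_m\<close>.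
  Their contractions \<open>X \<otimes> D \<rightarrow> A i\<close> form a cone, hence factor through some \<open>L_k\<close>, and the factorisation
  is expanded again.\<close>

lemma LW_germ_exists:
  assumes X: "X \<in> Ob M" and j: "\<And>i. i \<in> Ob J \<Longrightarrow> j i \<in> idx W"
    and r: "\<And>i. i \<in> Ob J \<Longrightarrow> r i \<in> homs M X (A i \<otimes> fob W (j i))"
    and compat: "\<And>a. a \<in> Ar J \<Longrightarrow> 
      germ M (AW (Cod J a)) (Duo Point (j (Dom J a))) ((d a \<odot> Idn M (fob W (j (Dom J a)))) \<cdot> r (Dom J a))
      = germ M (AW (Cod J a)) (Duo Point (j (Cod J a))) (r (Cod J a))"
  shows "\<exists>k l u. k \<in> idx L \<and> l \<in> idx W \<and> u \<in> homs M X (fob L k \<otimes> fob W l) \<and>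
    (\<forall>i \<in> Ob J. germ M (AW i) (Duo Point l) ((proj i k \<odot> Idn M (fob W l)) \<cdot> u)
       = germ M (AW i) (Duo Point (j i)) (r i))"
proof -
  obtain j0 where j0: "j0 \<in> idx W" "\<And>i. i \<in> Ob J \<Longrightarrow> (j i, j0) \<in> ile W"
    using bounded_Ob[of j] j by blast
  note Wj0 = ind_fob[OF W j0(1)]
  \<comment> \<open>All morphisms at a common index \<open>j0\<close>.\<close>
  define r0 where "r0 i = (Idn M (A i) \<odot> far W (j i, j0)) \<cdot> r i" for i
  have r0: "r0 i \<in> homs M X (A i \<otimes> fob W j0)" 
    "germ M (AW i) (Duo Point j0) (r0 i) = germ M (AW i) (Duo Point (j i)) (r i)" if "i \<in> Ob J" for i
    using AW_germ_push[OF that j0(2)[OF that] r[OF that]] by (auto simp: r0_def)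
  have slide: "(d a \<odot> Idn M (fob W n)) \<cdot> ((Idn M (A (Dom J a)) \<odot> far W (l, n)) \<cdot> f) =
      (Idn M (A (Cod J a)) \<odot> far W (l, n)) \<cdot> ((d a \<odot> Idn M (fob W l)) \<cdot> f)"
    if a: "a \<in> Ar J" and ln: "(l, n) \<in> ile W" and f: "f \<in> homs M X (A (Dom J a) \<otimes> fob W l)" for a l n f
    using d_homs[OF a] shape[OF a] A_ob ind_far[OF W ln] f ind_fob[OF W] ile_idx[OF W ln]
    by (simp add: homs_iff)
  have dr: "(d a \<odot> Idn M (fob W l)) \<cdot> f \<in> homs M X (A (Cod J a) \<otimes> fob W l)"
    if "a \<in> Ar J" "l \<in> idx W" "f \<in> homs M X (A (Dom J a) \<otimes> fob W l)" for a l f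
    by (rule cmp_homs[OF that(3) tar_homs[OF d_homs[OF that(1)] idn_homs[OF ind_fob[OF W that(2)]]]])
  have "\<exists>m. (j0, m) \<in> ile W \<and> (Idn M (A (Cod J a)) \<odot> far W (j0, m)) \<cdot> ((d a \<odot> Idn M (fob W j0)) \<cdot> r0 (Dom J a))
     = (Idn M (A (Cod J a)) \<odot> far W (j0, m)) \<cdot> r0 (Cod J a)" if a: "a \<in> Ar J" for a
  proof -
    have ob: "Dom J a \<in> Ob J" "Cod J a \<in> Ob J" using shape[OF a] by auto
    have "germ M (AW (Cod J a)) (Duo Point j0) ((d a \<odot> Idn M (fob W j0)) \<cdot> r0 (Dom J a)) =
      germ M (AW (Cod J a)) (Duo Point (j (Dom J a))) ((d a \<odot> Idn M (fob W (j (Dom J a)))) \<cdot> r (Dom J a))"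
      unfolding r0_def slide[OF a j0(2)[OF ob(1)] r[OF ob(1)]]
      by (rule AW_germ_push(2)[OF ob(2) j0(2)[OF ob(1)] dr[OF a j[OF ob(1)] r[OF ob(1)]]])
    also have "\<dots> = germ M (AW (Cod J a)) (Duo Point j0) (r0 (Cod J a))"
      using compat[OF a] r0(2)[OF ob(2)] by simp
    finally show ?thesis
      using AW_germ_eq[OF ob(2) j0(1) j0(1) dr[OF a j0(1) r0(1)[OF ob(1)]] r0(1)[OF ob(2)]] by blast
  qed
  then obtain s where s: "\<And>a. a \<in> Ar J \<Longrightarrow> (j0, s a) \<in> ile W"
    "\<And>a. a \<in> Ar J \<Longrightarrow> (Idn M (A (Cod J a)) \<odot> far W (j0, s a)) \<cdot> ((d a \<odot> Idn M (fob W j0)) \<cdot> r0 (Dom J a))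
     = (Idn M (A (Cod J a)) \<odot> far W (j0, s a)) \<cdot> r0 (Cod J a)" by metis
  obtain m where m: "(j0, m) \<in> ile W" "\<And>a. a \<in> Ar J \<Longrightarrow> (s a, m) \<in> ile W"
    using bounded_Ar'[of s j0] s(1) j0(1) ile_idx[OF W] by blast
  have mW: "m \<in> idx W" using ile_idx[OF W m(1)] by simp
  note Wm = ind_fob[OF W mW]
  \<comment> \<open>An index \<open>m\<close> at which all compatibilities hold.\<close>
  define r1 where "r1 i = (Idn M (A i) \<odot> far W (j0, m)) \<cdot> r0 i" for i
  have r1: "r1 i \<in> homs M X (A i \<otimes> fob W m)" 
    "germ M (AW i) (Duo Point m) (r1 i) = germ M (AW i) (Duo Point (j i)) (r i)" if "i \<in> Ob J" for i
    using AW_germ_push[OF that m(1) r0(1)[OF that]] r0(2)[OF that] by (auto simp: r1_def)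
  have r1_d: "(d a \<odot> Idn M (fob W m)) \<cdot> r1 (Dom J a) = r1 (Cod J a)" if a: "a \<in> Ar J" for a
  proof -
    have ob: "Dom J a \<in> Ob J" "Cod J a \<in> Ob J" using shape[OF a] by auto
    have "(d a \<odot> Idn M (fob W m)) \<cdot> r1 (Dom J a) = 
        (Idn M (A (Cod J a)) \<odot> far W (j0, m)) \<cdot> ((d a \<odot> Idn M (fob W j0)) \<cdot> r0 (Dom J a))"
      unfolding r1_def by (rule slide[OF a m(1) r0(1)[OF ob(1)]])
    also have "\<dots> = r1 (Cod J a)"
      using AW_push_push[OF ob(2) s(1)[OF a] m(2)[OF a] dr[OF a j0(1) r0(1)[OF ob(1)]]]
        AW_push_push[OF ob(2) s(1)[OF a] m(2)[OF a] r0(1)[OF ob(2)]] s(2)[OF a]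
      by (simp add: r1_def)
    finally show ?thesis .
  qed
  obtain l D \<epsilon> t where t: "(m, l) \<in> ile W" "D \<in> Ob M" "\<epsilon> \<in> homs M (fob W m \<otimes> D) (unt M)"
    "t \<in> homs M (unt M) (D \<otimes> fob W l)"
    and zigzag: "\<And>B X f. B \<in> Ob M \<Longrightarrow> f \<in> homs M X (B \<otimes> fob W m) \<Longrightarrow> 
      expand X D (fob W l) t (contract B (fob W m) D \<epsilon> f) = (Idn M B \<odot> far W (m, l)) \<cdot> f"
    using contract_expand[OF mW] by metis
  have lW: "l \<in> idx W" using ile_idx[OF W t(1)] by simp
  note Wl = ind_fob[OF W lW]
  define w where "w i = contract (A i) (fob W m) D \<epsilon> (r1 i)" for i
  have w: "w i \<in> homs M (X \<otimes> D) (A i)" if "i \<in> Ob J" for i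
    unfolding w_def by (rule contract_homs[OF A_ob[OF that] Wm t(2,3) r1(1)[OF that]])
  have w_d: "d a \<cdot> w (Dom J a) = w (Cod J a)" if a: "a \<in> Ar J" for a
  proof -
    have ob: "Dom J a \<in> Ob J" "Cod J a \<in> Ob J" using shape[OF a] by auto
    show ?thesis
      unfolding w_def r1_d[OF a, symmetric]
      by (rule contract_natural[symmetric]) (use Wm t r1(1)[OF ob(1)] d_homs[OF a] in \<open>auto simp: homs_iff\<close>)
  qed
  obtain k g where g: "k \<in> idx L" "g \<in> homs M (X \<otimes> D) (fob L k)" "\<And>i. i \<in> Ob J \<Longrightarrow> proj i k \<cdot> g = w i"
    using lift_to_limit[OF tob_ob[OF X t(2)], of w] w w_d by blast
  define u where "u = expand X D (fob W l) t g"
  have u: "u \<in> homs M X (fob L k \<otimes> fob W l)"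
    unfolding u_def by (rule expand_homs[OF X t(2) Wl t(4) g(2)])
  have "germ M (AW i) (Duo Point l) ((proj i k \<odot> Idn M (fob W l)) \<cdot> u)
       = germ M (AW i) (Duo Point (j i)) (r i)" if i: "i \<in> Ob J" for i
  proof -
    have "(proj i k \<odot> Idn M (fob W l)) \<cdot> u = expand X D (fob W l) t (proj i k \<cdot> g)"
      unfolding u_def
      by (rule expand_natural[symmetric]) (use X Wl t g(2) proj_homs[OF i g(1)] in \<open>auto simp: homs_iff\<close>)
    also have "\<dots> = (Idn M (A i) \<odot> far W (m, l)) \<cdot> r1 i"
      unfolding g(3)[OF i] w_def by (rule zigzag[OF A_ob[OF i] r1(1)[OF i]])
    finally show ?thesis
      using AW_germ_push(2)[OF i t(1) r1(1)[OF i]] r1(2)[OF i] by simp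
  qed
  then show ?thesis using g(1) lW u by blast
qed

text \<open>The projections \<open>p i \<otimes> W\<close> make \<open>L \<otimes> W\<close> a limit.\<close>

abbreviation q where "q i \<equiv> ind_tensor_ar M (p i) (Idn (Ind M) W)"

lemma q_homs: "i \<in> Ob J \<Longrightarrow> q i \<in> homs (Ind M) LW (AW i)"
  by (rule ind_tensor_ar_homs[OF p_homs idn_Ind_homs[OF W]])

lemma ifam_q:
  assumes i: "i \<in> Ob J" and k: "k \<in> idx L" and j: "j \<in> idx W"
  shows "ifam (q i) (Duo k j) = germ M (AW i) (Duo Point j) (proj i k \<odot> Idn M (fob W j))"
  using proj_homs[OF i k] idn_homs[OF ind_fob[OF W j]] 
  by (intro ifam_tensor[OF p_homs[OF i] idn_Ind_homs[OF W] k _ _ ifam_p[OF i k] j j _ ifam_idn[OF j]]) auto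

lemma ifam_q_cmp:
  assumes \<phi>: "\<phi> \<in> homs (Ind M) E LW" and i: "i \<in> Ob J" and k: "k \<in> idx L" and j: "j \<in> idx W"
    and u: "u \<in> homs M (fob E x) (fob L k \<otimes> fob W j)" "ifam \<phi> x = germ M LW (Duo k j) u"
  shows "ifam (ind_cmp M (q i) \<phi>) x = germ M (AW i) (Duo Point j) ((proj i k \<odot> Idn M (fob W j)) \<cdot> u)"
  using u k j tar_homs[OF proj_homs[OF i k] idn_homs[OF ind_fob[OF W j]]]
  by (intro ifam_cmp[OF \<phi> q_homs[OF i] _ _ u(2) _ _ ifam_q[OF i k j]]) auto

lemma q_cone: "is_cone J (Ind M) (tensor_diagram M diag W) LW q"
  unfolding is_cone_def
proof (intro conjI ballI)
  show "LW \<in> Ob (Ind M)" using LW by (simp add: Ind_simps)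
  show "q i \<in> homs (Ind M) LW (fob (tensor_diagram M diag W) i)" if "i \<in> Ob J" for i
    using q_homs[OF that] by (simp add: tensor_diagram_def)
  fix a assume a: "a \<in> Ar J"
  then have ob: "Dom J a \<in> Ob J" using shape by blast
  have "ind_cmp M (cst_ar (d a)) (p (Dom J a)) = p (Cod J a)"
    using cone a by (simp add: is_cone_def Ind_simps)
  moreover have "ind_cmp M (Idn (Ind M) W) (Idn (Ind M) W) = Idn (Ind M) W"
    using category.idn_cmp[OF category_Ind idn_Ind_homs[OF W]] by (simp add: Ind_simps(6))
  ultimately show "far (tensor_diagram M diag W) a \<cdot>\<^bsub>Ind M\<^esub> q (Dom J a) = q (Cod J a)"
    using ind_tensor_ar_cmp[OF p_homs[OF ob] cst_ar_homs(1)[OF d_homs[OF a]]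
        idn_Ind_homs[OF W] idn_Ind_homs[OF W]] by (simp add: tensor_diagram_def Ind_simps(6))
qed

text \<open>A morphism from an ind-object is glued from its components, which are compatible by uniqueness.\<close>

lemma q_factorization:
  assumes cone: "is_cone J (Ind M) (tensor_diagram M diag W) E r"
  shows "\<exists>\<phi>. \<phi> \<in> homs (Ind M) E LW \<and> (\<forall>i \<in> Ob J. ind_cmp M (q i) \<phi> = r i)"
proof -
  have E: "is_ind_ob M E" using cone by (simp add: is_cone_def Ind_simps)
  have r: "r i \<in> homs (Ind M) E (AW i)" if "i \<in> Ob J" for i
    using cone that by (simp add: is_cone_def tensor_diagram_def)
  have rd: "ind_cmp M (ind_tensor_ar M (cst_ar (d a)) (Idn (Ind M) W)) (r (Dom J a)) = r (Cod J a)"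
    if "a \<in> Ar J" for a
    using cone that by (simp add: is_cone_def tensor_diagram_def Ind_simps(6))
  have "\<exists>j f. j \<in> idx W \<and> f \<in> homs M (fob E x) (A i \<otimes> fob W j) \<and> ifam (r i) x = germ M (AW i) (Duo Point j) f"
    if i: "i \<in> Ob J" and x: "x \<in> idx E" for i x
  proof -
    obtain y f where y: "y \<in> idx (AW i)" "f \<in> homs M (fob E x) (fob (AW i) y)" "ifam (r i) x = germ M (AW i) y f"
      by (rule ind_hom_component[OF r[OF i] x])
    obtain j where j: "y = Duo Point j" "j \<in> idx W" using y(1) by (auto elim!: idx_ind_tensorE)
    show ?thesis using y(2,3) j by auto
  qed
  then obtain j f where jf: "\<And>i x. i \<in> Ob J \<Longrightarrow> x \<in> idx E \<Longrightarrow> j i x \<in> idx W"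
    "\<And>i x. i \<in> Ob J \<Longrightarrow> x \<in> idx E \<Longrightarrow> f i x \<in> homs M (fob E x) (A i \<otimes> fob W (j i x))"
    "\<And>i x. i \<in> Ob J \<Longrightarrow> x \<in> idx E \<Longrightarrow> ifam (r i) x = germ M (AW i) (Duo Point (j i x)) (f i x)"
    by metis
  have "\<exists>k l u. k \<in> idx L \<and> l \<in> idx W \<and> u \<in> homs M (fob E x) (fob L k \<otimes> fob W l) \<and>
    (\<forall>i \<in> Ob J. germ M (AW i) (Duo Point l) ((proj i k \<odot> Idn M (fob W l)) \<cdot> u) = ifam (r i) x)"
    if x: "x \<in> idx E" for x
  proof -
    have "germ M (AW (Cod J a)) (Duo Point (j (Dom J a) x)) ((d a \<odot> Idn M (fob W (j (Dom J a) x))) \<cdot> f (Dom J a) x)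
      = germ M (AW (Cod J a)) (Duo Point (j (Cod J a) x)) (f (Cod J a) x)" if a: "a \<in> Ar J" for a
    proof -
      have ob: "Dom J a \<in> Ob J" "Cod J a \<in> Ob J" using shape[OF a] by auto
      note da = cst_ar_homs[OF d_homs[OF a]]
      let ?j = "j (Dom J a) x"
      have jW: "?j \<in> idx W" using jf(1)[OF ob(1) x] .
      have "ifam (ind_tensor_ar M (cst_ar (d a)) (Idn (Ind M) W)) (Duo Point ?j) =
          germ M (AW (Cod J a)) (Duo Point ?j) (d a \<odot> Idn M (fob W ?j))"
        using d_homs[OF a] idn_homs[OF ind_fob[OF W jW]] 
        by (intro ifam_tensor[OF da(1) idn_Ind_homs[OF W] _ _ _ da(2) jW jW _ ifam_idn[OF jW]]) auto
      then have "ifam (ind_cmp M (ind_tensor_ar M (cst_ar (d a)) (Idn (Ind M) W)) (r (Dom J a))) x =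
          germ M (AW (Cod J a)) (Duo Point ?j) ((d a \<odot> Idn M (fob W ?j)) \<cdot> f (Dom J a) x)"
        using jf(2)[OF ob(1) x] jW tar_homs[OF d_homs[OF a] idn_homs[OF ind_fob[OF W jW]]]
        by (intro ifam_cmp[OF r[OF ob(1)] ind_tensor_ar_homs[OF da(1) idn_Ind_homs[OF W]] _ _ jf(3)[OF ob(1) x]]) auto
      then show ?thesis using rd[OF a] jf(3)[OF ob(2) x] by simp
    qed
    then have "\<exists>k l u. k \<in> idx L \<and> l \<in> idx W \<and> u \<in> homs M (fob E x) (fob L k \<otimes> fob W l) \<and>
      (\<forall>i \<in> Ob J. germ M (AW i) (Duo Point l) ((proj i k \<odot> Idn M (fob W l)) \<cdot> u) 
        = germ M (AW i) (Duo Point (j i x)) (f i x))"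
      using jf(1,2) x by (intro LW_germ_exists[OF ind_fob[OF E x]]) auto
    then show ?thesis using jf(3)[OF _ x] by auto
  qed
  then obtain k l u where k: "\<And>x. x \<in> idx E \<Longrightarrow> k x \<in> idx L" and l: "\<And>x. x \<in> idx E \<Longrightarrow> l x \<in> idx W"
    and u: "\<And>x. x \<in> idx E \<Longrightarrow> u x \<in> homs M (fob E x) (fob L (k x) \<otimes> fob W (l x))"
    and ur: "\<And>x i. x \<in> idx E \<Longrightarrow> i \<in> Ob J \<Longrightarrow> 
      germ M (AW i) (Duo Point (l x)) ((proj i (k x) \<odot> Idn M (fob W (l x))) \<cdot> u x) = ifam (r i) x"
    by metis
  let ?\<phi> = "ind_rep M E LW (\<lambda>x. Duo (k x) (l x)) u"
  have \<phi>: "?\<phi> \<in> homs (Ind M) E LW"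
  proof (rule ind_rep_homs[OF E LW])
    show "Duo (k x) (l x) \<in> idx LW" "u x \<in> homs M (fob E x) (fob LW (Duo (k x) (l x)))" if "x \<in> idx E" for x
      using k l u that by auto
    fix x y assume xy: "(x, y) \<in> ile E"
    then have x: "x \<in> idx E" and y: "y \<in> idx E" using ile_idx[OF E] by auto
    note uE = cmp_homs[OF ind_far[OF E xy] u[OF y]]
    show "germ M LW (Duo (k x) (l x)) (u x) = germ M LW (Duo (k y) (l y)) (u y \<cdot> far E (x, y))"
    proof (rule LW_germ_unique[OF k[OF x] k[OF y] l[OF x] l[OF y] u[OF x] uE])
      fix i assume i: "i \<in> Ob J"
      have pl: "proj i (k y) \<odot> Idn M (fob W (l y)) \<in> homs M (fob L (k y) \<otimes> fob W (l y)) (A i \<otimes> fob W (l y))"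
        by (rule tar_homs[OF proj_homs[OF i k[OF y]] idn_homs[OF ind_fob[OF W l[OF y]]]])
      have "ifam (r i) x = germ M (AW i) (Duo Point (l y)) 
          (((proj i (k y) \<odot> Idn M (fob W (l y))) \<cdot> u y) \<cdot> far E (x, y))"
        using cmp_homs[OF u[OF y] pl] l[OF y] by (intro ind_homD(6)[OF r[OF i] xy] ur[OF y i, symmetric]) auto
      then show "germ M (AW i) (Duo Point (l x)) ((proj i (k x) \<odot> Idn M (fob W (l x))) \<cdot> u x) =
        germ M (AW i) (Duo Point (l y)) ((proj i (k y) \<odot> Idn M (fob W (l y))) \<cdot> (u y \<cdot> far E (x, y)))"
        using ur[OF x i] cmp_assoc[OF ind_far[OF E xy] u[OF y] pl] by simp
    qed
  qed
  have "ind_cmp M (q i) ?\<phi> = r i" if i: "i \<in> Ob J" for i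
  proof (rule ind_hom_eqI[OF ind_cmp_homs[OF \<phi> q_homs[OF i]] r[OF i]])
    fix x assume x: "x \<in> idx E"
    have "ifam ?\<phi> x = germ M LW (Duo (k x) (l x)) (u x)" using x by (simp add: ind_rep_def)
    from ifam_q_cmp[OF \<phi> i k[OF x] l[OF x] u[OF x] this]
    show "ifam (ind_cmp M (q i) ?\<phi>) x = ifam (r i) x" using ur[OF x i] by simp
  qed
  then show ?thesis using \<phi> by blast
qed

lemma q_jointly_monic:
  assumes \<phi>: "\<phi> \<in> homs (Ind M) E LW" and \<psi>: "\<psi> \<in> homs (Ind M) E LW"
    and eq: "\<And>i. i \<in> Ob J \<Longrightarrow> ind_cmp M (q i) \<phi> = ind_cmp M (q i) \<psi>"
  shows "\<phi> = \<psi>"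
proof (rule ind_hom_eqI[OF \<phi> \<psi>])
  fix x assume x: "x \<in> idx E"
  have *: "\<exists>k j u. k \<in> idx L \<and> j \<in> idx W \<and> u \<in> homs M (fob E x) (fob L k \<otimes> fob W j) \<and>
      ifam \<chi> x = germ M LW (Duo k j) u" if \<chi>: "\<chi> \<in> homs (Ind M) E LW" for \<chi>
  proof -
    obtain y u where y: "y \<in> idx LW" "u \<in> homs M (fob E x) (fob LW y)" "ifam \<chi> x = germ M LW y u"
      by (rule ind_hom_component[OF \<chi> x])
    obtain k j where "y = Duo k j" "k \<in> idx L" "j \<in> idx W" using y(1) by (rule idx_ind_tensorE)
    then show ?thesis using y(2,3) by auto
  qed
  obtain k j u where u: "k \<in> idx L" "j \<in> idx W" "u \<in> homs M (fob E x) (fob L k \<otimes> fob W j)"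
      "ifam \<phi> x = germ M LW (Duo k j) u"
    using *[OF \<phi>] by blast
  obtain k' j' v where v: "k' \<in> idx L" "j' \<in> idx W" "v \<in> homs M (fob E x) (fob L k' \<otimes> fob W j')"
      "ifam \<psi> x = germ M LW (Duo k' j') v"
    using *[OF \<psi>] by blast
  have "germ M LW (Duo k j) u = germ M LW (Duo k' j') v"
    using ifam_q_cmp[OF \<phi> _ u] ifam_q_cmp[OF \<psi> _ v] eq
    by (intro LW_germ_unique[OF u(1) v(1) u(2) v(2) u(3) v(3)]) simp
  then show "ifam \<phi> x = ifam \<psi> x" using u(4) v(4) by simp
qed

lemma tensor_limit: "is_limit J (Ind M) (tensor_diagram M diag W) LW q"
  unfolding is_limit_def
proof (intro conjI allI impI q_cone)
  fix E r assume c: "is_cone J (Ind M) (tensor_diagram M diag W) E r"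
  obtain \<phi> where \<phi>: "\<phi> \<in> homs (Ind M) E LW" "\<forall>i \<in> Ob J. ind_cmp M (q i) \<phi> = r i"
    using q_factorization[OF c] by blast
  show "\<exists>!u. u \<in> homs (Ind M) E LW \<and> (\<forall>i \<in> Ob J. q i \<cdot>\<^bsub>Ind M\<^esub> u = r i)"
    unfolding Ind_simps(6)
  proof (rule ex1I[of _ \<phi>])
    show "\<psi> = \<phi>" if "\<psi> \<in> homs (Ind M) E LW \<and> (\<forall>i \<in> Ob J. ind_cmp M (q i) \<psi> = r i)" for \<psi>
      by (rule q_jointly_monic) (use \<phi> that in auto)
  qed (use \<phi> in blast)
qed

lemma tensor_comparison_iso:
  assumes "is_limit J (Ind M) (tensor_diagram M diag W) N s"
  shows "is_iso (Ind M) (tensor_comparison M (Ob J) W L p N s)"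
  unfolding tensor_comparison_def
  by (rule category.limit_comparison_iso[OF category_Ind tensor_limit assms])

end

section \<open>Bounds for small families of indices\<close>

lemma lambda_filtered_bound:
  assumes "lambda_filtered lam P r" "|S| <o lam" "\<And>x. x \<in> S \<Longrightarrow> s x \<in> P"
  shows "\<exists>m \<in> P. \<forall>x \<in> S. (s x, m) \<in> r"
proof -
  have "|s ` S| <o lam"
    using ordLeq_ordLess_trans[OF card_of_image assms(2)] .
  moreover have "s ` S \<subseteq> P" using assms(3) by blast
  ultimately obtain m where "m \<in> P" "\<forall>i \<in> s ` S. (i, m) \<in> r"
    using assms(1) unfolding lambda_filtered_def by blast
  then show ?thesis by blast
qed

lemma filtered_finite_bound:
  assumes P: "filtered_poset P r" and "finite S" "\<And>x. x \<in> S \<Longrightarrow> s x \<in> P"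
  shows "\<exists>m \<in> P. \<forall>x \<in> S. (s x, m) \<in> r"
  using assms(2,3)
proof (induction S rule: finite_induct)
  case empty
  then show ?case using P by (auto simp: filtered_poset_def)
next
  case (insert y S)
  then obtain m where m: "m \<in> P" "\<forall>x \<in> S. (s x, m) \<in> r" by auto
  have "s y \<in> P" using insert.prems by simp
  then obtain n where n: "n \<in> P" "(s y, n) \<in> r" "(m, n) \<in> r"
    using P m(1) by (auto simp: filtered_poset_def)
  have "trans r" using P by (auto simp: filtered_poset_def partial_order_on_def preorder_on_def)
  then have "\<forall>x \<in> insert y S. (s x, n) \<in> r" using m(2) n by (auto dest: transD)
  then show ?case using n(1) by blast
qed

text \<open>An infinite \<open>I\<close> has as many pairs as elements; for a finite \<open>I\<close>, where \<open>\<lambda>\<close> may be finite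
  as well, filteredness suffices.\<close>

lemma lambda_filtered_pairs_bound:
  assumes lam: "lambda_filtered lam P r" and P: "filtered_poset P r" and I: "|I| <o lam"
    and S: "S \<subseteq> I \<times> I" and s: "\<And>x. x \<in> S \<Longrightarrow> s x \<in> P"
  shows "\<exists>m \<in> P. \<forall>x \<in> S. (s x, m) \<in> r"
proof (cases "finite I")
  case True
  then have "finite S" using S finite_subset by blast
  then show ?thesis by (rule filtered_finite_bound[OF P _ s])
next
  case False
  then have "|I \<times> I| =o |I|" by (rule card_of_Times_same_infinite)
  then have "|S| \<le>o |I|" using card_of_mono1[OF S] ordLeq_ordIso_trans by blast
  then have "|S| <o lam" using I ordLeq_ordLess_trans by blast
  then show ?thesis by (rule lambda_filtered_bound[OF lam _ s])
qed

section \<open>Diagrams of duals\<close>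

context closed_symmetric_monoidal
begin

lemma dual_ar_homs:
  assumes f: "f \<in> homs M X Y"
  shows "dual_ar M f \<in> homs M (dual M Y) (dual M X)"
proof -
  have ob: "X \<in> Ob M" "Y \<in> Ob M" using homs_ob[OF f] by auto
  have "evl M Y (unt M) \<cdot> (Idn M (dual M Y) \<odot> f) \<in> homs M (dual M Y \<otimes> X) (unt M)"
    using f ob by (simp add: homs_iff dual_def)
  then show ?thesis
    using curried_property(1)[of "dual M Y" X "unt M"] f ob
    by (simp add: dual_ar_def homs_iff) (simp add: dual_def)
qed

end

lemma (in category) idn_const_ob:
  "X \<in> Ob C \<Longrightarrow> Idn (Ind C) (const_ob C X) = const_ar C (Idn C X)"
  by (auto simp: Ind_simps const_ar_def ind_rep_def fun_eq_iff)

theorem corollary5p9: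
  fixes M :: "('o, 'm) csm_cat" and lam :: "'l rel" and W :: "('u ix, 'o, 'm) ind_ob"
  assumes "closed_symmetric_monoidal M"
    and "has_finite_limits M"
    and "has_finite_colimits M"
    and "Card_order lam"
    and "is_ind_ob M W"
    and "lambda_filtered lam (idx W) (ile W)"
    and "nuclear M W"
  shows "(\<forall>V L p N q.
            is_ind_ob M V \<and> |idx V| <o lam \<and>
            is_limit (opposite (index_cat V)) (Ind M) (dual_diagram M V) L p \<and>
            is_limit (opposite (index_cat V)) (Ind M) (tensor_diagram M (dual_diagram M V) W) N q
            \<longrightarrow> is_iso (Ind M) (tensor_comparison M (idx V) W L p N q)) \<and>
         (lam =o cardSuc natLeq \<longrightarrow>
          (\<forall>(Vs :: nat \<Rightarrow> 'o) L p N q.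
            (\<forall>n. Vs n \<in> Ob M) \<and>
            is_product (Ind M) UNIV (\<lambda>n. const_ob M (dual M (Vs n))) L p \<and>
            is_product (Ind M) UNIV (\<lambda>n. ind_tensor M (const_ob M (dual M (Vs n))) W) N q
            \<longrightarrow> is_iso (Ind M) (tensor_comparison M UNIV W L p N q)))"
proof -
  interpret closed_symmetric_monoidal M by (rule assms(1))
  note W = assms(5)
  have filt: "filtered_poset (idx W) (ile W)" using W by (simp add: is_ind_ob_def)
  note tc = nuclear_trace_class[OF W assms(7)]
  show ?thesis
  proof (intro conjI allI impI)
    fix V :: "('u ix, 'o, 'm) ind_ob" and L p N q
    assume "is_ind_ob M V \<and> |idx V| <o lam \<and>
            is_limit (opposite (index_cat V)) (Ind M) (dual_diagram M V) L p \<and>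
            is_limit (opposite (index_cat V)) (Ind M) (tensor_diagram M (dual_diagram M V) W) N q"
    then have V: "is_ind_ob M V" and small: "|idx V| <o lam"
      and L: "is_limit (opposite (index_cat V)) (Ind M) (dual_diagram M V) L p"
      and N: "is_limit (opposite (index_cat V)) (Ind M) (tensor_diagram M (dual_diagram M V) W) N q"
      by auto
    let ?J = "opposite (index_cat V)"
    have J: "Ob ?J = idx V" "Ar ?J = ile V \<inter> idx V \<times> idx V" "Dom ?J = snd" "Cod ?J = fst"
      by (simp_all add: opposite_def poset_cat_def)
    interpret constant_diagram M W L ?J "\<lambda>i. dual M (fob V i)" "\<lambda>a. dual_ar M (far V a)" p
    proof
      show "is_limit ?J (Ind M) \<lparr>fob = \<lambda>i. const_ob M (dual M (fob V i)),
          far = \<lambda>a. const_ar M (dual_ar M (far V a))\<rparr> L p"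
        using L by (simp add: dual_diagram_def)
      show "\<exists>m \<in> idx W. \<forall>i \<in> Ob ?J. (s i, m) \<in> ile W" if "\<And>i. i \<in> Ob ?J \<Longrightarrow> s i \<in> idx W" for s
        by (rule lambda_filtered_bound[OF assms(6) _ that]) (use small in \<open>auto simp: J\<close>)
      show "\<exists>m \<in> idx W. \<forall>a \<in> Ar ?J. (s a, m) \<in> ile W" if "\<And>a. a \<in> Ar ?J \<Longrightarrow> s a \<in> idx W" for s
        by (rule lambda_filtered_pairs_bound[OF assms(6) filt small _ that]) (auto simp: J)
      show "dual_ar M (far V a) \<in> homs M (dual M (fob V (Dom ?J a))) (dual M (fob V (Cod ?J a)))"
        if "a \<in> Ar ?J" for a
        using dual_ar_homs[OF ind_far[OF V, of "fst a" "snd a"]] that unfolding J by simp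
    qed (use W tc ind_fob[OF V] in \<open>auto simp: J\<close>)
    show "is_iso (Ind M) (tensor_comparison M (idx V) W L p N q)"
      using tensor_comparison_iso[of N q] N by (simp add: J(1) dual_diagram_def)
  next
    fix Vs :: "nat \<Rightarrow> 'o" and L :: "('u ix, 'o, 'm) ind_ob" and p N q
    assume lam: "lam =o cardSuc natLeq"
    assume "(\<forall>n. Vs n \<in> Ob M) \<and>
            is_product (Ind M) UNIV (\<lambda>n. const_ob M (dual M (Vs n))) L p \<and>
            is_product (Ind M) UNIV (\<lambda>n. ind_tensor M (const_ob M (dual M (Vs n))) W) N q"
    then have Vs [simp]: "\<And>n. Vs n \<in> Ob M"
      and L: "is_product (Ind M) UNIV (\<lambda>n. const_ob M (dual M (Vs n))) L p"
      and N: "is_product (Ind M) UNIV (\<lambda>n. ind_tensor M (const_ob M (dual M (Vs n))) W) N q"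
      by auto
    \<comment> \<open>A product is a limit over a discrete poset, whose arrows are the identities.\<close>
    let ?J = "poset_cat (UNIV :: nat set) (Id_on UNIV)"
    have J: "Ob ?J = UNIV" "Ar ?J = Id" "Dom ?J = fst" "Cod ?J = snd"
      by (auto simp: poset_cat_def)
    have "natLeq <o lam"
      using cardSuc_greater[OF natLeq_Card_order] ordIso_symmetric[OF lam] ordLess_ordIso_trans by blast
    then have small: "|UNIV :: nat set| <o lam"
      using ordIso_ordLess_trans[OF card_of_nat] by blast
    interpret constant_diagram M W L ?J "\<lambda>n. dual M (Vs n)" "\<lambda>a. Idn M (dual M (Vs (fst a)))" p
    proof
      show "is_limit ?J (Ind M) \<lparr>fob = \<lambda>n. const_ob M (dual M (Vs n)),
          far = \<lambda>a. const_ar M (Idn M (dual M (Vs (fst a))))\<rparr> L p"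
        using L by (simp add: is_product_def idn_const_ob)
      show "\<exists>m \<in> idx W. \<forall>i \<in> Ob ?J. (s i, m) \<in> ile W" if "\<And>i. i \<in> Ob ?J \<Longrightarrow> s i \<in> idx W" for s
        by (rule lambda_filtered_bound[OF assms(6) _ that]) (use small in \<open>auto simp: J\<close>)
      show "\<exists>m \<in> idx W. \<forall>a \<in> Ar ?J. (s a, m) \<in> ile W" if "\<And>a. a \<in> Ar ?J \<Longrightarrow> s a \<in> idx W" for s
        by (rule lambda_filtered_pairs_bound[OF assms(6) filt small _ that]) auto
    qed (use W tc idn_homs in \<open>auto simp: J\<close>)
    have "is_limit ?J (Ind M) (tensor_diagram M diag W) N q"
      using N ind_tensor_ar_idn[OF cst_ind_ob W]
      by (simp add: is_product_def tensor_diagram_def idn_const_ob[symmetric])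
    then show "is_iso (Ind M) (tensor_comparison M UNIV W L p N q)"
      using tensor_comparison_iso[of N q] by (simp add: J(1))
  qed
qed

end
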